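(* Let $I$ be a compact interval, let $T:I\to I$ be a piecewise monotone map with natural partition $P$, let $\Sigma_+(T,P)$ be its symbolic dynamics, $\Sigma=\Sigma(T,P)$ the natural extension (invertible symbolic dynamics), $\Sigma_M\subset\Sigma$ its eventually Markov part, $K(T,P)$ its set of kneading invariants, and $\hat\Sigma$ the Hofbauer shift of $\Sigma$ with its natural projection $\hat\pi:\hat\Sigma\to\Sigma$. Then: (1) The non-Markov part $\Sigma\setminus\Sigma_M$ carries only zero entropy measures: every $\sigma$-invariant Borel probability measure $\mu$ on $\Sigma$ with $\mu(\Sigma_M)=0$ satisfies $h(\sigma,\mu)=0$. Therefore the partial isomorphism $\hat\pi$ (which is a Borel isomorphism, commuting with the shifts, from $\hat\Sigma$ onto $\Sigma_M$) is an entropy-conjugacy between $\hat\Sigma$ and $\Sigma$. (2) More precisely, except for finitely many periodic sequences, a sequence of $\Sigma(T,P)$ is shadowed at all times by $K(T,P)$ if and only if it is non-Markov at all times. (3) Moreover, $\hat\pi$ is a period-preserving bijection between the periodic orbits of $\hat\Sigma$ and their image in $\Sigma_+(T,P)$, except for finitely many periodic orbits.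
   Context: **Piecewise monotone maps.** A self-map $T$ of a compact interval $I\subset\mathbb R$ (not assumed continuous) is piecewise monotone if there is a partition of $I$ into finitely many subintervals ("pieces") on each of which the restriction of $T$ is continuous and strictly monotone. The natural partition $P$ is the set of interiors, relative to $\mathbb R$, of the pieces of such a partition of minimum cardinality. Let $c_0<c_1<\dots<c_N$ be the endpoints of the elements of $P$, so $I=[c_0,c_N]$. **Symbolic dynamics.** Let $X'=\bigcap_{k\ge0}T^{-k}\bigl(\bigcup_{A\in P}A\bigr)$. For $x\in X'$ its itinerary is $\iota(x)=(A_k)_{k\ge0}\in P^{\mathbb N}$ with $T^kx\in A_k$ for all $k\ge0$. With $P$ discrete and $P^{\mathbb N}$ given the product topology, $\Sigma_+(T,P)=\overline{\{\iota(x):x\in X'\}}\subset P^{\mathbb N}$. The left shift is denoted $\sigma$. The natural extension is $\Sigma=\Sigma(T,P)=\{A\in P^{\mathbb Z}:\forall p\in\mathbb Z,\ A_pA_{p+1}\dots\in\Sigma_+(T,P)\}$ with the shift $\sigma$. A periodic sequence of $\Sigma$ is identified with the periodic sequence of $\Sigma_+(T,P)$ given by its nonnegative coordinates; the image in $\Sigma_+(T,P)$ of a periodic orbit of $\hat\Sigma$ is understood through this identification. $h(\sigma,\mu)$ denotes the Kolmogorov-Sinai entropy. **Kneading invariants.** For $x\in I$, $\iota(x\pm)=\lim_{\epsilon\to0^+}\iota(x\pm\epsilon)$, and $K(T,P)=\{\iota(\gamma):\gamma\in\{c_0+,c_1-,c_1+,\dots,c_N-\}\}$, a finite set. **Shadowing.**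 For $S\subset\Sigma_+(T,P)$, a sequence $A\in\Sigma$ is shadowed by $S$ at time $p\in\mathbb Z$ if there are arbitrarily large integers $n$ such that the word $A_{p-n}\dots A_p$ is the beginning of a sequence in $S$. **Follower sets, Markov times.** Words are considered up to integer translation of the indices. For a word $A_{-n}\dots A_0$, $\mathrm{fol}(A_{-n}\dots A_0)=\{B_0B_1\dots\in\Sigma_+(T,P):\exists B\in\Sigma,\ B_{-n}\dots B_0=A_{-n}\dots A_0\}$. $A\in\Sigma$ is (eventually) Markov at time $p$ if there is $N$ such that $\mathrm{fol}(A_{p-n}\dots A_p)=\mathrm{fol}(A_{p-N}\dots A_p)$ for all $n\ge N$; otherwise it is non-Markov at time $p$. $\Sigma_M$ is the set of $A\in\Sigma$ that are Markov at every time $p\in\mathbb Z$. **Markov diagram and Hofbauer shift.** A word $A_{-n}\dots A_0$ of $\Sigma$ is minimal if $n=0$ or $\mathrm{fol}(A_{-n}\dots A_0)\subsetneq\mathrm{fol}(A_{-n+1}\dots A_0)$. Its minimal form is $\min(A_{-n}\dots A_0)=A_{-k}\dots A_0$ with $k\le n$ maximum such that $A_{-k}\dots A_0$ is minimal. The Markov diagram $\mathcal D$ is the oriented graph whose vertices are the minimal words of $\Sigma$, with an arrow $A_{-n}\dots A_0\to B_{-m}\dots B_0$ iff $B_{-m}\dots B_0=\min(A_{-n}\dots A_0B_0)$. The Hofbauer shift is $\hat\Sigma=\{\alpha\in\mathcal D^{\mathbb Z}:\forall p\in\mathbb Z,\ \alpha_p\to\alpha_{p+1}\text{ in }\mathcal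 D\}$ with the left shift $\sigma$, and $\hat\pi:\hat\Sigma\to\Sigma$ sends $\alpha$ to $A$ where $A_p$ is the last symbol of the word $\alpha_p$. **Entropy-conjugacy.** The source uses this term without defining it. Here it is to be read as what the preceding assertion provides: a Borel isomorphism commuting with the shifts between invariant Borel subsets (here all of $\hat\Sigma$, and $\Sigma_M\subset\Sigma$) whose complements carry only invariant probability measures of zero entropy. *)

theory Defs
  imports "HOL-Probability.Probability"
begin

section \<open>Sequences, shifts and periodic orbits\<close>

text \<open>One definition serves one-sided (index type nat) and two-sided (index type int) sequences.\<close>

definition left_shift :: "('i::{plus,one} \<Rightarrow> 's) \<Rightarrow> 'i \<Rightarrow> 's" where
  "left_shift A = (\<lambda>i. A (i + 1))"

definition seq_topology :: "'s set \<Rightarrow> ('i \<Rightarrow> 's) topology" where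
  "seq_topology E = product_topology (\<lambda>_. discrete_topology E) UNIV"

definition periodic :: "('a \<Rightarrow> 'a) \<Rightarrow> 'a \<Rightarrow> bool" where
  "periodic f x \<longleftrightarrow> (\<exists>n>0. (f ^^ n) x = x)"

text \<open>The period of a periodic orbit is its cardinality.\<close>

definition periodic_orbits :: "('a \<Rightarrow> 'a) \<Rightarrow> 'a set \<Rightarrow> 'a set set" where
  "periodic_orbits f X = {{(f ^^ n) x | n. True} | x. x \<in> X \<and> periodic f x}"

section \<open>Invariant measures and entropy\<close>

definition borel_of :: "'a topology \<Rightarrow> 'a measure" where
  "borel_of X = sigma (topspace X) {U. openin X U}"

definition invariant_prob :: "'a topology \<Rightarrow> ('a \<Rightarrow> 'a) \<Rightarrow> 'a measure \<Rightarrow> bool" where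
  "invariant_prob X f M \<longleftrightarrow>
     prob_space M \<and> sets M = sets (borel_of X) \<and> f \<in> M \<rightarrow>\<^sub>M M \<and> distr M M f = M"

text \<open>
  A finite measurable partition is given by a simple function \<open>Y\<close> with values in the naturals, its
  atoms being the nonempty fibres of \<open>Y\<close>. The fibres of \<open>name f Y n\<close> are the atoms of the join of
  the preimages of that partition under \<open>f ^^ i\<close> for \<open>i < n\<close>.
\<close>

definition name :: "('a \<Rightarrow> 'a) \<Rightarrow> ('a \<Rightarrow> nat) \<Rightarrow> nat \<Rightarrow> 'a \<Rightarrow> nat list" where
  "name f Y n x = map (\<lambda>i. Y ((f ^^ i) x)) [0..<n]"

definition partition_entropy :: "'a measure \<Rightarrow> ('a \<Rightarrow> 'b) \<Rightarrow> real" where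
  "partition_entropy M Y = prob_space.entropy M (exp 1) (count_space (Y ` space M)) Y"

definition KS_entropy :: "'a measure \<Rightarrow> ('a \<Rightarrow> 'a) \<Rightarrow> ereal" where
  "KS_entropy M f =
     (SUP Y \<in> {Y. simple_function M Y}. ereal (lim (\<lambda>n. partition_entropy M (name f Y n) / real n)))"

definition zero_entropy_outside :: "'a topology \<Rightarrow> ('a \<Rightarrow> 'a) \<Rightarrow> 'a set \<Rightarrow> bool" where
  "zero_entropy_outside X f X' \<longleftrightarrow>
     (\<forall>M. invariant_prob X f M \<longrightarrow> emeasure M X' = 0 \<longrightarrow> KS_entropy M f = 0)"

definition borel_isomorphism ::
  "'a topology \<Rightarrow> 'a set \<Rightarrow> 'b topology \<Rightarrow> 'b set \<Rightarrow> ('a \<Rightarrow> 'b) \<Rightarrow> bool" where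
  "borel_isomorphism X X' Y Y' \<phi> \<longleftrightarrow>
     bij_betw \<phi> X' Y' \<and>
     \<phi> \<in> restrict_space (borel_of X) X' \<rightarrow>\<^sub>M restrict_space (borel_of Y) Y' \<and>
     the_inv_into X' \<phi> \<in> restrict_space (borel_of Y) Y' \<rightarrow>\<^sub>M restrict_space (borel_of X) X'"

definition invariant_borel_subset :: "'a topology \<Rightarrow> ('a \<Rightarrow> 'a) \<Rightarrow> 'a set \<Rightarrow> bool" where
  "invariant_borel_subset X f X' \<longleftrightarrow>
     X' \<in> sets (borel_of X) \<and> f -` X' \<inter> topspace X = X'"

definition entropy_conjugacy ::
  "'a topology \<Rightarrow> ('a \<Rightarrow> 'a) \<Rightarrow> 'a set \<Rightarrow> 'b topology \<Rightarrow> ('b \<Rightarrow> 'b) \<Rightarrow> 'b set \<Rightarrow> ('a \<Rightarrow> 'b) \<Rightarrow> bool" where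
  "entropy_conjugacy X f X' Y g Y' \<phi> \<longleftrightarrow>
     invariant_borel_subset X f X' \<and> invariant_borel_subset Y g Y' \<and>
     borel_isomorphism X X' Y Y' \<phi> \<and> (\<forall>x\<in>X'. \<phi> (f x) = g (\<phi> x)) \<and>
     zero_entropy_outside X f X' \<and> zero_entropy_outside Y g Y'"

section \<open>Piecewise monotone maps and their symbolic dynamics\<close>

definition monotone_pieces :: "real \<Rightarrow> real \<Rightarrow> (real \<Rightarrow> real) \<Rightarrow> real set set \<Rightarrow> bool" where
  "monotone_pieces a b T Q \<longleftrightarrow>
     finite Q \<and> partition_on {a..b} Q \<and>
     (\<forall>J\<in>Q. is_interval J \<and> continuous_on J T \<and> (strict_mono_on J T \<or> strict_antimono_on J T))"

definition piecewise_monotone :: "real \<Rightarrow> real \<Rightarrow> (real \<Rightarrow> real) \<Rightarrow> bool" where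
  "piecewise_monotone a b T \<longleftrightarrow> T \<in> {a..b} \<rightarrow> {a..b} \<and> (\<exists>Q. monotone_pieces a b T Q)"

text \<open>
  One-point pieces are allowed; they may be unavoidable, since \<open>T\<close> can take an isolated value at a
  discontinuity. Their interior is empty and is not used as a symbol. The resulting \<open>P\<close> does not
  depend on the choice of the minimizing \<open>Q\<close>, whose members can differ only in their endpoints.
\<close>

definition natural_partition :: "real \<Rightarrow> real \<Rightarrow> (real \<Rightarrow> real) \<Rightarrow> real set set \<Rightarrow> bool" where
  "natural_partition a b T P \<longleftrightarrow>
     (\<exists>Q. is_arg_min card (monotone_pieces a b T) Q \<and> P = interior ` Q - {{}})"

definition regular_points :: "(real \<Rightarrow> real) \<Rightarrow> real set set \<Rightarrow> real set" where
  "regular_points T P = {x. \<forall>k. (T ^^ k) x \<in> \<Union>P}"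

definition itinerary :: "(real \<Rightarrow> real) \<Rightarrow> real set set \<Rightarrow> real \<Rightarrow> nat \<Rightarrow> real set" where
  "itinerary T P x k = (THE A. A \<in> P \<and> (T ^^ k) x \<in> A)"

definition symb_dyn :: "(real \<Rightarrow> real) \<Rightarrow> real set set \<Rightarrow> (nat \<Rightarrow> real set) set" where
  "symb_dyn T P = seq_topology P closure_of (itinerary T P ` regular_points T P)"

definition nat_extension :: "(real \<Rightarrow> real) \<Rightarrow> real set set \<Rightarrow> (int \<Rightarrow> real set) set" where
  "nat_extension T P =
     {A. (\<forall>p. A p \<in> P) \<and> (\<forall>p. (\<lambda>k. A (p + int k)) \<in> symb_dyn T P)}"

definition endpoints :: "real set set \<Rightarrow> real set" where
  "endpoints P = (\<Union>A\<in>P. {Inf A, Sup A})"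

text \<open>
  One-sided limits of itineraries run through regular points only. The last endpoint is excluded on
  the right and the first one on the left: there the filter is trivial and would admit every limit.
\<close>

definition kneading :: "(real \<Rightarrow> real) \<Rightarrow> real set set \<Rightarrow> (nat \<Rightarrow> real set) set" where
  "kneading T P =
     {C. \<exists>c \<in> endpoints P - {Max (endpoints P)}.
           limitin (seq_topology P) (itinerary T P) C (at c within {c<..} \<inter> regular_points T P)} \<union>
     {C. \<exists>c \<in> endpoints P - {Min (endpoints P)}.
           limitin (seq_topology P) (itinerary T P) C (at c within {..<c} \<inter> regular_points T P)}"

section \<open>Markov sequences and the Hofbauer shift of a two-sided subshift\<close>

text \<open>
  Words up to translation are nonempty lists. Below \<open>S\<close> is a shift-invariant set of two-sided
  sequences, \<open>nat_extension T P\<close> in the application; the sequences in \<open>fol S w\<close> then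
  automatically belong to \<open>symb_dyn T P\<close>.
\<close>

definition shadowed_at :: "(nat \<Rightarrow> 's) set \<Rightarrow> (int \<Rightarrow> 's) \<Rightarrow> int \<Rightarrow> bool" where
  "shadowed_at K A p \<longleftrightarrow>
     (\<forall>m::nat. \<exists>n\<ge>m. \<exists>C\<in>K. map A [p - int n..p] = map C [0..<Suc n])"

definition words :: "(int \<Rightarrow> 's) set \<Rightarrow> 's list set" where
  "words S = {map A [m..p] | A m p. A \<in> S \<and> m \<le> p}"

definition fol :: "(int \<Rightarrow> 's) set \<Rightarrow> 's list \<Rightarrow> (nat \<Rightarrow> 's) set" where
  "fol S w = {(\<lambda>k. B (int k)) | B. B \<in> S \<and> map B [1 - int (length w)..0] = w}"

definition markov_at :: "(int \<Rightarrow> 's) set \<Rightarrow> (int \<Rightarrow> 's) \<Rightarrow> int \<Rightarrow> bool" where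
  "markov_at S A p \<longleftrightarrow>
     (\<exists>N::nat. \<forall>n\<ge>N. fol S (map A [p - int n..p]) = fol S (map A [p - int N..p]))"

definition markov_part :: "(int \<Rightarrow> 's) set \<Rightarrow> (int \<Rightarrow> 's) set" where
  "markov_part S = {A \<in> S. \<forall>p. markov_at S A p}"

definition minimal_words :: "(int \<Rightarrow> 's) set \<Rightarrow> 's list set" where
  "minimal_words S = {w \<in> words S. length w = 1 \<or> fol S w \<subset> fol S (tl w)}"

text \<open>The longest minimal suffix, obtained by dropping as few symbols as possible.\<close>

definition min_form :: "(int \<Rightarrow> 's) set \<Rightarrow> 's list \<Rightarrow> 's list" where
  "min_form S w = drop (LEAST j. drop j w \<in> minimal_words S) w"

text \<open>
  The vertices of the Markov diagram are the elements of \<open>minimal_words S\<close>. Minimal forms are meant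
  for words of \<open>S\<close> only, hence the requirement that the extended word be one.
\<close>

definition markov_arrow :: "(int \<Rightarrow> 's) set \<Rightarrow> 's list \<Rightarrow> 's list \<Rightarrow> bool" where
  "markov_arrow S v w \<longleftrightarrow>
     v \<in> minimal_words S \<and> w \<in> minimal_words S \<and>
     v @ [last w] \<in> words S \<and> w = min_form S (v @ [last w])"

definition hofbauer_shift :: "(int \<Rightarrow> 's) set \<Rightarrow> (int \<Rightarrow> 's list) set" where
  "hofbauer_shift S = {\<alpha>. \<forall>p. markov_arrow S (\<alpha> p) (\<alpha> (p + 1))}"

definition hofbauer_proj :: "(int \<Rightarrow> 's list) \<Rightarrow> int \<Rightarrow> 's" where
  "hofbauer_proj \<alpha> = (\<lambda>p. last (\<alpha> p))"

definition hofbauer_topology :: "(int \<Rightarrow> 's) set \<Rightarrow> (int \<Rightarrow> 's list) topology" where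
  "hofbauer_topology S = subtopology (seq_topology (minimal_words S)) (hofbauer_shift S)"

definition nat_extension_topology ::
  "(real \<Rightarrow> real) \<Rightarrow> real set set \<Rightarrow> (int \<Rightarrow> real set) topology" where
  "nat_extension_topology T P = subtopology (seq_topology P) (nat_extension T P)"

text \<open>
  Periodic two-sided sequences are identified with their nonnegative coordinates; this is the image
  under the projection of a set of sequences in the Hofbauer shift, after that identification.
\<close>

definition one_sided_image :: "(int \<Rightarrow> 's list) set \<Rightarrow> (nat \<Rightarrow> 's) set" where
  "one_sided_image Orb = (\<lambda>\<alpha> k. hofbauer_proj \<alpha> (int k)) ` Orb"

end

theory Submission
  imports Defs
begin

text \<open>
  A cylinder that meets the image of a piece \<open>s\<close> under \<open>T\<close> without being contained in it contains an
  endpoint of this image, and then its word preceded by \<open>s\<close> is the beginning of a kneading invariant.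
  Hence a sequence that is not shadowed at time \<open>p\<close> is Markov at time \<open>p\<close>. Conversely, let \<open>A\<close> be
  Markov and shadowed by \<open>\<kappa>\<close> at time \<open>p\<close>. The tails of \<open>\<kappa>\<close> at the shadowing times are extremal points
  of one follower set, which has at most two of them, so \<open>\<kappa>\<close> is eventually periodic and the past of
  \<open>A\<close> is periodic with one of finitely many periods.

  If an invariant measure does not charge the Markov part, almost every sequence is shadowed, so a
  long word is with high probability a concatenation of long prefixes of finitely many sequences and
  a few other symbols. Weighting all such concatenations yields a code whose mean length per symbol is
  arbitrarily small, and Gibbs' inequality bounds the entropy of every partition by it.

  A path in the Markov diagram is determined by its projection, because its vertices are the shortest
  words of the past with the limiting follower set; the projection is therefore injective and
  preserves periods without exception.
\<close>

section \<open>Words and followers in a two-sided subshift\<close>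

text \<open>The symbolic space is handled through nonemptiness of cylinders, which are open
  intervals; order and connectedness on the line thus replace closures and limits of itineraries.

  Why tails are extremal: a kneading invariant is followed by points next to an endpoint of a piece,
  and these lie beyond any given point of the piece. Since \<open>T ^^ n\<close> is monotone on the
  cylinder of the first n symbols, it cannot put them strictly between two continuations that the
  same prefix admits. Once the follower set has stabilized, every tail of \<kappa> at a large
  shadowing time is such a continuation, and of three distinct tails one would lie in the middle.

  Why almost every sequence is shadowed: being Markov at one time persists to later times, and by
  invariance it has the same probability at every time. If the Markov part is null, so is the set of
  sequences that are Markov at time 0.

  The entropy bound treats each partition directly: it is approximated by one that depends on
  finitely many coordinates, and the errors are coded as well, at a price multiplied by their small
  frequency.\<close>

lemma left_shift_funpow_int: "(left_shift ^^ n) A = (\<lambda>i::int. A (i + int n))"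
  by (induction n) (auto simp: left_shift_def fun_eq_iff algebra_simps)

lemma left_shift_funpow_nat: "(left_shift ^^ n) A = (\<lambda>i::nat. A (i + n))"
  by (induction n) (auto simp: left_shift_def fun_eq_iff algebra_simps)

lemma upto_shift: "[m + k..p + k] = map (\<lambda>i. i + k) [m..p]" for k :: int
  by (rule nth_equalityI) auto

lemma map_upto_shift: "map A [m + k..p + k] = map (\<lambda>i. A (i + k)) [m..p]" for k :: int
  by (simp add: upto_shift)

lemma map_upto_eq_iff: "map A [m..p] = map B [m..p] \<longleftrightarrow> (\<forall>i\<in>{m..p::int}. A i = B i)"
  by auto

lemma map_upto_snoc: "m \<le> p + 1 \<Longrightarrow> map A [m..p + 1] = map A [m..p] @ [A (p + 1)]" for p :: int
  by (simp add: upto_rec2)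

lemma last_map_upto: "m \<le> p \<Longrightarrow> last (map A [m..p]) = A p" for p :: int
  by (subst upto_rec2) auto

lemma drop_map_upto: "drop j (map A [m..p]) = map A [m + int j..p]"
  by (rule nth_equalityI) (auto simp: algebra_simps)

lemma tl_map_upto: "tl (map A [m..p]) = map A [m + 1..p]"
  using drop_map_upto[of 1 A m p] by (simp add: drop_Suc)


text \<open>\<open>closed\<close> is topological closedness in terms of words; it is what puts the
  projection of a path in the Markov diagram into \<open>S\<close>.\<close>

locale subshift =
  fixes S :: "(int \<Rightarrow> 's) set"
  assumes shift: "A \<in> S \<Longrightarrow> (\<lambda>i. A (i + k)) \<in> S"
    and closed: "(\<And>m p. m \<le> p \<Longrightarrow> map A [m..p] \<in> words S) \<Longrightarrow> A \<in> S"
begin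

text \<open>Shift invariance lets the window stay where the word sits in \<open>A\<close>, instead
  of being moved to end at 0 as in \<open>fol\<close>.\<close>

lemma fol_map_upto:
  assumes "m \<le> p"
  shows "fol S (map A [m..p]) = {(\<lambda>k. B (p + int k)) | B. B \<in> S \<and> (\<forall>i\<in>{m..p}. B i = A i)}"
    (is "?L = ?R")
proof -
  have *: "map B [1 - int (length (map A [m..p]))..0] = map (\<lambda>i. B (i - p)) [m..p]" for B :: "int \<Rightarrow> 's"
    using map_upto_shift[of B "m" "-p" p] assms by (simp add: algebra_simps)
  show ?thesis
  proof (intro equalityI subsetI)
    fix D assume "D \<in> ?L"
    then obtain B where B: "B \<in> S" "map (\<lambda>i. B (i - p)) [m..p] = map A [m..p]" "D = (\<lambda>k. B (int k))"
      unfolding fol_def * by blast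
    have "(\<lambda>i. B (i - p)) \<in> S" using shift[OF B(1), of "-p"] by simp
    then show "D \<in> ?R" using B by (intro CollectI exI[of _ "\<lambda>i. B (i - p)"]) auto
  next
    fix D assume "D \<in> ?R"
    then obtain B where B: "B \<in> S" "\<forall>i\<in>{m..p}. B i = A i" "D = (\<lambda>k. B (p + int k))" by blast
    have "(\<lambda>i. B (i + p)) \<in> S" using shift[OF B(1)] .
    then show "D \<in> ?L" unfolding fol_def * using B
      by (intro CollectI exI[of _ "\<lambda>i. B (i + p)"]) (auto simp: add.commute)
  qed
qed

lemma fol_map_upto_mono:
  assumes "m \<le> m'" "m' \<le> p"
  shows "fol S (map A [m..p]) \<subseteq> fol S (map A [m'..p])"
proof -
  have "m \<le> p" using assms by simp
  then show ?thesis unfolding fol_map_upto[OF \<open>m' \<le> p\<close>] fol_map_upto[OF \<open>m \<le> p\<close>]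
    using assms(1) by fastforce
qed

lemma words_repr:
  assumes "w \<in> words S"
  obtains B where "B \<in> S" "w = map B [p + 1 - int (length w)..p]" "w \<noteq> []"
proof -
  obtain A m q where A: "A \<in> S" "m \<le> q" "w = map A [m..q]" using assms unfolding words_def by auto
  have "w = map (\<lambda>i. A (i + (q - p))) [p + 1 - int (length w)..p]"
    using map_upto_shift[of A "m + p - q" "q - p" p] A by (simp add: algebra_simps)
  with shift[OF A(1), of "q - p"] A that show ?thesis by (metis (no_types, lifting) Nil_is_map_conv upto_Nil linorder_not_less)
qed

lemma fol_empty_iff: "w \<noteq> [] \<Longrightarrow> fol S w = {} \<longleftrightarrow> w \<notin> words S"
proof
  assume "w \<noteq> []" "fol S w = {}"
  show "w \<notin> words S"
  proof
    assume "w \<in> words S"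
    then obtain B where "B \<in> S" "w = map B [0 + 1 - int (length w)..0]" using words_repr[of w 0] by blast
    then have "(\<lambda>k. B (int k)) \<in> fol S w" unfolding fol_def by auto
    with \<open>fol S w = {}\<close> show False by simp
  qed
next
  assume "w \<noteq> []" "w \<notin> words S"
  show "fol S w = {}"
  proof (rule ccontr)
    assume "fol S w \<noteq> {}"
    then obtain B where B: "B \<in> S" "map B [1 - int (length w)..0] = w" unfolding fol_def by auto
    have "1 - int (length w) \<le> 0" using \<open>w \<noteq> []\<close> by (cases w) auto
    then have "w \<in> words S" unfolding words_def using B(1) B(2)[symmetric] by blast
    with \<open>w \<notin> words S\<close> show False by simp
  qed
qed

text \<open>The follower set acts as a state: that of \<open>v @ [b]\<close> is computed from that
  of \<open>v\<close>, without looking at \<open>v\<close> beyond its last letter. Members of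
  \<open>fol S v\<close> begin with this letter, so it is put back in front of
  \<open>D\<close>.\<close>

lemma fol_snoc:
  assumes "v \<noteq> []"
  shows "fol S (v @ [b]) = {D. D 0 = b \<and> case_nat (last v) D \<in> fol S v}"
proof -
  have len: "1 - int (length v) \<le> 0" using assms by (cases v) auto
  have eq: "map B [1 - int (length (v @ [b]))..0] =
      map (\<lambda>i. B (i - 1)) [1 - int (length v)..0] @ [B 0]" for B :: "int \<Rightarrow> 's"
  proof -
    have "[1 - int (length (v @ [b]))..0] = [- int (length v)..-1] @ [0]"
      using upto_rec2[of "- int (length v)" 0] by simp
    moreover have "map B [- int (length v)..-1] = map (\<lambda>i. B (i - 1)) [1 - int (length v)..0]"
      using map_upto_shift[of B "1 - int (length v)" "-1" 0] by simp
    ultimately show ?thesis by simp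
  qed
  show ?thesis
  proof (intro equalityI subsetI)
    fix D assume "D \<in> fol S (v @ [b])"
    then obtain B where B: "B \<in> S" "map B [1 - int (length (v @ [b]))..0] = v @ [b]" "D = (\<lambda>k. B (int k))"
      unfolding fol_def by blast
    from B(2) have v: "map (\<lambda>i. B (i - 1)) [1 - int (length v)..0] = v" and b: "B 0 = b"
      unfolding eq by auto
    have "last v = B (-1)"
      by (subst v[symmetric], subst last_map_upto) (use len in auto)
    then have "case_nat (last v) D = (\<lambda>k. B (int k - 1))"
      by (auto simp: B(3) fun_eq_iff split: nat.split)
    moreover have "(\<lambda>i. B (i - 1)) \<in> S" using shift[OF B(1), of "-1"] by simp
    ultimately show "D \<in> {D. D 0 = b \<and> case_nat (last v) D \<in> fol S v}"
      using v b B(3) unfolding fol_def by auto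
  next
    fix D assume "D \<in> {D. D 0 = b \<and> case_nat (last v) D \<in> fol S v}"
    then obtain B where B: "D 0 = b" "B \<in> S" "map B [1 - int (length v)..0] = v"
        "case_nat (last v) D = (\<lambda>k. B (int k))"
      unfolding fol_def by auto
    have D: "D k = B (int k + 1)" for k
      using fun_cong[OF B(4), of "Suc k"] by (simp add: add.commute)
    have "(\<lambda>i. B (i + 1)) \<in> S" using shift[OF B(2)] .
    moreover have "map (\<lambda>i. B (i + 1)) [1 - int (length (v @ [b]))..0] = v @ [b]"
      unfolding eq using B(1,3) D[of 0] by simp
    ultimately show "D \<in> fol S (v @ [b])" unfolding fol_def
      by (intro CollectI exI[of _ "\<lambda>i. B (i + 1)"]) (auto simp: D)
  qed
qed

lemma fol_snoc_cong:
  assumes "fol S v = fol S v'" "v \<noteq> []" "v' \<noteq> []" "last v = last v'"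
  shows "fol S (v @ [b]) = fol S (v' @ [b])"
  using assms by (simp add: fol_snoc)

lemma fol_drop_mono:
  assumes "j \<le> k" "k < length w"
  shows "fol S (drop j w) \<subseteq> fol S (drop k w)"
proof
  fix D assume "D \<in> fol S (drop j w)"
  then obtain B where B: "B \<in> S" "map B [1 - int (length (drop j w))..0] = drop j w" "D = (\<lambda>k. B (int k))"
    unfolding fol_def by blast
  have "drop (k - j) (map B [1 - int (length (drop j w))..0]) = drop k w"
    using B(2) assms by simp
  then have "map B [1 - int (length (drop k w))..0] = drop k w"
    unfolding drop_map_upto using assms by (simp add: algebra_simps of_nat_diff)
  then show "D \<in> fol S (drop k w)" unfolding fol_def using B by blast
qed

lemma words_drop:
  assumes "w \<in> words S" "j < length w"
  shows "drop j w \<in> words S"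
proof -
  obtain A m q where A: "A \<in> S" "m \<le> q" "w = map A [m..q]" using assms unfolding words_def by auto
  have "m + int j \<le> q" using assms(2) A by simp
  then show ?thesis unfolding words_def using A drop_map_upto[of j A m q] by blast
qed

text \<open>A suffix of length at least two that is not minimal has the same followers as its tail,
  since one inclusion always holds. So the symbols dropped before the first minimal suffix leave the
  follower set unchanged.\<close>

lemma min_form_props:
  assumes "w \<in> words S"
  obtains j where "j < length w" "min_form S w = drop j w" "drop j w \<in> minimal_words S"
    "fol S (drop j w) = fol S w" "\<And>i. i < j \<Longrightarrow> drop i w \<notin> minimal_words S"
proof -
  define j where "j = (LEAST j. drop j w \<in> minimal_words S)"
  have ne: "w \<noteq> []" using assms unfolding words_def by auto
  have ex: "drop (length w - 1) w \<in> minimal_words S"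
    unfolding minimal_words_def using words_drop[OF assms, of "length w - 1"] ne by (simp add: Suc_le_eq)
  have jm: "drop j w \<in> minimal_words S" unfolding j_def by (rule LeastI[of _ "length w - 1"]) (rule ex)
  have "j \<le> length w - 1" unfolding j_def by (rule Least_le) (rule ex)
  then have jl: "j < length w" using ne by (cases w) auto
  have nm: "drop i w \<notin> minimal_words S" if "i < j" for i
    using that not_less_Least unfolding j_def by blast
  have "fol S (drop i w) = fol S w" if "i \<le> j" for i
    using that
  proof (induction i)
    case (Suc i)
    have "fol S (drop i w) \<subseteq> fol S (drop (Suc i) w)" using Suc.prems jl by (intro fol_drop_mono) auto
    moreover have "\<not> fol S (drop i w) \<subset> fol S (tl (drop i w))"
      using nm[of i] words_drop[OF assms, of i] Suc.prems jl unfolding minimal_words_def by auto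
    ultimately show ?case using Suc by (simp add: drop_Suc tl_drop)
  qed simp
  with that jl jm nm show thesis unfolding min_form_def j_def[symmetric] by blast
qed

section \<open>The Hofbauer shift and the Markov part\<close>

text \<open>The Markov property with its witness given as an absolute time rather than a length: the
  same \<open>m\<close> then serves for all later \<open>p\<close>.\<close>

definition stable_from :: "(int \<Rightarrow> 's) \<Rightarrow> int \<Rightarrow> int \<Rightarrow> bool" where
  "stable_from A p m \<longleftrightarrow> m \<le> p \<and> (\<forall>j\<le>m. fol S (map A [j..p]) = fol S (map A [m..p]))"

lemma stable_fromD: "stable_from A p m \<Longrightarrow> j \<le> m \<Longrightarrow> fol S (map A [j..p]) = fol S (map A [m..p])"
  unfolding stable_from_def by blast

lemma stable_from_le: "stable_from A p m \<Longrightarrow> m \<le> p"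
  unfolding stable_from_def by blast

lemma stable_fromI:
  "m \<le> p \<Longrightarrow> (\<And>j. j \<le> m \<Longrightarrow> fol S (map A [j..p]) = fol S (map A [m..p])) \<Longrightarrow> stable_from A p m"
  unfolding stable_from_def by blast

lemma stable_from_mono:
  assumes "stable_from A p m" "j \<le> m" shows "stable_from A p j"
proof (rule stable_fromI)
  show "j \<le> p" using assms stable_from_le by fastforce
  fix i assume "i \<le> j"
  then have "i \<le> m" using assms(2) by simp
  then show "fol S (map A [i..p]) = fol S (map A [j..p])"
    using stable_fromD[OF assms(1)] assms(2) by metis
qed

lemma markov_at_iff: "markov_at S A p \<longleftrightarrow> (\<exists>m. stable_from A p m)"
proof
  assume "markov_at S A p"
  then obtain N :: nat where N: "\<And>n. n \<ge> N \<Longrightarrow> fol S (map A [p - int n..p]) = fol S (map A [p - int N..p])"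
    unfolding markov_at_def by blast
  have "stable_from A p (p - int N)"
  proof (rule stable_fromI)
    fix j assume "j \<le> p - int N"
    then have "N \<le> nat (p - j)" "j = p - int (nat (p - j))" by auto
    then show "fol S (map A [j..p]) = fol S (map A [p - int N..p])" using N by metis
  qed simp
  then show "\<exists>m. stable_from A p m" ..
next
  assume "\<exists>m. stable_from A p m"
  then obtain m where m: "stable_from A p m" ..
  have "fol S (map A [p - int n..p]) = fol S (map A [p - int (nat (p - m))..p])" if "n \<ge> nat (p - m)" for n
    using stable_fromD[OF m, of "p - int n"] stable_from_le[OF m] that by simp
  then show "markov_at S A p" unfolding markov_at_def by blast
qed

lemma stable_from_Suc:
  assumes "stable_from A p m" shows "stable_from A (p + 1) m"
proof (rule stable_fromI)
  have mp: "m \<le> p" using assms by (rule stable_from_le)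
  then show "m \<le> p + 1" by simp
  fix j assume j: "j \<le> m"
  then have "j \<le> p" using mp by simp
  have "fol S (map A [j..p] @ [A (p + 1)]) = fol S (map A [m..p] @ [A (p + 1)])"
    by (rule fol_snoc_cong) (use stable_fromD[OF assms j] mp \<open>j \<le> p\<close> last_map_upto[of _ p A] in auto)
  then show "fol S (map A [j..p + 1]) = fol S (map A [m..p + 1])"
    using mp \<open>j \<le> p\<close> by (simp add: map_upto_snoc del: map_append)
qed

lemma markov_at_mono:
  assumes "markov_at S A p" "p \<le> q" shows "markov_at S A q"
proof -
  obtain m where m: "stable_from A p m" using assms(1) markov_at_iff by blast
  have "stable_from A q m" using \<open>p \<le> q\<close>
  proof (induction q rule: int_ge_induct)
    case (step i)
    then show ?case using stable_from_Suc by blast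
  qed (rule m)
  then show ?thesis using markov_at_iff by blast
qed

lemma markov_at_left_shift: "markov_at S (left_shift A) p \<longleftrightarrow> markov_at S A (p + 1)"
proof -
  have "map (left_shift A) [p - int n..p] = map A [p + 1 - int n..p + 1]" for n
    using map_upto_shift[of A "p - int n" 1 p] by (simp add: left_shift_def algebra_simps)
  then show ?thesis unfolding markov_at_def by simp
qed

text \<open>A path in the Markov diagram that projects to \<open>A\<close> is forced to pass at time \<open>p\<close> through the word
  of \<open>A\<close> that starts at the last time from which the follower set is stable.\<close>

definition hofbauer_rel :: "(int \<Rightarrow> 's) \<Rightarrow> int \<Rightarrow> 's list \<Rightarrow> bool" where
  "hofbauer_rel A p w \<longleftrightarrow> (\<exists>m. w = map A [m..p] \<and> stable_from A p m \<and> \<not> stable_from A p (m + 1))"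

lemma hofbauer_rel_unique:
  assumes "hofbauer_rel A p v" "hofbauer_rel A p w" shows "v = w"
proof -
  obtain m n where *: "v = map A [m..p]" "stable_from A p m" "\<not> stable_from A p (m + 1)"
     "w = map A [n..p]" "stable_from A p n" "\<not> stable_from A p (n + 1)"
    using assms unfolding hofbauer_rel_def by blast
  have "\<not> n \<ge> m + 1" using *(3,5) stable_from_mono by blast
  moreover have "\<not> m \<ge> n + 1" using *(2,6) stable_from_mono by blast
  ultimately have "m = n" by linarith
  then show ?thesis using * by simp
qed

lemma hofbauer_rel_exists:
  assumes "markov_at S A p" shows "\<exists>w. hofbauer_rel A p w"
proof -
  obtain m where m: "stable_from A p m" using assms markov_at_iff by blast
  then have "m \<le> p" using stable_from_le by blast
  define k where "k = (LEAST k. stable_from A p (p - int k))"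
  have ex: "stable_from A p (p - int (nat (p - m)))" using m \<open>m \<le> p\<close> by simp
  have k: "stable_from A p (p - int k)" unfolding k_def by (rule LeastI) (rule ex)
  have "\<not> stable_from A p (p - int k + 1)"
  proof
    assume *: "stable_from A p (p - int k + 1)"
    then have "k \<noteq> 0" using stable_from_le by fastforce
    then have "stable_from A p (p - int (k - 1))" using * by (simp add: of_nat_diff algebra_simps)
    then have "k \<le> k - 1" unfolding k_def by (rule Least_le)
    with \<open>k \<noteq> 0\<close> show False by simp
  qed
  with k show ?thesis unfolding hofbauer_rel_def by blast
qed

lemma stable_from_fol_tl:
  assumes "stable_from A p m" "\<not> stable_from A p (m + 1)" "m < p"
  shows "fol S (map A [m..p]) \<subset> fol S (map A [m + 1..p])"
proof -
  have "fol S (map A [m..p]) \<noteq> fol S (map A [m + 1..p])"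
  proof
    assume eq: "fol S (map A [m..p]) = fol S (map A [m + 1..p])"
    have "stable_from A p (m + 1)"
    proof (rule stable_fromI)
      fix j assume "j \<le> m + 1"
      then consider "j = m + 1" | "j \<le> m" by linarith
      then show "fol S (map A [j..p]) = fol S (map A [m + 1..p])"
        using stable_fromD[OF assms(1)] eq by cases auto
    qed (use assms in auto)
    with assms show False by simp
  qed
  moreover have "fol S (map A [m..p]) \<subseteq> fol S (map A [m + 1..p])"
    using fol_map_upto_mono[of m "m+1" p A] assms by simp
  ultimately show ?thesis by blast
qed

lemma map_upto_minimal_iff:
  assumes "A \<in> S" "m \<le> p"
  shows "map A [m..p] \<in> minimal_words S \<longleftrightarrow> m = p \<or> fol S (map A [m..p]) \<subset> fol S (map A [m + 1..p])"
proof -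
  have "map A [m..p] \<in> words S" using assms unfolding words_def by blast
  moreover have "length (map A [m..p]) = 1 \<longleftrightarrow> m = p" using assms by auto
  ultimately show ?thesis unfolding minimal_words_def tl_map_upto[symmetric] by blast
qed

lemma hofbauer_rel_minimal:
  assumes "A \<in> S" "hofbauer_rel A p w" shows "w \<in> minimal_words S"
proof -
  obtain m where *: "w = map A [m..p]" "stable_from A p m" "\<not> stable_from A p (m + 1)"
    using assms unfolding hofbauer_rel_def by blast
  then have "m \<le> p" using stable_from_le by blast
  have "m = p \<or> fol S (map A [m..p]) \<subset> fol S (map A [m + 1..p])"
    using stable_from_fol_tl[OF *(2,3)] \<open>m \<le> p\<close> by linarith
  then show ?thesis unfolding *(1) map_upto_minimal_iff[OF assms(1) \<open>m \<le> p\<close>] .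
qed

text \<open>The stable start cannot move to the left when a symbol is appended, so \<open>w\<close>
  is a suffix of the extended word. Longer suffixes start where the follower set is already
  constant, so they are not minimal and the minimal form starts exactly at \<open>n\<close>.\<close>

lemma hofbauer_rel_arrow:
  assumes A: "A \<in> S" and v: "hofbauer_rel A p v" and w: "hofbauer_rel A (p + 1) w"
  shows "markov_arrow S v w"
proof -
  obtain m where m: "v = map A [m..p]" "stable_from A p m" "\<not> stable_from A p (m + 1)"
    using v unfolding hofbauer_rel_def by blast
  obtain n where n: "w = map A [n..p + 1]" "stable_from A (p + 1) n" "\<not> stable_from A (p + 1) (n + 1)"
    using w unfolding hofbauer_rel_def by blast
  have mp: "m \<le> p" and np: "n \<le> p + 1" using m n stable_from_le by blast+
  have mn: "m \<le> n"
  proof (rule ccontr)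
    assume "\<not> m \<le> n"
    then have "n + 1 \<le> m" by simp
    with stable_from_mono[OF stable_from_Suc[OF m(2)]] n(3) show False by blast
  qed
  have last: "last w = A (p + 1)" using n np by (simp only: last_map_upto)
  have vw: "v @ [last w] = map A [m..p + 1]" using last m mp by (simp add: map_upto_snoc)
  have inw: "v @ [last w] \<in> words S" unfolding vw words_def using A mp by force
  have "(LEAST j. drop j (v @ [last w]) \<in> minimal_words S) = nat (n - m)"
  proof (rule Least_equality)
    show "drop (nat (n - m)) (v @ [last w]) \<in> minimal_words S"
      unfolding vw drop_map_upto using hofbauer_rel_minimal[OF A w] n mn by simp
  next
    fix j assume j: "drop j (v @ [last w]) \<in> minimal_words S"
    show "nat (n - m) \<le> j"
    proof (rule ccontr)
      assume "\<not> nat (n - m) \<le> j"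
      then have jn: "m + int j < n" by simp
      then have "fol S (map A [m + int j..p + 1]) = fol S (map A [m + int j + 1..p + 1])"
        using stable_fromD[OF n(2), of "m + int j"] stable_fromD[OF n(2), of "m + int j + 1"] by simp
      moreover have "map A [m + int j..p + 1] \<in> minimal_words S" using j unfolding vw drop_map_upto .
      ultimately show False
        using map_upto_minimal_iff[OF A, of "m + int j" "p + 1"] jn np by auto
    qed
  qed
  then have "min_form S (v @ [last w]) = drop (nat (n - m)) (v @ [last w])"
    unfolding min_form_def by (rule arg_cong)
  also have "\<dots> = w" unfolding vw drop_map_upto using mn n(1) by simp
  finally have "min_form S (v @ [last w]) = w" .
  then show ?thesis unfolding markov_arrow_def
    using inw hofbauer_rel_minimal[OF A v] hofbauer_rel_minimal[OF A w] by simp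
qed

text \<open>Taking minimal forms only discards initial symbols, and by \<open>fol_snoc_cong\<close>
  the followers after an appended symbol do not notice it. The starting vertex may still contribute
  symbols not known to come from the projection.\<close>

lemma hofbauer_suffix:
  assumes "\<alpha> \<in> hofbauer_shift S"
  shows "\<exists>j < length (\<alpha> p) + k. \<alpha> (p + int k) =
           drop j (\<alpha> p @ map (hofbauer_proj \<alpha>) [p + 1..p + int k])
       \<and> fol S (\<alpha> (p + int k)) = fol S (\<alpha> p @ map (hofbauer_proj \<alpha>) [p + 1..p + int k])
       \<and> \<alpha> (p + int k) \<noteq> [] "
proof (induction k)
  case 0
  have "\<alpha> p \<in> words S"
    using assms unfolding hofbauer_shift_def markov_arrow_def minimal_words_def by blast
  then have "\<alpha> p \<noteq> []" unfolding words_def by auto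
  then show ?case by (auto intro!: exI[of _ 0])
next
  case (Suc k)
  define u where "u = \<alpha> p @ map (hofbauer_proj \<alpha>) [p + 1..p + int k]"
  define b where "b = hofbauer_proj \<alpha> (p + 1 + int k)"
  have u': "\<alpha> p @ map (hofbauer_proj \<alpha>) [p + 1..p + int (Suc k)] = u @ [b]"
    unfolding u_def b_def using map_upto_snoc[of "p + 1" "p + int k" "hofbauer_proj \<alpha>"]
    by (simp add: add_ac)
  obtain j where j: "j < length (\<alpha> p) + k" "\<alpha> (p + int k) = drop j u"
    "fol S (\<alpha> (p + int k)) = fol S u" "\<alpha> (p + int k) \<noteq> []"
    using Suc unfolding u_def by blast
  have lu: "length u = length (\<alpha> p) + k" unfolding u_def by simp
  have "markov_arrow S (\<alpha> (p + int k)) (\<alpha> (p + int k + 1))"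
    using assms unfolding hofbauer_shift_def by simp
  then have arr: "\<alpha> (p + int k) @ [b] \<in> words S"
    "\<alpha> (p + int (Suc k)) = min_form S (\<alpha> (p + int k) @ [b])"
    "\<alpha> (p + int (Suc k)) \<noteq> []"
    unfolding markov_arrow_def b_def hofbauer_proj_def minimal_words_def words_def by (auto simp: add_ac)
  obtain i where i: "i < length (\<alpha> (p + int k) @ [b])" "\<alpha> (p + int (Suc k)) = drop i (\<alpha> (p + int k) @ [b])"
    "fol S (\<alpha> (p + int (Suc k))) = fol S (\<alpha> (p + int k) @ [b])"
    using min_form_props[OF arr(1)] arr(2) by metis
  have "\<alpha> (p + int (Suc k)) = drop (j + i) (u @ [b])"
    using i(2) j lu by (simp add: add.commute)
  moreover have "fol S (\<alpha> (p + int k) @ [b]) = fol S (u @ [b])"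
    by (rule fol_snoc_cong) (use j lu in auto)
  moreover have "j + i < length (\<alpha> p) + Suc k" using i(1) j lu by simp
  ultimately show ?case unfolding u' using i(3) arr(3) by (intro exI[of _ "j + i"]) auto
qed

lemma hofbauer_shift_rel:
  assumes "\<alpha> \<in> hofbauer_shift S"
  shows "hofbauer_rel (hofbauer_proj \<alpha>) p (\<alpha> p)"
proof -
  define A where "A = hofbauer_proj \<alpha>"
  define s where "s = (\<lambda>p. p + 1 - int (length (\<alpha> p)))"
  have min: "\<alpha> p \<in> minimal_words S" for p
    using assms unfolding hofbauer_shift_def markov_arrow_def by blast
  have ne: "\<alpha> p \<noteq> []" for p using min[of p] unfolding minimal_words_def words_def by auto
  have sp: "s p \<le> p" for p unfolding s_def using ne[of p] by (cases "\<alpha> p") auto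
  have word: "\<alpha> p = map A [s p..p]" for p
  proof -
    \<comment> \<open>Going back as many steps as \<open>\<alpha> p\<close> has letters: a suffix of
      that length consists of projected symbols alone, whatever the vertex at time \<open>q\<close>
      is.\<close>
    define k where "k = length (\<alpha> p)"
    define q where "q = p - int k"
    obtain j where j: "\<alpha> p = drop j (\<alpha> q @ map A [q + 1..p])" "\<alpha> p \<noteq> []" "j < length (\<alpha> q) + k"
      using hofbauer_suffix[OF assms, of q k] unfolding A_def q_def by auto
    have "length (\<alpha> p) = length (\<alpha> q) + k - j"
      by (subst j(1)) (simp add: q_def)
    then have "j = length (\<alpha> q)" using j(3) unfolding k_def by simp
    then have "\<alpha> p = map A [q + 1..p]" using j(1) by simp
    then show ?thesis unfolding s_def q_def k_def by (simp add: algebra_simps)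
  qed
  have stab: "fol S (map A [s p..p]) = fol S (map A [s q..p])" "s q \<le> s p" if "q \<le> p" for p q
  proof -
    define k where "k = nat (p - q)"
    have p: "p = q + int k" using that unfolding k_def by simp
    have cat: "\<alpha> q @ map A [q + 1..p] = map A [s q..p]"
      using sp[of q] that by (subst word) (simp add: upto_split2[of "s q" q p])
    obtain j where "\<alpha> p = drop j (map A [s q..p])" "fol S (\<alpha> p) = fol S (map A [s q..p])"
      "j < length (\<alpha> q) + k"
      using hofbauer_suffix[OF assms, of q k] cat unfolding p A_def by auto
    then have j: "map A [s p..p] = drop j (map A [s q..p])" "fol S (map A [s p..p]) = fol S (map A [s q..p])"
      unfolding word[of p, symmetric] by blast+
    show "fol S (map A [s p..p]) = fol S (map A [s q..p])" by (rule j)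
    show "s q \<le> s p"
      using arg_cong[where f=length, OF j(1)] sp[of p] sp[of q] that by simp
  qed
  have "stable_from A p (s p)"
  proof (rule stable_fromI)
    \<comment> \<open>The vertex at time \<open>j\<close> starts no later than \<open>j\<close>, so
      the followers of the window from \<open>j\<close> are squeezed between those from
      \<open>s j\<close> and from \<open>s p\<close>, which agree along the path.\<close>
    fix j assume "j \<le> s p"
    then have "s j \<le> j" "j \<le> p" "j \<le> s p" using sp[of j] sp[of p] by auto
    then have "fol S (map A [s j..p]) \<subseteq> fol S (map A [j..p])" "fol S (map A [j..p]) \<subseteq> fol S (map A [s p..p])"
      using fol_map_upto_mono sp[of p] by auto
    then show "fol S (map A [j..p]) = fol S (map A [s p..p])" using stab(1)[OF \<open>j \<le> p\<close>] by simp
  qed (rule sp)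
  moreover have "\<not> stable_from A p (s p + 1)"
  proof
    assume *: "stable_from A p (s p + 1)"
    then have "s p < p" using stable_from_le by fastforce
    then have "length (\<alpha> p) \<noteq> 1" unfolding s_def by simp
    then have "fol S (\<alpha> p) \<subset> fol S (tl (\<alpha> p))" using min[of p] unfolding minimal_words_def by auto
    then have "fol S (map A [s p..p]) \<subset> fol S (map A [s p + 1..p])" unfolding word by (simp add: tl_map_upto)
    moreover have "fol S (map A [s p..p]) = fol S (map A [s p + 1..p])" using stable_fromD[OF *, of "s p"] by simp
    ultimately show False by simp
  qed
  ultimately show ?thesis unfolding hofbauer_rel_def A_def[symmetric] using word by blast
qed

text \<open>Each window is enlarged to the left until it contains the vertex at its right end. By
  stability the enlarged window has the nonempty follower set of that vertex, so it is a word of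
  \<open>S\<close> and \<open>closed\<close> applies.\<close>

lemma hofbauer_proj_mem:
  assumes "\<alpha> \<in> hofbauer_shift S" shows "hofbauer_proj \<alpha> \<in> markov_part S"
proof -
  let ?A = "hofbauer_proj \<alpha>"
  have m: "markov_at S ?A p" for p
    using hofbauer_shift_rel[OF assms, of p] markov_at_iff unfolding hofbauer_rel_def by blast
  have "?A \<in> S"
  proof (rule closed)
    fix m p :: int assume "m \<le> p"
    obtain n where n: "\<alpha> p = map ?A [n..p]" "stable_from ?A p n"
      using hofbauer_shift_rel[OF assms, of p] unfolding hofbauer_rel_def by blast
    have np: "n \<le> p" using n stable_from_le by blast
    have "\<alpha> p \<in> words S" using assms unfolding hofbauer_shift_def markov_arrow_def minimal_words_def by blast
    then have "fol S (map ?A [n..p]) \<noteq> {}" using n(1) np fol_empty_iff[of "map ?A [n..p]"] by simp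
    moreover have "fol S (map ?A [min m n..p]) = fol S (map ?A [n..p])" by (rule stable_fromD[OF n(2)]) simp
    moreover have "fol S (map ?A [min m n..p]) \<subseteq> fol S (map ?A [m..p])"
      using fol_map_upto_mono \<open>m \<le> p\<close> by simp
    ultimately have "fol S (map ?A [m..p]) \<noteq> {}" by blast
    then show "map ?A [m..p] \<in> words S" using fol_empty_iff[of "map ?A [m..p]"] \<open>m \<le> p\<close> by auto
  qed
  with m show ?thesis unfolding markov_part_def by blast
qed

lemma bij_betw_hofbauer_proj: "bij_betw hofbauer_proj (hofbauer_shift S) (markov_part S)"
  unfolding bij_betw_def
proof (intro conjI equalityI subsetI)
  show "inj_on hofbauer_proj (hofbauer_shift S)"
  proof (rule inj_onI, rule ext)
    fix \<alpha> \<beta> p assume "\<alpha> \<in> hofbauer_shift S" "\<beta> \<in> hofbauer_shift S" "hofbauer_proj \<alpha> = hofbauer_proj \<beta>"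
    then show "\<alpha> p = \<beta> p" using hofbauer_shift_rel hofbauer_rel_unique by metis
  qed
next
  fix A assume "A \<in> hofbauer_proj ` hofbauer_shift S"
  then show "A \<in> markov_part S" using hofbauer_proj_mem by auto
next
  fix A assume "A \<in> markov_part S"
  then have A: "A \<in> S" "\<And>p. markov_at S A p" unfolding markov_part_def by auto
  define \<alpha> where "\<alpha> = (\<lambda>p. SOME w. hofbauer_rel A p w)"
  have \<alpha>: "hofbauer_rel A p (\<alpha> p)" for p
    unfolding \<alpha>_def using hofbauer_rel_exists[OF A(2)] by (rule someI_ex)
  have "\<alpha> \<in> hofbauer_shift S" unfolding hofbauer_shift_def using hofbauer_rel_arrow[OF A(1)] \<alpha> by blast
  moreover have "hofbauer_proj \<alpha> = A"
  proof
    fix p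
    obtain m where "\<alpha> p = map A [m..p]" "m \<le> p" using \<alpha>[of p] unfolding hofbauer_rel_def stable_from_def by blast
    then show "hofbauer_proj \<alpha> p = A p" unfolding hofbauer_proj_def by (simp only: last_map_upto)
  qed
  ultimately show "A \<in> hofbauer_proj ` hofbauer_shift S" by blast
qed

lemma left_shift_hofbauer_iff: "left_shift \<alpha> \<in> hofbauer_shift S \<longleftrightarrow> \<alpha> \<in> hofbauer_shift S"
proof -
  have "(\<forall>p::int. R (p + 1)) \<longleftrightarrow> (\<forall>p. R p)" for R by (metis diff_add_cancel)
  from this[of "\<lambda>p. markov_arrow S (\<alpha> p) (\<alpha> (p + 1))"] show ?thesis
    unfolding hofbauer_shift_def left_shift_def by simp
qed

lemma hofbauer_proj_left_shift: "hofbauer_proj (left_shift \<alpha>) = left_shift (hofbauer_proj \<alpha>)"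
  unfolding hofbauer_proj_def left_shift_def by simp

end

section \<open>Sequence spaces over a discrete alphabet\<close>

lemma topspace_seq_topology: "topspace (seq_topology E) = {A. \<forall>i. A i \<in> E}"
  unfolding seq_topology_def by (auto simp: PiE_def Pi_def)

lemma openin_seq_topology:
  "openin (seq_topology E) U \<longleftrightarrow>
     U \<subseteq> {A. \<forall>i. A i \<in> E} \<and>
     (\<forall>A\<in>U. \<exists>F. finite F \<and> (\<forall>B. (\<forall>i. B i \<in> E) \<and> (\<forall>i\<in>F. B i = A i) \<longrightarrow> B \<in> U))"
    (is "_ \<longleftrightarrow> ?R")
proof
  assume U: "openin (seq_topology E) U"
  show ?R
  proof (intro conjI ballI)
    show "U \<subseteq> {A. \<forall>i. A i \<in> E}" using openin_subset[OF U] by (simp add: topspace_seq_topology)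
    fix A assume "A \<in> U"
    then obtain V where V: "finite {i. V i \<noteq> E}" "A \<in> PiE UNIV V" "PiE UNIV V \<subseteq> U"
      using U unfolding seq_topology_def openin_product_topology_alt by auto
    show "\<exists>F. finite F \<and> (\<forall>B. (\<forall>i. B i \<in> E) \<and> (\<forall>i\<in>F. B i = A i) \<longrightarrow> B \<in> U)"
    proof (intro exI conjI allI impI)
      fix B assume B: "(\<forall>i. B i \<in> E) \<and> (\<forall>i\<in>{i. V i \<noteq> E}. B i = A i)"
      have "B i \<in> V i" for i using B V(2) by (cases "V i = E") (auto simp: PiE_def Pi_def)
      then show "B \<in> U" using V(3) by (auto simp: PiE_def Pi_def)
    qed (rule V(1))
  qed
next
  assume R: ?R
  show "openin (seq_topology E) U"
    unfolding seq_topology_def openin_product_topology_alt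
  proof (intro ballI)
    fix A assume A: "A \<in> U"
    then obtain F where F: "finite F" "\<And>B. (\<forall>i. B i \<in> E) \<and> (\<forall>i\<in>F. B i = A i) \<Longrightarrow> B \<in> U" using R by blast
    have AE: "A i \<in> E" for i using A R by blast
    define V where "V = (\<lambda>i. if i \<in> F then {A i} else E)"
    have "finite {i \<in> UNIV. V i \<noteq> topspace (discrete_topology E)}"
      by (rule finite_subset[OF _ F(1)]) (auto simp: V_def)
    moreover have "\<forall>i\<in>UNIV. openin (discrete_topology E) (V i)" using AE by (auto simp: V_def)
    moreover have "A \<in> PiE UNIV V" using AE by (auto simp: V_def PiE_def Pi_def)
    moreover have "PiE UNIV V \<subseteq> U"
    proof
      fix B assume "B \<in> PiE UNIV V"
      then have B: "B i \<in> V i" for i by (auto simp: PiE_def Pi_def)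
      have "B i \<in> E" for i using B[of i] AE by (auto simp: V_def split: if_splits)
      moreover have "\<forall>i\<in>F. B i = A i" using B by (fastforce simp: V_def split: if_splits)
      ultimately show "B \<in> U" using F(2) by blast
    qed
    ultimately show "\<exists>V. finite {i \<in> UNIV. V i \<noteq> topspace (discrete_topology E)} \<and>
        (\<forall>i\<in>UNIV. openin (discrete_topology E) (V i)) \<and> A \<in> PiE UNIV V \<and> PiE UNIV V \<subseteq> U" by blast
  qed
qed

lemma openin_subshift_topology:
  assumes X: "X \<subseteq> {A. \<forall>i::int. A i \<in> E}"
  shows "openin (subtopology (seq_topology E) X) U \<longleftrightarrow>
     U \<subseteq> X \<and> (\<forall>A\<in>U. \<exists>r::nat. \<forall>B\<in>X. (\<forall>i\<in>{- int r..int r}. B i = A i) \<longrightarrow> B \<in> U)"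
    (is "_ \<longleftrightarrow> ?R")
proof
  assume "openin (subtopology (seq_topology E) X) U"
  then obtain V where V: "openin (seq_topology E) V" "U = V \<inter> X" unfolding openin_subtopology by blast
  show ?R
  proof (intro conjI ballI)
    fix A assume "A \<in> U"
    then obtain F where F: "finite F" "\<And>B. (\<forall>i. B i \<in> E) \<and> (\<forall>i\<in>F. B i = A i) \<Longrightarrow> B \<in> V"
      using V unfolding openin_seq_topology by blast
    obtain r where r: "\<And>i. i \<in> F \<Longrightarrow> \<bar>i\<bar> \<le> r"
      using finite_imageI[OF F(1), of abs] by (metis Max_ge imageI)
    have "\<bar>i\<bar> \<le> int (nat r)" if "i \<in> F" for i using r[OF that] by linarith
    then have "F \<subseteq> {- int (nat r)..int (nat r)}" by (fastforce simp: abs_le_iff simp del: int_nat_eq)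
    then show "\<exists>r::nat. \<forall>B\<in>X. (\<forall>i\<in>{- int r..int r}. B i = A i) \<longrightarrow> B \<in> U"
      using F(2) V(2) X by (intro exI[of _ "nat r"]) blast
  qed (use V in blast)
next
  assume R: ?R
  \<comment> \<open>The union of the cylinders of the full sequence space that are centred in
    \<open>U\<close> and whose trace on \<open>X\<close> lies in \<open>U\<close>.\<close>
  define V where "V = {B. (\<forall>i. B i \<in> E) \<and> (\<exists>A\<in>U. \<exists>r::nat. (\<forall>C\<in>X. (\<forall>i\<in>{- int r..int r}. C i = A i) \<longrightarrow> C \<in> U) \<and>
     (\<forall>i\<in>{- int r..int r}. B i = A i))}"
  have "openin (seq_topology E) V" unfolding openin_seq_topology
  proof (intro conjI ballI)
    fix B assume "B \<in> V"
    then obtain A r where Ar: "A \<in> U" "\<forall>C\<in>X. (\<forall>i\<in>{- int r..int r}. C i = A i) \<longrightarrow> C \<in> U"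
      "\<forall>i\<in>{- int r..int r}. B i = A i" unfolding V_def by blast
    have "B' \<in> V" if "(\<forall>i. B' i \<in> E) \<and> (\<forall>i\<in>{- int r..int r}. B' i = B i)" for B'
    proof -
      have "\<forall>i\<in>{- int r..int r}. B' i = A i" using that Ar(3) by simp
      then show ?thesis using that Ar(1,2) unfolding V_def by blast
    qed
    then show "\<exists>F. finite F \<and> (\<forall>B'. (\<forall>i. B' i \<in> E) \<and> (\<forall>i\<in>F. B' i = B i) \<longrightarrow> B' \<in> V)"
      by (intro exI[of _ "{- int r..int r}"]) simp
  qed (auto simp: V_def)
  moreover have "U = V \<inter> X"
  proof
    show "U \<subseteq> V \<inter> X" using R X unfolding V_def by blast
    show "V \<inter> X \<subseteq> U" unfolding V_def by blast
  qed
  ultimately show "openin (subtopology (seq_topology E) X) U" unfolding openin_subtopology by blast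
qed

lemma space_borel_of: "space (borel_of X) = topspace X"
  unfolding borel_of_def by (rule space_measure_of) (auto dest: openin_subset)

lemma openin_sets_borel_of: "openin X U \<Longrightarrow> U \<in> sets (borel_of X)"
  unfolding borel_of_def by (subst sets_measure_of) (auto dest: openin_subset)

lemma measurable_borel_ofI:
  assumes "f \<in> space N \<rightarrow> topspace X" "\<And>U. openin X U \<Longrightarrow> f -` U \<inter> space N \<in> sets N"
  shows "f \<in> N \<rightarrow>\<^sub>M borel_of X"
  unfolding borel_of_def by (rule measurable_measure_of) (use assms in \<open>auto dest: openin_subset\<close>)

locale subshift_space =
  fixes X :: "(int \<Rightarrow> 's) set" and E :: "'s set"
  assumes range: "A \<in> X \<Longrightarrow> A i \<in> E"
begin

abbreviation "seqtop \<equiv> subtopology (seq_topology E) X"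

lemma topspace_seqtop: "topspace seqtop = X"
  using range by (auto simp: topspace_seq_topology)

lemma openin_seqtop_iff: "openin seqtop U \<longleftrightarrow>
     U \<subseteq> X \<and> (\<forall>A\<in>U. \<exists>r::nat. \<forall>B\<in>X. (\<forall>i\<in>{- int r..int r}. B i = A i) \<longrightarrow> B \<in> U)"
  by (rule openin_subshift_topology) (use range in auto)

text \<open>These sets are clopen. Over an infinite alphabet they need not be finite unions of
  cylinders, and that case matters: the alphabet of the Hofbauer shift is countable, in general
  infinite.\<close>

definition determined :: "nat \<Rightarrow> (int \<Rightarrow> 's) set \<Rightarrow> bool" where
  "determined r D \<longleftrightarrow> D \<subseteq> X \<and> (\<forall>A\<in>D. \<forall>B\<in>X. (\<forall>i\<in>{- int r..int r}. B i = A i) \<longrightarrow> B \<in> D)"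

lemma determined_mono: "determined r D \<Longrightarrow> r \<le> r' \<Longrightarrow> determined r' D"
  unfolding determined_def by fastforce

lemma determined_iff:
  "determined r D \<Longrightarrow> A \<in> X \<Longrightarrow> B \<in> X \<Longrightarrow> (\<And>i. i \<in> {- int r..int r} \<Longrightarrow> A i = B i) \<Longrightarrow> A \<in> D \<longleftrightarrow> B \<in> D"
  unfolding determined_def by metis

lemma determined_openin: "determined r D \<Longrightarrow> openin seqtop D"
  unfolding determined_def openin_seqtop_iff by blast

lemma determined_sets: "determined r D \<Longrightarrow> D \<in> sets (borel_of seqtop)"
  using determined_openin openin_sets_borel_of by blast

lemma window_determined: "determined (nat (max \<bar>m\<bar> \<bar>p\<bar>)) {A \<in> X. R (map A [m..p])}"
  unfolding determined_def
proof (intro conjI ballI impI)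
  fix A B assume A: "A \<in> {A \<in> X. R (map A [m..p])}" and B: "B \<in> X"
    and eq: "\<forall>i\<in>{- int (nat (max \<bar>m\<bar> \<bar>p\<bar>))..int (nat (max \<bar>m\<bar> \<bar>p\<bar>))}. B i = A i"
  have "i \<in> {- int (nat (max \<bar>m\<bar> \<bar>p\<bar>))..int (nat (max \<bar>m\<bar> \<bar>p\<bar>))}" if "i \<in> {m..p}" for i
    using that by auto
  then have e: "map B [m..p] = map A [m..p]" unfolding map_upto_eq_iff using eq by blast
  show "B \<in> {A \<in> X. R (map A [m..p])}" using A B unfolding mem_Collect_eq e by blast
qed auto

lemma window_sets: "{A \<in> X. R (map A [m..p])} \<in> sets (borel_of seqtop)"
  using window_determined determined_sets by blast

lemma openin_UN_determined:
  assumes "openin seqtop U"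
  obtains D where "U = (\<Union>r. D r)" "\<And>r. determined r (D r)" "incseq D"
proof
  let ?D = "\<lambda>r. {A \<in> X. \<forall>B\<in>X. (\<forall>i\<in>{- int r..int r}. B i = A i) \<longrightarrow> B \<in> U}"
  show "U = (\<Union>r. ?D r)" using assms unfolding openin_seqtop_iff by auto
  show "determined r (?D r)" for r unfolding determined_def by auto
  show "incseq ?D" by (rule incseq_SucI) auto
qed

text \<open>An open set is a countable union of sets determined by finite windows, and over a
  countable alphabet each of these is a countable union of cylinders.\<close>

lemma measurable_coordinatesI:
  assumes E: "countable E" and f: "f \<in> space N \<rightarrow> X"
    and c: "\<And>i e. {x \<in> space N. f x i = e} \<in> sets N"
  shows "f \<in> N \<rightarrow>\<^sub>M borel_of seqtop"
proof (rule measurable_borel_ofI)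
  show "f \<in> space N \<rightarrow> topspace seqtop" unfolding topspace_seqtop by (rule f)
  have word: "{x \<in> space N. map (f x) [m..p] = w} \<in> sets N" for m p w
  proof -
    have "{x \<in> space N. map (f x) [m..p] = w} =
      (if length w = length [m..p] then {x \<in> space N. \<forall>k\<in>{..<length w}. f x (m + int k) = w ! k} else {})"
      by (auto simp: list_eq_iff_nth_eq)
    moreover have "{x \<in> space N. \<forall>k\<in>{..<length w}. f x (m + int k) = w ! k} \<in> sets N"
      by (rule sets.sets_Collect_finite_All) (use c in auto)
    ultimately show ?thesis by (metis (no_types, lifting) sets.empty_sets)
  qed
  fix U assume "openin seqtop U"
  then obtain D where D: "U = (\<Union>r. D r)" "\<And>r. determined r (D r)" by (metis openin_UN_determined)
  have "f -` D r \<inter> space N \<in> sets N" for r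
  proof -
    let ?W = "{w \<in> lists E. \<exists>A\<in>D r. map A [- int r..int r] = w}"
    have "f -` D r \<inter> space N = (\<Union>w\<in>?W. {x \<in> space N. map (f x) [- int r..int r] = w})"
    proof (intro equalityI subsetI)
      fix x assume x: "x \<in> f -` D r \<inter> space N"
      then have "f x \<in> X" using f by auto
      then have "map (f x) [- int r..int r] \<in> lists E" using range by auto
      with x show "x \<in> (\<Union>w\<in>?W. {x \<in> space N. map (f x) [- int r..int r] = w})" by blast
    next
      fix x assume "x \<in> (\<Union>w\<in>?W. {x \<in> space N. map (f x) [- int r..int r] = w})"
      then obtain A where A: "A \<in> D r" "map A [- int r..int r] = map (f x) [- int r..int r]" "x \<in> space N"
        by auto
      then have "f x \<in> X" using f by auto
      with A D(2)[of r] show "x \<in> f -` D r \<inter> space N"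
        unfolding map_upto_eq_iff determined_def by auto
    qed
    moreover have "countable ?W" using countable_lists[OF E] by (rule countable_subset[rotated]) auto
    ultimately show ?thesis using word by (simp only: sets.countable_UN'')
  qed
  moreover have "f -` U \<inter> space N = (\<Union>r. f -` D r \<inter> space N)" using D(1) by auto
  ultimately show "f -` U \<inter> space N \<in> sets N" by (simp only: sets.countable_UN'' countableI_type)
qed

end

section \<open>The projection of the Hofbauer shift is a Borel isomorphism\<close>

lemma hofbauer_shift_minimal: "\<alpha> \<in> hofbauer_shift S \<Longrightarrow> \<alpha> p \<in> minimal_words S"
  unfolding hofbauer_shift_def markov_arrow_def by blast

locale alphabet_subshift = subshift S + subshift_space S E for S :: "(int \<Rightarrow> 's) set" and E +
  assumes finite_alphabet: "finite E"
begin

lemma markov_at_sets: "{A \<in> S. markov_at S A p} \<in> sets (borel_of seqtop)"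
proof -
  have *: "A \<in> S \<and> (\<exists>N. \<forall>n\<ge>N. R A N n) \<longleftrightarrow> A \<in> (\<Union>N. \<Inter>n\<in>{N..}. {A \<in> S. R A N n})"
    for A and R :: "_ \<Rightarrow> nat \<Rightarrow> nat \<Rightarrow> bool"
    by auto
  have "{A \<in> S. markov_at S A p} =
      (\<Union>N. \<Inter>n\<in>{N..}. {A \<in> S. fol S (map A [p - int n..p]) = fol S (map A [p - int N..p])})"
    unfolding markov_at_def by (rule set_eqI, unfold mem_Collect_eq, rule *)
  moreover have "{A \<in> S. fol S (map A [p - int n..p]) = fol S (map A [p - int N..p])} \<in> sets (borel_of seqtop)" for n N
  proof -
    \<comment> \<open>Both follower sets are read off suffixes of one common window.\<close>
    let ?m = "p - int (max n N)"
    have drop: "map A [p - int k..p] = drop (max n N - k) (map A [?m..p])" if "k \<le> max n N" for k and A :: "int \<Rightarrow> 's"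
      unfolding drop_map_upto using that by (simp add: of_nat_diff)
    have eq: "{A \<in> S. fol S (map A [p - int n..p]) = fol S (map A [p - int N..p])} =
      {A \<in> S. (\<lambda>w. fol S (drop (max n N - n) w) = fol S (drop (max n N - N) w)) (map A [?m..p])}"
      unfolding drop[OF max.cobounded1] drop[OF max.cobounded2] ..
    show ?thesis unfolding eq by (rule window_sets)
  qed
  ultimately show ?thesis
    by (simp only:) (intro sets.countable_INT' sets.countable_UN'' countableI_type image_subsetI; (blast | simp))
qed

lemma markov_part_sets: "markov_part S \<in> sets (borel_of seqtop)"
proof -
  have "markov_part S = (\<Inter>p. {A \<in> S. markov_at S A p})" unfolding markov_part_def by auto
  then show ?thesis
    using markov_at_sets by (simp only:) (intro sets.countable_INT' countableI_type image_subsetI; blast)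
qed

lemma countable_minimal_words: "countable (minimal_words S)"
proof (rule countable_subset)
  show "minimal_words S \<subseteq> lists E" using range unfolding minimal_words_def words_def by auto
  show "countable (lists E)" using finite_alphabet countable_finite countable_lists by blast
qed

sublocale hof: subshift_space "hofbauer_shift S" "minimal_words S"
  by unfold_locales (rule hofbauer_shift_minimal)

text \<open>The length of \<open>w\<close> fixes the only possible start, so no quantifier over
  starting times is left, and stability is a countable intersection of window conditions.\<close>

lemma hofbauer_rel_sets: "{A \<in> S. hofbauer_rel A p w} \<in> sets (borel_of seqtop)"
proof -
  let ?m = "p + 1 - int (length w)"
  have stab: "{A \<in> S. stable_from A p m} \<in> sets (borel_of seqtop)" if "m \<le> p" for m
  proof -
    have "{A \<in> S. stable_from A p m} = (\<Inter>j\<in>{..m}. {A \<in> S. fol S (map A [j..p]) = fol S (map A [m..p])})"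
      using that unfolding stable_from_def by auto
    moreover have "{A \<in> S. fol S (map A [j..p]) = fol S (map A [m..p])} \<in> sets (borel_of seqtop)" if "j \<le> m" for j
    proof -
      have "map A [m..p] = drop (nat (m - j)) (map A [j..p])" for A :: "int \<Rightarrow> 's"
        unfolding drop_map_upto using that by simp
      then show ?thesis using window_sets[of "\<lambda>w. fol S w = fol S (drop (nat (m - j)) w)" j p] by (simp del: drop_map)
    qed
    ultimately show ?thesis
      by (simp only:) (intro sets.countable_INT' countableI_type image_subsetI; blast)
  qed
  have len: "m = p + 1 - int (length w)" if "w = map A [m..p]" "m \<le> p" for A m using that by simp
  \<comment> \<open>If \<open>w\<close> is a single letter, the next start lies beyond
    \<open>p\<close>, where stability fails by definition; hence the inner case distinction.\<close>
  have "{A \<in> S. hofbauer_rel A p w} = (if w = [] then {} else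
      {A \<in> S. map A [?m..p] = w} \<inter> {A \<in> S. stable_from A p ?m} -
      (if ?m = p then {} else {A \<in> S. stable_from A p (?m + 1)}))" (is "_ = ?R")
  proof (intro equalityI subsetI)
    fix A assume "A \<in> {A \<in> S. hofbauer_rel A p w}"
    then obtain m where A: "A \<in> S" "w = map A [m..p]" "stable_from A p m" "\<not> stable_from A p (m + 1)"
      unfolding hofbauer_rel_def by blast
    have mp: "m \<le> p" using A(3) by (rule stable_from_le)
    have m: "?m = m" using A(2) mp by simp
    show "A \<in> ?R" unfolding m using A mp by auto
  next
    fix A assume R: "A \<in> ?R"
    then have A: "A \<in> S" "map A [?m..p] = w" "stable_from A p ?m" "?m = p \<or> \<not> stable_from A p (?m + 1)"
      by (auto split: if_splits)
    then have "\<not> stable_from A p (?m + 1)" using stable_from_le[of A p "?m + 1"] by linarith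
    then show "A \<in> {A \<in> S. hofbauer_rel A p w}" using A(1,3) A(2)[symmetric] unfolding hofbauer_rel_def by blast
  qed
  moreover have "?m \<le> p" if "w \<noteq> []" using that by (cases w) auto
  ultimately show ?thesis using window_sets[of "\<lambda>v. v = w" ?m p] stab by auto
qed

lemma hofbauer_proj_measurable: "hofbauer_proj \<in> borel_of hof.seqtop \<rightarrow>\<^sub>M borel_of seqtop"
proof (rule measurable_coordinatesI)
  show "countable E" using finite_alphabet by (rule countable_finite)
  show "hofbauer_proj \<in> space (borel_of hof.seqtop) \<rightarrow> S"
    unfolding space_borel_of hof.topspace_seqtop using hofbauer_proj_mem unfolding markov_part_def by blast
  fix i e
  show "{x \<in> space (borel_of hof.seqtop). hofbauer_proj x i = e} \<in> sets (borel_of hof.seqtop)"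
    using hof.window_sets[of "\<lambda>v. last (last v) = e" i i]
    unfolding space_borel_of hof.topspace_seqtop hofbauer_proj_def by simp
qed

text \<open>Both maps are measurable coordinatewise: a coordinate of the projection is the last
  letter of a vertex, and the inverse takes the value \<open>w\<close> at time \<open>i\<close>
  exactly where \<open>hofbauer_rel A i w\<close> holds.\<close>

lemma borel_isomorphism_hofbauer_proj:
  "borel_isomorphism hof.seqtop (hofbauer_shift S) seqtop (markov_part S) hofbauer_proj"
  unfolding borel_isomorphism_def
proof (intro conjI bij_betw_hofbauer_proj)
  have bij: "bij_betw hofbauer_proj (hofbauer_shift S) (markov_part S)" by (rule bij_betw_hofbauer_proj)
  have sp: "space (borel_of hof.seqtop) = hofbauer_shift S" unfolding space_borel_of hof.topspace_seqtop ..
  have sp2: "space (borel_of seqtop) = S" unfolding space_borel_of topspace_seqtop ..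
  have sub: "markov_part S \<subseteq> S" unfolding markov_part_def by blast
  show "hofbauer_proj \<in> restrict_space (borel_of hof.seqtop) (hofbauer_shift S) \<rightarrow>\<^sub>M
      restrict_space (borel_of seqtop) (markov_part S)"
    by (intro measurable_restrict_space2 measurable_restrict_space1 hofbauer_proj_measurable)
      (use hofbauer_proj_mem sp in \<open>auto simp: space_restrict_space\<close>)
  show "the_inv_into (hofbauer_shift S) hofbauer_proj \<in>
      restrict_space (borel_of seqtop) (markov_part S) \<rightarrow>\<^sub>M restrict_space (borel_of hof.seqtop) (hofbauer_shift S)"
  proof (rule measurable_restrict_space2, goal_cases)
    case 1
    show ?case using the_inv_into_into[of hofbauer_proj "hofbauer_shift S"] bij sub
      unfolding bij_betw_def by (auto simp: space_restrict_space sp2)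
  next
    case 2
    show ?case
  proof (rule hof.measurable_coordinatesI)
    let ?g = "the_inv_into (hofbauer_shift S) hofbauer_proj"
    have space: "space (restrict_space (borel_of seqtop) (markov_part S)) = markov_part S"
      unfolding space_restrict_space sp2 using sub by blast
    show "countable (minimal_words S)" by (rule countable_minimal_words)
    have g: "?g A \<in> hofbauer_shift S \<and> hofbauer_proj (?g A) = A" if "A \<in> markov_part S" for A
      using bij that the_inv_into_into[of hofbauer_proj "hofbauer_shift S" A] f_the_inv_into_f[of hofbauer_proj "hofbauer_shift S" A]
      unfolding bij_betw_def by auto
    then show "?g \<in> space (restrict_space (borel_of seqtop) (markov_part S)) \<rightarrow> hofbauer_shift S"
      unfolding space by blast
    fix i w
    have "?g A i = w \<longleftrightarrow> hofbauer_rel A i w" if "A \<in> markov_part S" for A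
      using hofbauer_shift_rel[of "?g A" i] hofbauer_rel_unique g[OF that] by metis
    then have "{A \<in> space (restrict_space (borel_of seqtop) (markov_part S)). ?g A i = w} =
        markov_part S \<inter> {A \<in> S. hofbauer_rel A i w}" unfolding space using sub by blast
    then show "{A \<in> space (restrict_space (borel_of seqtop) (markov_part S)). ?g A i = w} \<in>
        sets (restrict_space (borel_of seqtop) (markov_part S))"
      unfolding sets_restrict_space using hofbauer_rel_sets[of i w] by simp
  qed
  qed
qed

end

section \<open>Block codes\<close>

definition words_over :: "'s set \<Rightarrow> nat \<Rightarrow> 's list set" where
  "words_over E n = {w. set w \<subseteq> E \<and> length w = n}"

lemma finite_words_over: "finite E \<Longrightarrow> finite (words_over E n)"
  unfolding words_over_def by (rule finite_lists_length_eq)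

lemma words_over_0: "words_over E 0 = {[]}"
  unfolding words_over_def by auto

lemma sum_words_over_append:
  "(\<Sum>w\<in>words_over E (m + n). f w) = (\<Sum>u\<in>words_over E m. \<Sum>v\<in>words_over E n. f (u @ v))"
proof -
  have "(\<Sum>u\<in>words_over E m. \<Sum>v\<in>words_over E n. f (u @ v)) =
      (\<Sum>(u, v)\<in>words_over E m \<times> words_over E n. f (u @ v))"
    by (rule sum.cartesian_product)
  also have "\<dots> = (\<Sum>w\<in>words_over E (m + n). f w)"
    by (rule sum.reindex_bij_witness[of _ "\<lambda>w. (take m w, drop m w)" "\<lambda>(u, v). u @ v"])
      (auto simp: words_over_def dest: in_set_takeD in_set_dropD)
  finally show ?thesis ..
qed

lemma sum_words_over_1: "(\<Sum>w\<in>words_over E 1. f w) = (\<Sum>s\<in>E. f [s])"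
  by (rule sum.reindex_bij_witness[of _ "\<lambda>s. [s]" hd])
    (auto simp: words_over_def length_Suc_conv)

lemma sum_words_over_prod:
  fixes f :: "nat \<Rightarrow> 's \<Rightarrow> real"
  shows "(\<Sum>w\<in>words_over E n. \<Prod>i<n. f i (w ! i)) = (\<Prod>i<n. \<Sum>s\<in>E. f i s)"
proof (induction n)
  case (Suc n)
  have "(\<Sum>w\<in>words_over E (Suc n). \<Prod>i<Suc n. f i (w ! i)) =
      (\<Sum>u\<in>words_over E n. \<Sum>s\<in>E. \<Prod>i<Suc n. f i ((u @ [s]) ! i))"
    using sum_words_over_append[of "\<lambda>w. \<Prod>i<Suc n. f i (w ! i)" E n 1]
    unfolding sum_words_over_1 by simp
  also have "\<dots> = (\<Sum>u\<in>words_over E n. \<Sum>s\<in>E. (\<Prod>i<n. f i (u ! i)) * f n s)"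
    by (intro sum.cong refl) (auto simp: words_over_def nth_append)
  also have "\<dots> = (\<Prod>i<Suc n. \<Sum>s\<in>E. f i s)"
    by (simp add: sum_product[symmetric] Suc)
  finally show ?case .
qed (simp add: words_over_0)

text \<open>\<open>code_weight c w\<close> is the sum, over all ways to cut \<open>w\<close> into nonempty blocks, of the product
  of the weights of the blocks.\<close>

function code_weight :: "('s list \<Rightarrow> real) \<Rightarrow> 's list \<Rightarrow> real" where
  "code_weight c w = (if w = [] then 1 else
     (\<Sum>l\<in>{1..length w}. code_weight c (take (length w - l) w) * c (drop (length w - l) w)))"
  by auto
termination by (relation "Wellfounded.measure (length \<circ> snd)") auto

declare code_weight.simps [simp del]

lemma code_weight_Nil: "code_weight c [] = 1"
  by (simp add: code_weight.simps)

lemma code_weight_nonneg: "(\<And>b. 0 \<le> c b) \<Longrightarrow> 0 \<le> code_weight c w"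
proof (induction w rule: length_induct)
  case (1 w)
  then show ?case by (subst code_weight.simps) (auto intro!: sum_nonneg mult_nonneg_nonneg)
qed

text \<open>The cuttings whose last block is \<open>b\<close> form one term of the
  recursion.\<close>

lemma code_weight_append:
  assumes c: "\<And>b. 0 \<le> c b" and "b \<noteq> []"
  shows "code_weight c w * c b \<le> code_weight c (w @ b)"
proof -
  let ?f = "\<lambda>l. code_weight c (take (length (w @ b) - l) (w @ b)) * c (drop (length (w @ b) - l) (w @ b))"
  have "?f (length b) \<le> sum ?f {1..length (w @ b)}"
    by (rule member_le_sum)
      (use assms in \<open>auto simp: Suc_le_eq intro!: mult_nonneg_nonneg code_weight_nonneg\<close>)
  moreover have "?f (length b) = code_weight c w * c b" by simp
  moreover have "code_weight c (w @ b) = sum ?f {1..length (w @ b)}"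
    using assms(2) by (subst code_weight.simps) simp
  ultimately show ?thesis by simp
qed

text \<open>Renewal argument: removing the last block bounds the total weight at length
  \<open>n\<close> by the totals at shorter lengths, at most 1 by induction, averaged with the Kraft
  weights of the blocks.\<close>

lemma sum_code_weight_le_1:
  assumes c: "\<And>b. 0 \<le> c b" and kraft: "\<And>n. (\<Sum>l\<in>{1..n}. \<Sum>b\<in>words_over E l. c b) \<le> 1"
  shows "(\<Sum>w\<in>words_over E n. code_weight c w) \<le> 1"
proof (induction n rule: less_induct)
  case (less n)
  show ?case
  proof (cases "n = 0")
    case True
    then show ?thesis by (simp add: words_over_0 code_weight_Nil)
  next
    case False
    have "(\<Sum>w\<in>words_over E n. code_weight c w) =
        (\<Sum>w\<in>words_over E n. \<Sum>l\<in>{1..n}. code_weight c (take (n - l) w) * c (drop (n - l) w))"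
      by (intro sum.cong refl, subst code_weight.simps) (use False in \<open>auto simp: words_over_def\<close>)
    also have "\<dots> = (\<Sum>l\<in>{1..n}. \<Sum>w\<in>words_over E n. code_weight c (take (n - l) w) * c (drop (n - l) w))"
      by (rule sum.swap)
    also have "\<dots> = (\<Sum>l\<in>{1..n}. (\<Sum>u\<in>words_over E (n - l). code_weight c u) * (\<Sum>b\<in>words_over E l. c b))"
    proof (rule sum.cong[OF refl])
      fix l assume "l \<in> {1..n}"
      then have "(\<Sum>w\<in>words_over E n. code_weight c (take (n - l) w) * c (drop (n - l) w)) =
        (\<Sum>u\<in>words_over E (n - l). \<Sum>b\<in>words_over E l. code_weight c u * c b)"
        using sum_words_over_append[of "\<lambda>w. code_weight c (take (n - l) w) * c (drop (n - l) w)" E "n - l" l]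
        by (auto simp: words_over_def intro!: sum.cong)
      then show "(\<Sum>w\<in>words_over E n. code_weight c (take (n - l) w) * c (drop (n - l) w)) =
        (\<Sum>u\<in>words_over E (n - l). code_weight c u) * (\<Sum>b\<in>words_over E l. c b)"
        by (simp add: sum_product)
    qed
    also have "\<dots> \<le> (\<Sum>l\<in>{1..n}. 1 * (\<Sum>b\<in>words_over E l. c b))"
      by (intro sum_mono mult_right_mono less sum_nonneg c) auto
    also have "\<dots> \<le> 1" using kraft[of n] by simp
    finally show ?thesis .
  qed
qed

text \<open>A prefix of a member of \<open>K\<close> costs only \<open>\<eta>\<close> per symbol, yet for large \<open>M\<close> all blocks together
  satisfy Kraft's inequality.\<close>

definition prefix_weight :: "'s set \<Rightarrow> (nat \<Rightarrow> 's) set \<Rightarrow> real \<Rightarrow> nat \<Rightarrow> 's list \<Rightarrow> real" where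
  "prefix_weight E K \<eta> M b =
     (if length b = 1 then 1 / (2 * real (card E)) else 0) +
     (if M \<le> length b \<and> (\<exists>C\<in>K. b = map C [0..<length b]) then exp (- \<eta> * real (length b)) else 0)"

lemma prefix_weight_nonneg: "0 \<le> prefix_weight E K \<eta> M b"
  unfolding prefix_weight_def by simp

text \<open>Single letters receive total weight at most 1/2. For each length there are at most
  \<open>card K\<close> prefixes, so the long blocks add at most a geometric tail, which a large
  \<open>M\<close> pushes below 1/2.\<close>

lemma prefix_weight_kraft:
  assumes "finite E" "finite K" "\<eta> > 0"
  obtains M where "M \<ge> 1" "\<And>n. (\<Sum>l\<in>{1..n}. \<Sum>b\<in>words_over E l. prefix_weight E K \<eta> M b) \<le> 1"
proof -
  define x where "x = exp (- \<eta>)"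
  have x: "0 < x" "x < 1" unfolding x_def using assms(3) by auto
  have pow: "exp (- (\<eta> * real l)) = x ^ l" for l unfolding x_def by (simp add: exp_of_nat_mult[symmetric] mult.commute)
  have "(\<lambda>M. real (card K) * x ^ M / (1 - x)) \<longlonglongrightarrow> real (card K) * 0 / (1 - x)"
    by (intro tendsto_intros) (use x in auto)
  then have "eventually (\<lambda>M. real (card K) * x ^ M / (1 - x) < 1 / 2) sequentially"
    by (rule order_tendstoD) simp
  then obtain M0 where "\<And>M. M \<ge> M0 \<Longrightarrow> real (card K) * x ^ M / (1 - x) < 1 / 2"
    unfolding eventually_sequentially by blast
  then have M: "real (card K) * x ^ Suc M0 / (1 - x) < 1 / 2" by (meson le_SucI order_refl)
  define M where "M = Suc M0"
  have one: "(\<Sum>b\<in>words_over E l. prefix_weight E K \<eta> M b) \<le>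
      (if l = 1 then 1 / 2 else 0) + (if M \<le> l then real (card K) * x ^ l else 0)" for l
  proof -
    have "(\<Sum>b\<in>words_over E l. if length b = 1 then 1 / (2 * real (card E)) else 0) \<le> (if l = 1 then 1 / 2 else 0)"
    proof (cases "l = 1")
      case True
      then show ?thesis by (simp only: sum_words_over_1) simp
    qed (auto simp: words_over_def intro: sum_nonpos)
    moreover have "(\<Sum>b\<in>words_over E l. if M \<le> length b \<and> (\<exists>C\<in>K. b = map C [0..<length b]) then exp (- \<eta> * real (length b)) else 0)
        \<le> (if M \<le> l then real (card K) * x ^ l else 0)"
    proof (cases "M \<le> l")
      case True
      have "(\<Sum>b\<in>words_over E l. if M \<le> length b \<and> (\<exists>C\<in>K. b = map C [0..<length b]) then exp (- \<eta> * real (length b)) else 0)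
        = (\<Sum>b\<in>words_over E l. if \<exists>C\<in>K. b = map C [0..<l] then x ^ l else 0)"
        by (rule sum.cong) (use True in \<open>auto simp: words_over_def pow\<close>)
      also have "\<dots> = (\<Sum>b\<in>{b \<in> words_over E l. \<exists>C\<in>K. b = map C [0..<l]}. x ^ l)"
        by (rule sum.inter_filter[symmetric]) (rule finite_words_over[OF assms(1)])
      also have "\<dots> = real (card {b \<in> words_over E l. \<exists>C\<in>K. b = map C [0..<l]}) * x ^ l" by simp
      also have "card {b \<in> words_over E l. \<exists>C\<in>K. b = map C [0..<l]} \<le> card ((\<lambda>C. map C [0..<l]) ` K)"
        by (rule card_mono) (use assms(2) in auto)
      also have "card ((\<lambda>C. map C [0..<l]) ` K) \<le> card K" using assms(2) by (rule card_image_le)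
      finally show ?thesis using True x by (simp add: mult_right_mono)
    qed (auto simp: words_over_def intro: sum_nonpos)
    ultimately show ?thesis unfolding prefix_weight_def sum.distrib by (rule add_mono)
  qed
  have "(\<Sum>l\<in>{1..n}. \<Sum>b\<in>words_over E l. prefix_weight E K \<eta> M b) \<le> 1" for n
  proof -
    have "(\<Sum>l\<in>{1..n}. \<Sum>b\<in>words_over E l. prefix_weight E K \<eta> M b) \<le>
      (\<Sum>l\<in>{1..n}. (if l = 1 then 1 / 2 else 0) + (if M \<le> l then real (card K) * x ^ l else 0))"
      by (rule sum_mono) (rule one)
    also have "\<dots> = (\<Sum>l\<in>{1..n}. if l = 1 then 1 / 2 else 0) + (\<Sum>l\<in>{1..n}. if M \<le> l then real (card K) * x ^ l else 0)"
      by (rule sum.distrib)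
    also have "(\<Sum>l\<in>{1..n}. if l = 1 then 1 / 2 else 0) \<le> (1 / 2 :: real)" by simp
    also have "(\<Sum>l\<in>{1..n}. if M \<le> l then real (card K) * x ^ l else 0) \<le> 1 / 2"
    proof -
      have "(\<Sum>l\<in>{1..n}. if M \<le> l then real (card K) * x ^ l else 0) = (\<Sum>l\<in>{l \<in> {1..n}. M \<le> l}. real (card K) * x ^ l)"
        by (rule sum.inter_filter[symmetric]) simp
      also have "{l \<in> {1..n}. M \<le> l} = {M..n}" unfolding M_def by auto
      also have "(\<Sum>l\<in>{M..n}. real (card K) * x ^ l) = real (card K) * (\<Sum>l\<in>{M..n}. x ^ l)" by (simp add: sum_distrib_left)
      also have "(\<Sum>l\<in>{M..n}. x ^ l) \<le> x ^ M / (1 - x)"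
      proof -
        have "(1 - x) * (\<Sum>l\<in>{M..n}. x ^ l) \<le> x ^ M"
        proof (cases "M \<le> n")
          case True
          have "(1 - x) * (\<Sum>l\<in>{M..n}. x ^ l) = x ^ M - x ^ Suc n"
            using sum_gp_multiplied[OF True, of x] .
          then show ?thesis using x by simp
        qed (use x in simp)
        then show ?thesis using x by (simp add: field_simps)
      qed
      finally have "(\<Sum>l\<in>{1..n}. if M \<le> l then real (card K) * x ^ l else 0) \<le> real (card K) * (x ^ M / (1 - x))"
        by (simp add: mult_left_mono)
      also have "real (card K) * (x ^ M / (1 - x)) \<le> 1 / 2" using M unfolding M_def times_divide_eq_right by (rule less_imp_le)
      finally show ?thesis .
    qed
    finally show ?thesis by simp
  qed
  then show thesis using that[of M] unfolding M_def by simp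
qed


text \<open>The block must start inside the window that begins at \<open>m\<close>, because only
  that window is encoded.\<close>

definition block_ends_at :: "(nat \<Rightarrow> 's) set \<Rightarrow> nat \<Rightarrow> int \<Rightarrow> (int \<Rightarrow> 's) \<Rightarrow> int \<Rightarrow> bool" where
  "block_ends_at K M m A p \<longleftrightarrow>
     (\<exists>l\<ge>M. m \<le> p + 1 - int l \<and> (\<exists>C\<in>K. map A [p + 1 - int l..p] = map C [0..<l]))"

text \<open>The window is parsed from the right. If a long prefix of a member of \<open>K\<close>
  ends at the last position, it is removed at \<eta> per symbol; otherwise one letter is removed at
  the price \<open>ln (2 * real (card E))\<close>, which happens only at bad positions. Parsing from
  the right keeps the left end \<open>m\<close>, so the bad positions of the remaining window are
  among the old ones.\<close>

lemma code_weight_cost: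
  assumes E: "finite E" and AE: "\<And>i. A i \<in> E" and \<eta>: "\<eta> > 0" and M: "M \<ge> 1"
  shows "exp (- (\<eta> * real n + ln (2 * real (card E)) *
      real (card {p \<in> {m..<m + int n}. \<not> block_ends_at K M m A p})))
    \<le> code_weight (prefix_weight E K \<eta> M) (map A [m..m + int n - 1])"
proof (induction n rule: less_induct)
  case (less n)
  let ?D = "ln (2 * real (card E))"
  let ?bad = "\<lambda>n. {p \<in> {m..<m + int n}. \<not> block_ends_at K M m A p}"
  let ?Q = "code_weight (prefix_weight E K \<eta> M)"
  have cE: "1 \<le> card E" using E AE card_gt_0_iff[of E] by fastforce
  then have D: "?D \<ge> 0" by simp
  have fin: "finite (?bad k)" for k by (rule finite_subset[of _ "{m..<m + int k}"]) auto
  show ?case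
  proof (cases "n = 0")
    case True
    then show ?thesis by (simp add: code_weight_Nil)
  next
    case False
    define p where "p = m + int n - 1"
    show ?thesis
    proof (cases "block_ends_at K M m A p")
      case True
      then obtain l C where l: "l \<ge> M" "m \<le> p + 1 - int l" "C \<in> K" "map A [p + 1 - int l..p] = map C [0..<l]"
        unfolding block_ends_at_def by blast
      have ln: "1 \<le> l" "l \<le> n" using l(1,2) M unfolding p_def by auto
      let ?b = "map A [p + 1 - int l..p]"
      have split: "map A [m..m + int n - 1] = map A [m..m + int (n - l) - 1] @ ?b"
        using upto_split2[of m "m + int (n - l) - 1" p] upto_split1[of m "p + 1 - int l" p] ln l(2)
        unfolding p_def by (simp add: of_nat_diff algebra_simps)
      have b: "length ?b = l" using l(4) by (metis length_map length_upt minus_nat.diff_0)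
      have "exp (- \<eta> * real l) \<le> prefix_weight E K \<eta> M ?b"
        unfolding prefix_weight_def b using l by auto
      moreover have "exp (- (\<eta> * real (n - l) + ?D * real (card (?bad (n - l))))) \<le> ?Q (map A [m..m + int (n - l) - 1])"
        using less[of "n - l"] ln by simp
      ultimately have "exp (- (\<eta> * real (n - l) + ?D * real (card (?bad (n - l))))) * exp (- \<eta> * real l)
          \<le> ?Q (map A [m..m + int (n - l) - 1]) * prefix_weight E K \<eta> M ?b"
        by (intro mult_mono code_weight_nonneg prefix_weight_nonneg) auto
      also have "\<dots> \<le> ?Q (map A [m..m + int n - 1])"
        unfolding split by (rule code_weight_append[OF prefix_weight_nonneg]) (use b ln in auto)
      finally have *: "exp (- (\<eta> * real (n - l) + ?D * real (card (?bad (n - l))))) * exp (- \<eta> * real l)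
          \<le> ?Q (map A [m..m + int n - 1])" .
      have "card (?bad (n - l)) \<le> card (?bad n)" by (rule card_mono[OF fin]) auto
      then have "?D * real (card (?bad (n - l))) \<le> ?D * real (card (?bad n))" using D by (intro mult_left_mono) auto
      then have "exp (- (\<eta> * real n + ?D * real (card (?bad n)))) \<le>
          exp (- (\<eta> * real (n - l) + ?D * real (card (?bad (n - l))))) * exp (- \<eta> * real l)"
        using ln by (simp add: exp_add[symmetric] of_nat_diff algebra_simps)
      with * show ?thesis by linarith
    next
      case bad: False
      have split: "map A [m..m + int n - 1] = map A [m..m + int (n - 1) - 1] @ [A p]"
        using map_upto_snoc[of m "m + int (n - 1) - 1" A] False unfolding p_def by (simp add: of_nat_diff)
      have "exp (- ?D) = 1 / (2 * real (card E))" using cE by (simp add: exp_minus inverse_eq_divide)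
      then have "exp (- ?D) \<le> prefix_weight E K \<eta> M [A p]" unfolding prefix_weight_def by simp
      moreover have "exp (- (\<eta> * real (n - 1) + ?D * real (card (?bad (n - 1))))) \<le> ?Q (map A [m..m + int (n - 1) - 1])"
        using less[of "n - 1"] False by simp
      ultimately have "exp (- (\<eta> * real (n - 1) + ?D * real (card (?bad (n - 1))))) * exp (- ?D)
          \<le> ?Q (map A [m..m + int (n - 1) - 1]) * prefix_weight E K \<eta> M [A p]"
        by (intro mult_mono code_weight_nonneg prefix_weight_nonneg) auto
      also have "\<dots> \<le> ?Q (map A [m..m + int n - 1])"
        unfolding split by (rule code_weight_append[OF prefix_weight_nonneg]) simp
      finally have *: "exp (- (\<eta> * real (n - 1) + ?D * real (card (?bad (n - 1))))) * exp (- ?D)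
          \<le> ?Q (map A [m..m + int n - 1])" .
      have "?bad n = insert p (?bad (n - 1))" using False bad unfolding p_def by auto
      moreover have "p \<notin> ?bad (n - 1)" using False unfolding p_def by auto
      ultimately have "card (?bad n) = Suc (card (?bad (n - 1)))" using fin by simp
      then have "exp (- (\<eta> * real n + ?D * real (card (?bad n)))) \<le>
          exp (- (\<eta> * real (n - 1) + ?D * real (card (?bad (n - 1))))) * exp (- ?D)"
        using False \<eta> by (simp add: exp_add[symmetric] of_nat_diff algebra_simps)
      with * show ?thesis by linarith
    qed
  qed
qed

section \<open>Entropy bounds\<close>

context prob_space
begin

lemma integral_simple_compose:
  fixes g :: "'b \<Rightarrow> real"
  assumes Z: "simple_function M Z"
  shows "integrable M (\<lambda>x. g (Z x))"
    "(\<integral>x. g (Z x) \<partial>M) = (\<Sum>z\<in>Z ` space M. prob (Z -` {z} \<inter> space M) * g z)"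
proof -
  note fin = simple_functionD(1)[OF Z] and meas = simple_functionD(2)[OF Z]
  let ?h = "\<lambda>x. \<Sum>z\<in>Z ` space M. g z * indicator (Z -` {z} \<inter> space M) x"
  have eq: "g (Z x) = ?h x" if "x \<in> space M" for x
  proof -
    have "?h x = (\<Sum>z\<in>Z ` space M. if z = Z x then g z else 0)"
      by (intro sum.cong refl) (use that in \<open>auto simp: indicator_def\<close>)
    then show ?thesis using fin that by simp
  qed
  have int: "integrable M ?h"
    by (intro Bochner_Integration.integrable_sum Bochner_Integration.integrable_mult_right)
      (use meas in \<open>auto simp: emeasure_finite less_top[symmetric]\<close>)
  then show "integrable M (\<lambda>x. g (Z x))" 
    using Bochner_Integration.integrable_cong[where f = "\<lambda>x. g (Z x)" and g = ?h, OF refl eq] by blast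
  have "(\<integral>x. g (Z x) \<partial>M) = (\<integral>x. ?h x \<partial>M)" 
    by (rule Bochner_Integration.integral_cong[where f = "\<lambda>x. g (Z x)" and g = ?h, OF refl eq])
  also have "\<dots> = (\<Sum>z\<in>Z ` space M. \<integral>x. g z * indicator (Z -` {z} \<inter> space M) x \<partial>M)"
    by (rule Bochner_Integration.integral_sum) (use meas in \<open>auto simp: emeasure_finite less_top[symmetric] intro!: Bochner_Integration.integrable_mult_right\<close>)
  also have "\<dots> = (\<Sum>z\<in>Z ` space M. prob (Z -` {z} \<inter> space M) * g z)"
    by (intro sum.cong refl) (simp add: Int_absorb2 sets.sets_into_space)
  finally show "(\<integral>x. g (Z x) \<partial>M) = (\<Sum>z\<in>Z ` space M. prob (Z -` {z} \<inter> space M) * g z)" .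
qed

lemma partition_entropy_eq:
  assumes Z: "simple_function M Z"
  shows "partition_entropy M Z = - (\<Sum>z\<in>Z ` space M. prob (Z -` {z} \<inter> space M) * ln (prob (Z -` {z} \<inter> space M)))"
proof -
  interpret information_space M "exp 1" by unfold_locales simp
  have "simple_distributed M Z (\<lambda>z. prob (Z -` {z} \<inter> space M))"
    by (rule simple_distributedI[OF Z]) auto
  from entropy_simple_distributed[OF this] show ?thesis
    unfolding partition_entropy_def by (simp add: log_def)
qed

lemma partition_entropy_nonneg:
  assumes Z: "simple_function M Z" shows "0 \<le> partition_entropy M Z"
proof -
  have "prob (Z -` {z} \<inter> space M) * ln (prob (Z -` {z} \<inter> space M)) \<le> 0" for z
    by (cases "prob (Z -` {z} \<inter> space M) = 0")
      (auto simp: mult_le_0_iff prob_le_1 zero_less_measure_iff measure_nonneg intro!: ln_le_zero_iff[THEN iffD2])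
  then show ?thesis unfolding partition_entropy_eq[OF Z] by (simp add: sum_nonpos)
qed

text \<open>Gibbs' inequality, from ln t \<le> t - 1 with t = q/p. Total mass at most 1 suffices for
  \<open>q\<close>, and \<open>cost\<close> may be any integrable bound for the code length, not
  only a function of \<open>Z\<close>.\<close>

lemma partition_entropy_le_code:
  assumes Z: "simple_function M Z"
    and q: "\<And>x. x \<in> space M \<Longrightarrow> 0 < q (Z x)" "(\<Sum>z\<in>Z ` space M. q z) \<le> 1"
    and cost: "integrable M cost" "\<And>x. x \<in> space M \<Longrightarrow> - ln (q (Z x)) \<le> cost x"
  shows "partition_entropy M Z \<le> (\<integral>x. cost x \<partial>M)"
proof -
  let ?p = "\<lambda>z. prob (Z -` {z} \<inter> space M)"
  have total: "(\<Sum>z\<in>Z ` space M. ?p z) = 1"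
    using integral_simple_compose(2)[OF Z, of "\<lambda>_. 1"] by (simp add: prob_space)
  \<comment> \<open>The correction \<open>q z - ?p z\<close> has a nonpositive sum.\<close>
  have "- (?p z * ln (?p z)) \<le> ?p z * (- ln (q z)) + (q z - ?p z)" if "z \<in> Z ` space M" for z
  proof (cases "?p z = 0")
    case True
    then show ?thesis using q(1) that by (auto intro: less_imp_le)
  next
    case False
    then have p: "?p z > 0" by (simp add: zero_less_measure_iff)
    have qz: "q z > 0" using q(1) that by auto
    have "ln (q z / ?p z) \<le> q z / ?p z - 1" using p qz by (intro ln_le_minus_one) simp
    then have "?p z * ln (q z / ?p z) \<le> ?p z * (q z / ?p z - 1)" using p by (intro mult_left_mono) auto
    then show ?thesis using p qz by (simp add: ln_div algebra_simps)
  qed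
  then have "(\<Sum>z\<in>Z ` space M. - (?p z * ln (?p z))) \<le> (\<Sum>z\<in>Z ` space M. ?p z * (- ln (q z)) + (q z - ?p z))"
    by (rule sum_mono)
  also have "\<dots> = (\<Sum>z\<in>Z ` space M. ?p z * (- ln (q z))) + ((\<Sum>z\<in>Z ` space M. q z) - 1)"
    unfolding sum.distrib sum_subtractf total ..
  also have "\<dots> \<le> (\<Sum>z\<in>Z ` space M. ?p z * (- ln (q z)))" using q(2) by simp
  also have "\<dots> = (\<integral>x. - ln (q (Z x)) \<partial>M)" using integral_simple_compose(2)[OF Z, of "\<lambda>z. - ln (q z)"] by simp
  also have "\<dots> \<le> (\<integral>x. cost x \<partial>M)"
    by (rule integral_mono) (use cost integral_simple_compose(1)[OF Z, of "\<lambda>z. - ln (q z)"] in auto)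
  finally show ?thesis unfolding partition_entropy_eq[OF Z] by (simp add: sum_negf)
qed

end

lemma sets_invariant_prob_space: "invariant_prob X f M \<Longrightarrow> space M = topspace X"
  unfolding invariant_prob_def using sets_eq_imp_space_eq space_borel_of by metis

lemma funpow_measurable:
  assumes "f \<in> M \<rightarrow>\<^sub>M M" shows "(f ^^ n) \<in> M \<rightarrow>\<^sub>M M"
  by (induction n) (use assms in \<open>auto intro: measurable_compose simp: comp_def\<close>)

lemma funpow_distr:
  assumes f: "f \<in> M \<rightarrow>\<^sub>M M" and inv: "distr M M f = M" shows "distr M M (f ^^ n) = M"
proof (induction n)
  case 0
  show ?case by (simp add: id_def distr_id)
next
  case (Suc n)
  have "distr M M (f ^^ Suc n) = distr (distr M M (f ^^ n)) M f"
    by (simp only: distr_distr[OF f funpow_measurable[OF f, of n]] funpow.simps)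
  also have "\<dots> = M" unfolding Suc inv ..
  finally show ?case .
qed

lemma funpow_measure:
  assumes f: "f \<in> M \<rightarrow>\<^sub>M M" and inv: "distr M M f = M" and B: "B \<in> sets M"
  shows "measure M ((f ^^ n) -` B \<inter> space M) = measure M B"
  using measure_distr[OF funpow_measurable[OF f] B, of n] funpow_distr[OF f inv, of n] by simp

lemma simple_function_name:
  assumes f: "f \<in> M \<rightarrow>\<^sub>M M" and Y: "simple_function M Y"
  shows "simple_function M (name f Y n)"
proof (induction n)
  case 0
  show ?case unfolding name_def by simp
next
  case (Suc n)
  have "simple_function M (\<lambda>x. Y ((f ^^ n) x))"
  proof -
    have "(\<lambda>x. Y ((f ^^ n) x)) ` space M \<subseteq> Y ` space M"
      using measurable_space[OF funpow_measurable[OF f, of n]] by auto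
    moreover have "(\<lambda>x. Y ((f ^^ n) x)) -` {y} \<inter> space M \<in> sets M" for y
    proof -
      have "(\<lambda>x. Y ((f ^^ n) x)) -` {y} \<inter> space M = (f ^^ n) -` (Y -` {y} \<inter> space M) \<inter> space M"
        using measurable_space[OF funpow_measurable[OF f, of n]] by auto
      then show ?thesis using measurable_sets[OF funpow_measurable[OF f, of n] simple_functionD(2)[OF Y, of "{y}"]] by simp
    qed
    ultimately show ?thesis unfolding simple_function_def using simple_functionD(1)[OF Y] finite_subset by blast
  qed
  from simple_function_compose2[OF Suc this, of "\<lambda>xs y. xs @ [y]"] show ?case
    unfolding name_def by simp
qed

section \<open>Approximation of sets and simple functions by finitely many coordinates\<close>

context subshift_space
begin

lemma determined_UN:
  assumes "finite I" "\<And>i. i \<in> I \<Longrightarrow> determined (r i) (D i)"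
  shows "determined (\<Sum>i\<in>I. r i) (\<Union>i\<in>I. D i)"
proof -
  have "determined (\<Sum>i\<in>I. r i) (D i)" if "i \<in> I" for i
    using assms that by (meson determined_mono member_le_sum zero_le)
  then show ?thesis unfolding determined_def by blast
qed

text \<open>The sets with such approximations include the open sets, by continuity from below, and
  are closed under complements and countable unions.\<close>

lemma approx_determined:
  assumes "finite_measure \<mu>" and sets: "sets \<mu> = sets (borel_of seqtop)" and "B \<in> sets \<mu>" "\<epsilon> > 0"
  shows "\<exists>r D. determined r D \<and> measure \<mu> ((B - D) \<union> (D - B)) < \<epsilon>"
proof -
  interpret finite_measure \<mu> by fact
  have space: "space \<mu> = X" using sets_eq_imp_space_eq[OF sets] unfolding space_borel_of topspace_seqtop .
  have sigma: "sets \<mu> = sigma_sets X {U. openin seqtop U}"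
    unfolding sets borel_of_def topspace_seqtop by (rule sets_measure_of) (auto simp: openin_seqtop_iff)
  have det: "D \<in> sets \<mu>" if "determined r D" for r D using determined_sets[OF that] sets by simp
  have inc: "\<exists>n. measure \<mu> ((\<Union>i. F i) - F n) < \<epsilon>" if F: "range F \<subseteq> sets \<mu>" "incseq F" "\<epsilon> > 0" for F \<epsilon>
  proof -
    have "(\<lambda>n. measure \<mu> (F n)) \<longlonglongrightarrow> measure \<mu> (\<Union>i. F i)" by (rule finite_Lim_measure_incseq[OF F(1,2)])
    then have "eventually (\<lambda>n. measure \<mu> (\<Union>i. F i) - \<epsilon> < measure \<mu> (F n)) sequentially"
      by (rule order_tendstoD) (use F(3) in simp)
    then obtain n where "measure \<mu> (\<Union>i. F i) - \<epsilon> < measure \<mu> (F n)" by (auto simp: eventually_sequentially)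
    moreover have "measure \<mu> ((\<Union>i. F i) - F n) = measure \<mu> (\<Union>i. F i) - measure \<mu> (F n)"
      by (rule finite_measure_Diff) (use F in auto)
    ultimately show ?thesis by (intro exI[of _ n]) simp
  qed
  have "B \<in> sigma_sets X {U. openin seqtop U}" using assms(3) sigma by simp
  then show ?thesis using \<open>\<epsilon> > 0\<close>
  proof (induction arbitrary: \<epsilon> rule: sigma_sets.induct)
    case (Basic U)
    then obtain D where D: "U = (\<Union>r. D r)" "\<And>r. determined r (D r)" "incseq D"
      using openin_UN_determined by blast
    then obtain n where "measure \<mu> (U - D n) < \<epsilon>" using inc[of D \<epsilon>] det Basic.prems by blast
    moreover have "(U - D n) \<union> (D n - U) = U - D n" using D(1) by blast
    ultimately show ?case using D(2) by metis
  next
    case Empty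
    have "determined 0 {}" unfolding determined_def by simp
    then show ?case using Empty by (intro exI[of _ 0] exI[of _ "{}"]) simp
  next
    case (Compl B)
    then obtain r D where D: "determined r D" "measure \<mu> ((B - D) \<union> (D - B)) < \<epsilon>" by blast
    have "B \<subseteq> X" using Compl.hyps sets.sets_into_space[of B \<mu>] space sigma by simp
    have "D \<subseteq> X" using D(1) unfolding determined_def by simp
    have "determined r (X - D)" using D(1) unfolding determined_def by (metis DiffD1 DiffD2 DiffI subsetI)
    moreover have "((X - B) - (X - D)) \<union> ((X - D) - (X - B)) = (B - D) \<union> (D - B)"
      using \<open>B \<subseteq> X\<close> \<open>D \<subseteq> X\<close> by blast
    ultimately show ?case using D(2) by metis
  next
    case (Union B)
    have Bs: "B i \<in> sets \<mu>" for i using Union.hyps sigma by simp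
    \<comment> \<open>The union is cut off at \<open>n\<close> with error below \<epsilon>/2; the
      other half is shared by the \<open>n\<close> remaining sets. The denominator uses
      \<open>Suc n\<close> because \<open>n\<close> may be 0.\<close>
    define F where "F = (\<lambda>n. \<Union>i<n. B i)"
    have "incseq F" unfolding F_def by (rule incseq_SucI, rule UN_mono) auto
    moreover have "range F \<subseteq> sets \<mu>" unfolding F_def using Bs by auto
    moreover have UF: "(\<Union>i. F i) = (\<Union>i. B i)" unfolding F_def by auto
    ultimately obtain n where n: "measure \<mu> ((\<Union>i. B i) - F n) < \<epsilon> / 2" using inc[of F "\<epsilon> / 2"] Union.prems by auto
    have "\<exists>r D. determined r D \<and> measure \<mu> ((B i - D) \<union> (D - B i)) < \<epsilon> / (2 * real (Suc n))" for i
      using Union by (intro Union.IH) auto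
    then obtain r D where D: "\<And>i. determined (r i) (D i)"
      "\<And>i. measure \<mu> ((B i - D i) \<union> (D i - B i)) < \<epsilon> / (2 * real (Suc n))" by metis
    let ?D = "\<Union>i<n. D i"
    have "determined (\<Sum>i<n. r i) ?D" by (rule determined_UN) (use D in auto)
    moreover have "measure \<mu> (((\<Union>i. B i) - ?D) \<union> (?D - (\<Union>i. B i))) < \<epsilon>"
    proof -
      have s: "(\<Union>i. B i) - F n \<in> sets \<mu>" "(\<Union>i<n. (B i - D i) \<union> (D i - B i)) \<in> sets \<mu>"
        unfolding F_def using Bs det[OF D(1)] by auto
      have "measure \<mu> (((\<Union>i. B i) - ?D) \<union> (?D - (\<Union>i. B i))) \<le>
          measure \<mu> (((\<Union>i. B i) - F n) \<union> (\<Union>i<n. (B i - D i) \<union> (D i - B i)))"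
        by (rule finite_measure_mono) (use s in \<open>auto simp: F_def\<close>)
      also have "\<dots> \<le> measure \<mu> ((\<Union>i. B i) - F n) + measure \<mu> (\<Union>i<n. (B i - D i) \<union> (D i - B i))"
        by (rule measure_Un_le) (use s in auto)
      also have "measure \<mu> (\<Union>i<n. (B i - D i) \<union> (D i - B i)) \<le> (\<Sum>i<n. measure \<mu> ((B i - D i) \<union> (D i - B i)))"
        by (rule finite_measure_subadditive_finite) (use Bs det[OF D(1)] in auto)
      also have "\<dots> \<le> (\<Sum>i<n. \<epsilon> / (2 * real (Suc n)))" by (rule sum_mono) (rule less_imp_le[OF D(2)])
      also have "\<dots> \<le> \<epsilon> / 2" using Union.prems by (simp add: field_simps)
      finally show ?thesis using n by simp
    qed
    ultimately show ?case by blast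
  qed
qed

text \<open>Each level set of \<open>Y\<close> is approximated by a set \<open>D v\<close>, and
  \<open>B\<close> collects all the errors. Outside \<open>B\<close> a point \<open>A\<close> lies
  in \<open>D v\<close> for exactly one value in \<open>V\<close>, namely \<open>Y A\<close>, and
  the sets \<open>D v\<close> depend on a central window only.\<close>

lemma approx_simple_function:
  assumes "finite_measure \<mu>" and sets: "sets \<mu> = sets (borel_of seqtop)" and Y: "simple_function \<mu> Y" and "\<epsilon> > 0"
  obtains r B and G :: "'s list \<Rightarrow> 'b" where "B \<in> sets \<mu>" "measure \<mu> B < \<epsilon>"
    "\<And>A. A \<in> X \<Longrightarrow> A \<notin> B \<Longrightarrow> Y A = G (map A [- int r..int r])"
proof -
  interpret finite_measure \<mu> by fact
  have space: "space \<mu> = X" using sets_eq_imp_space_eq[OF sets] unfolding space_borel_of topspace_seqtop .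
  define V where "V = Y ` X"
  have V: "finite V" using simple_functionD(1)[OF Y] unfolding V_def space .
  have lev: "Y -` {v} \<inter> X \<in> sets \<mu>" for v using simple_functionD(2)[OF Y, of "{v}"] unfolding space .
  have "\<exists>r D. determined r D \<and> measure \<mu> ((Y -` {v} \<inter> X - D) \<union> (D - Y -` {v} \<inter> X)) < \<epsilon> / (real (Suc (card V)))" for v
    by (rule approx_determined[OF assms(1,2) lev]) (use \<open>\<epsilon> > 0\<close> in simp)
  then obtain r D where D: "\<And>v. determined (r v) (D v)"
    "\<And>v. measure \<mu> ((Y -` {v} \<inter> X - D v) \<union> (D v - Y -` {v} \<inter> X)) < \<epsilon> / (real (Suc (card V)))" by metis
  have Ds: "D v \<in> sets \<mu>" for v using determined_sets[OF D(1)] sets by simp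
  define B where "B = (\<Union>v\<in>V. (Y -` {v} \<inter> X - D v) \<union> (D v - Y -` {v} \<inter> X))"
  define R where "R = (\<Sum>v\<in>V. r v)"
  have DR: "determined R (D v)" if "v \<in> V" for v
    unfolding R_def using that D(1) V by (meson determined_mono member_le_sum zero_le)
  define Y' where "Y' = (\<lambda>A. the_elem {v \<in> V. A \<in> D v})"
    \<comment> \<open>the set is a singleton outside \<open>B\<close>; on \<open>B\<close> the value is irrelevant\<close>
  define G where "G = (\<lambda>w. Y' (SOME A. A \<in> X \<and> map A [- int R..int R] = w))"
  show thesis
  proof (rule that)
    show "B \<in> sets \<mu>" unfolding B_def using V lev Ds by auto
    have "measure \<mu> B \<le> (\<Sum>v\<in>V. measure \<mu> ((Y -` {v} \<inter> X - D v) \<union> (D v - Y -` {v} \<inter> X)))"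
      unfolding B_def by (rule finite_measure_subadditive_finite) (use V lev Ds in auto)
    also have "\<dots> \<le> (\<Sum>v\<in>V. \<epsilon> / (real (Suc (card V))))" by (rule sum_mono) (rule less_imp_le[OF D(2)])
    also have "\<dots> < \<epsilon>" using \<open>\<epsilon> > 0\<close> by (simp add: field_simps)
    finally show "measure \<mu> B < \<epsilon>" .
    fix A assume A: "A \<in> X" "A \<notin> B"
    have "\<exists>A'. A' \<in> X \<and> map A' [- int R..int R] = map A [- int R..int R]" using A(1) by blast
    from someI_ex[OF this] obtain A' where A': "A' \<in> X" "map A' [- int R..int R] = map A [- int R..int R]"
      "G (map A [- int R..int R]) = Y' A'" unfolding G_def by blast
    have "A' \<in> D v \<longleftrightarrow> A \<in> D v" if "v \<in> V" for v
      by (rule determined_iff[OF DR[OF that] A'(1) A(1)]) (use A'(2) in \<open>simp add: map_upto_eq_iff\<close>)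
    moreover have "A \<in> D v \<longleftrightarrow> v = Y A" if "v \<in> V" for v using A that unfolding B_def by blast
    moreover have "Y A \<in> V" unfolding V_def using A(1) by simp
    ultimately have "{v \<in> V. A' \<in> D v} = {Y A}" by blast
    then show "Y A = G (map A [- int R..int R])" unfolding A'(3) Y'_def by simp
  qed
qed

end

section \<open>Shadowed sequences carry no entropy\<close>

context alphabet_subshift
begin

lemma left_shift_S: "A \<in> S \<Longrightarrow> left_shift A \<in> S"
  unfolding left_shift_def by (rule shift)

lemma funpow_left_shift_S: "A \<in> S \<Longrightarrow> (left_shift ^^ n) A \<in> S"
  by (induction n) (auto intro: left_shift_S)

text \<open>Shadowing at time 0 provides arbitrarily long prefixes ending there, so almost surely
  one of length at least \<open>M\<close>. Continuity from above yields a common bound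
  \<open>L\<close> on its length outside a small set.\<close>

lemma shadowed_blocks:
  assumes prob: "prob_space \<mu>" and sets: "sets \<mu> = sets (borel_of seqtop)"
    and sh: "AE A in \<mu>. shadowed_at K A 0" and "\<epsilon> > 0"
  obtains L B where "B \<in> sets \<mu>" "measure \<mu> B < \<epsilon>"
    "\<And>A. A \<in> S \<Longrightarrow> A \<notin> B \<Longrightarrow> \<exists>l\<in>{M..L}. \<exists>C\<in>K. map A [1 - int l..0] = map C [0..<l]"
proof -
  interpret prob_space \<mu> by fact
  have space: "space \<mu> = S" using sets_eq_imp_space_eq[OF sets] unfolding space_borel_of topspace_seqtop .
  define G where "G = (\<lambda>l. {A \<in> S. \<exists>C\<in>K. map A [1 - int l..0] = map C [0..<l]})"
  define B where "B = (\<lambda>L. S - (\<Union>l\<in>{M..L}. G l))"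
  have Gs: "G l \<in> sets \<mu>" for l
    unfolding G_def sets by (rule window_sets[of "\<lambda>w. \<exists>C\<in>K. w = map C [0..<l]"])
  have Bs: "B L \<in> sets \<mu>" for L unfolding B_def space[symmetric] using Gs by auto
  have "decseq B" unfolding B_def by (rule decseq_SucI) auto
  then have "(\<lambda>L. measure \<mu> (B L)) \<longlonglongrightarrow> measure \<mu> (\<Inter>L. B L)"
    by (intro finite_Lim_measure_decseq) (use Bs in auto)
  moreover have "measure \<mu> (\<Inter>L. B L) = 0"
  proof -
    have "AE A in \<mu>. A \<notin> (\<Inter>L. B L)"
      using sh AE_space
    proof eventually_elim
      case (elim A)
      then obtain n C where n: "n \<ge> M" "C \<in> K" "map A [0 - int n..0] = map C [0..<Suc n]"
        unfolding shadowed_at_def by blast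
      then have "A \<in> G (Suc n)" unfolding G_def using elim space by (auto simp del: upt_Suc)
      then have "A \<notin> B (Suc n)" unfolding B_def using n(1) by auto
      then show ?case by blast
    qed
    moreover have "(\<Inter>L. B L) \<in> sets \<mu>" using Bs by auto
    ultimately show ?thesis by (simp add: prob_eq_0)
  qed
  ultimately have "eventually (\<lambda>L. measure \<mu> (B L) < \<epsilon>) sequentially"
    using order_tendstoD(2)[of "\<lambda>L. measure \<mu> (B L)" 0 sequentially \<epsilon>] \<open>\<epsilon> > 0\<close> by simp
  then obtain L where "measure \<mu> (B L) < \<epsilon>" by (auto simp: eventually_sequentially)
  moreover have "\<exists>l\<in>{M..L}. \<exists>C\<in>K. map A [1 - int l..0] = map C [0..<l]" if "A \<in> S" "A \<notin> B L" for A
    using that unfolding B_def G_def by blast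
  ultimately show thesis using that Bs by blast
qed

text \<open>The name of length \<open>n\<close> is coded through a longer word of the sequence: the
  block code weights the words, and given a word the letters of the name are guessed from it
  independently, with room for error. Four costs are each kept near \<epsilon>/4 per symbol on
  average: prefix blocks, letters at bad positions, correct guesses and wrong guesses.\<close>

lemma entropy_name_bound:
  assumes inv: "invariant_prob seqtop left_shift \<mu>" and K: "finite K"
    and sh: "AE A in \<mu>. shadowed_at K A 0" and Y: "simple_function \<mu> Y" and \<epsilon>: "\<epsilon> > 0"
  shows "\<exists>C. \<forall>n. partition_entropy \<mu> (name left_shift Y n) \<le> real n * \<epsilon> + C"
proof -
  have prob: "prob_space \<mu>" and sets: "sets \<mu> = sets (borel_of seqtop)"
    and meas: "left_shift \<in> \<mu> \<rightarrow>\<^sub>M \<mu>" and distr: "distr \<mu> \<mu> left_shift = \<mu>"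
    using inv unfolding invariant_prob_def by auto
  interpret prob_space \<mu> by fact
  have space: "space \<mu> = S" using sets_eq_imp_space_eq[OF sets] unfolding space_borel_of topspace_seqtop .
  obtain A0 where A0: "A0 \<in> S" using not_empty space by auto
  define V where "V = Y ` S"
  have V: "finite V" "V \<noteq> {}" using simple_functionD(1)[OF Y] A0 unfolding V_def space by auto
  define k where "k = real (card V)"
  have k: "k \<ge> 1" unfolding k_def using V by (simp add: Suc_le_eq card_gt_0_iff)
  \<comment> \<open>Chosen so that -ln (1 - \<delta>) = \<epsilon>/4 bounds the price of a correct
    guess; \<beta> below bounds that of a wrong one.\<close>
  define \<delta> where "\<delta> = 1 - exp (- \<epsilon> / 4)"
  have \<delta>: "0 < \<delta>" "\<delta> < 1" unfolding \<delta>_def using \<epsilon> by auto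
  define \<beta> where "\<beta> = ln (k / \<delta>)"
  have \<beta>: "\<beta> \<ge> 0" unfolding \<beta>_def using k \<delta> by (simp add: field_simps)
  have cE: "1 \<le> card E" using finite_alphabet range[OF A0] card_gt_0_iff[of E] by fastforce
  define d where "d = ln (2 * real (card E))"
  have d: "d \<ge> 0" unfolding d_def using cE by simp
  have \<epsilon>4: "\<epsilon> / 4 > 0" using \<epsilon> by simp
  obtain M where M: "M \<ge> 1" "\<And>n. (\<Sum>l\<in>{1..n}. \<Sum>b\<in>words_over E l. prefix_weight E K (\<epsilon> / 4) M b) \<le> 1"
    using prefix_weight_kraft[OF finite_alphabet K \<epsilon>4] by blast
  let ?Q = "code_weight (prefix_weight E K (\<epsilon> / 4) M)"
  have Qnn: "0 \<le> ?Q w" for w by (rule code_weight_nonneg) (rule prefix_weight_nonneg)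
  \<comment> \<open>Off \<open>B\<close> a block of length at most \<open>L\<close> ends at time 0.
    Adding 1 to \<open>d\<close> avoids division by zero and still keeps
    \<open>d * measure \<mu> B\<close> below \<epsilon>/4; likewise for \<beta> and
    \<open>B'\<close>.\<close>
  obtain L B where B: "B \<in> sets \<mu>" "measure \<mu> B < \<epsilon> / (4 * (d + 1))"
    "\<And>A. A \<in> S \<Longrightarrow> A \<notin> B \<Longrightarrow> \<exists>l\<in>{M..L}. \<exists>C\<in>K. map A [1 - int l..0] = map C [0..<l]"
    by (rule shadowed_blocks[OF prob sets sh, of "\<epsilon> / (4 * (d + 1))" M]) (use \<epsilon> d in auto)
  obtain r B' and G where B': "B' \<in> sets \<mu>" "measure \<mu> B' < \<epsilon> / (4 * (\<beta> + 1))"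
    "\<And>A. A \<in> S \<Longrightarrow> A \<notin> B' \<Longrightarrow> Y A = G (map A [- int r..int r])"
    by (rule approx_simple_function[OF finite_measure_axioms sets Y, of "\<epsilon> / (4 * (\<beta> + 1))"]) (use \<epsilon> \<beta> in auto)
  \<comment> \<open>With probability 1 - \<delta> the guess \<open>y'\<close> is kept, otherwise a
    value of \<open>V\<close> is drawn uniformly.\<close>
  define s :: "nat \<Rightarrow> nat \<Rightarrow> real" where "s = (\<lambda>y y'. (if y = y' then 1 - \<delta> else 0) + \<delta> / k)"
  have s_pos: "s y y' > 0" for y y' unfolding s_def using \<delta> k by (auto intro!: add_pos_pos)
  have s_sum: "(\<Sum>y\<in>V. s y y') \<le> 1" for y'
  proof -
    have "(\<Sum>y\<in>V. s y y') = (if y' \<in> V then 1 - \<delta> else 0) + \<delta>"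
      unfolding s_def sum.distrib using V k by (simp add: k_def)
    then show ?thesis using \<delta> by simp
  qed
  define C where "C = \<epsilon> / 2 * real r + d * (real L + real r) + real r * \<epsilon> / 4"
  have "partition_entropy \<mu> (name left_shift Y n) \<le> real n * \<epsilon> + C" for n
  proof -
    let ?Z = "name left_shift Y n"
    \<comment> \<open>The word occupies the times from -r to n + r - 1, so it contains the window of
      radius \<open>r\<close> around every time from 0 to n - 1.\<close>
    define N where "N = n + 2 * r"
    define g where "g = (\<lambda>w i. G (take (2 * r + 1) (drop i w)))"
    \<comment> \<open>The marginal, over all words, of the joint weight of word and name; the word
      that really occurs contributes one term, which is the lower bound used.\<close>
    define q where "q = (\<lambda>z. \<Sum>w\<in>words_over E N. ?Q w * (\<Prod>i<n. s (z ! i) (g w i)))"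
    define cost where "cost = (\<lambda>A. \<epsilon> / 4 * real N + d * (real L + real r + (\<Sum>p<n + r. indicator B ((left_shift ^^ p) A)))
        + (\<Sum>i<n. \<epsilon> / 4 + \<beta> * indicator B' ((left_shift ^^ i) A)))"
    have Z: "simple_function \<mu> ?Z" by (rule simple_function_name[OF meas Y])
    have Zs: "?Z A ! i = Y ((left_shift ^^ i) A)" if "i < n" for A i using that unfolding name_def by simp
    have q_lower: "exp (- cost A) \<le> q (?Z A)" if A: "A \<in> S" for A
    proof -
      let ?w = "map A [- int r..- int r + int N - 1]"
      have wE: "?w \<in> words_over E N" unfolding words_over_def using range[OF A] by auto
      have gA: "g ?w i = G (map ((left_shift ^^ i) A) [- int r..int r])" if "i < n" for i
      proof -
        have "take (2 * r + 1) (drop i ?w) = map ((left_shift ^^ i) A) [- int r..int r]"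
          by (rule nth_equalityI) (use that in \<open>auto simp: N_def left_shift_funpow_int algebra_simps\<close>)
        then show ?thesis unfolding g_def by simp
      qed
      have fac: "exp (- (\<epsilon> / 4 + \<beta> * indicator B' ((left_shift ^^ i) A))) \<le> s (?Z A ! i) (g ?w i)" if "i < n" for i
      proof (cases "(left_shift ^^ i) A \<in> B'")
        case True
        have "exp (- (\<epsilon> / 4 + \<beta>)) \<le> exp (- \<beta>)" using \<epsilon> by simp
        also have "\<dots> = \<delta> / k" unfolding \<beta>_def using k \<delta> by (simp add: exp_minus)
        also have "\<dots> \<le> s (?Z A ! i) (g ?w i)" unfolding s_def using \<delta> by simp
        finally show ?thesis using True by simp
      next
        case False
        then have "?Z A ! i = g ?w i"
          using gA[OF that] Zs[OF that] B'(3)[OF funpow_left_shift_S[OF A]] by simp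
        then have "1 - \<delta> \<le> s (?Z A ! i) (g ?w i)" unfolding s_def using \<delta> k by simp
        then show ?thesis using False unfolding \<delta>_def by simp
      qed
      let ?bad = "{p \<in> {- int r..<- int r + int N}. \<not> block_ends_at K M (- int r) A p}"
      \<comment> \<open>Before time \<open>L\<close> a block might start outside the window, so
        these positions are given up at a cost independent of \<open>n\<close>. From
        \<open>L\<close> on, a block of length at most \<open>L\<close> ends at \<open>p\<close> and
        fits, unless the shifted sequence lies in \<open>B\<close>.\<close>
      have "?bad \<subseteq> {- int r..<int L} \<union> int ` {p \<in> {..<n + r}. (left_shift ^^ p) A \<in> B}"
      proof
        fix p assume p: "p \<in> ?bad"
        show "p \<in> {- int r..<int L} \<union> int ` {p \<in> {..<n + r}. (left_shift ^^ p) A \<in> B}"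
        proof (rule ccontr)
          assume np: "p \<notin> {- int r..<int L} \<union> int ` {p \<in> {..<n + r}. (left_shift ^^ p) A \<in> B}"
          then have pL: "int L \<le> p" using p by auto
          have pe: "p = int (nat p)" "nat p < n + r" using p pL unfolding N_def by auto
          then have "(left_shift ^^ nat p) A \<notin> B" using np by (metis (mono_tags, lifting) UnCI imageI lessThan_iff mem_Collect_eq)
          then obtain l C where l: "l \<in> {M..L}" "C \<in> K" "map ((left_shift ^^ nat p) A) [1 - int l..0] = map C [0..<l]"
            using B(3)[OF funpow_left_shift_S[OF A]] by blast
          have "map A [p + 1 - int l..p] = map C [0..<l]"
            using map_upto_shift[of A "1 - int l" p 0] l(3) pe(1) unfolding left_shift_funpow_int
            by (simp add: algebra_simps)
          then have "block_ends_at K M (- int r) A p" unfolding block_ends_at_def using l pL by force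
          then show False using p by simp
        qed
      qed
      then have "card ?bad \<le> card ({- int r..<int L} \<union> int ` {p \<in> {..<n + r}. (left_shift ^^ p) A \<in> B})"
        by (rule card_mono[rotated]) auto
      also have "\<dots> \<le> card {- int r..<int L} + card (int ` {p \<in> {..<n + r}. (left_shift ^^ p) A \<in> B})"
        by (rule card_Un_le)
      also have "card (int ` {p \<in> {..<n + r}. (left_shift ^^ p) A \<in> B}) = card {p \<in> {..<n + r}. (left_shift ^^ p) A \<in> B}"
        by (rule card_image) simp
      finally have "real (card ?bad) \<le> real L + real r + real (card {p \<in> {..<n + r}. (left_shift ^^ p) A \<in> B})"
        by (simp add: of_nat_diff)
      also have "real (card {p \<in> {..<n + r}. (left_shift ^^ p) A \<in> B}) = (\<Sum>p<n + r. indicator B ((left_shift ^^ p) A))"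
        by (simp add: indicator_def sum.If_cases Int_def)
      finally have "d * real (card ?bad) \<le> d * (real L + real r + (\<Sum>p<n + r. indicator B ((left_shift ^^ p) A)))"
        using d by (rule mult_left_mono)
      then have "exp (- (\<epsilon> / 4 * real N + d * (real L + real r + (\<Sum>p<n + r. indicator B ((left_shift ^^ p) A)))))
          \<le> exp (- (\<epsilon> / 4 * real N + d * real (card ?bad)))" by simp
      also have "\<dots> \<le> ?Q ?w"
        unfolding d_def by (rule code_weight_cost[OF finite_alphabet range[OF A] \<epsilon>4 M(1)])
      finally have Qw: "exp (- (\<epsilon> / 4 * real N + d * (real L + real r + (\<Sum>p<n + r. indicator B ((left_shift ^^ p) A))))) \<le> ?Q ?w" .
      have "exp (- (\<Sum>i<n. \<epsilon> / 4 + \<beta> * indicator B' ((left_shift ^^ i) A))) =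
          (\<Prod>i<n. exp (- (\<epsilon> / 4 + \<beta> * indicator B' ((left_shift ^^ i) A))))"
        by (simp only: sum_negf[symmetric] exp_sum finite_lessThan)
      also have "\<dots> \<le> (\<Prod>i<n. s (?Z A ! i) (g ?w i))"
        by (rule prod_mono) (use fac in auto)
      finally have "exp (- (\<epsilon> / 4 * real N + d * (real L + real r + (\<Sum>p<n + r. indicator B ((left_shift ^^ p) A))))) *
          exp (- (\<Sum>i<n. \<epsilon> / 4 + \<beta> * indicator B' ((left_shift ^^ i) A))) \<le> ?Q ?w * (\<Prod>i<n. s (?Z A ! i) (g ?w i))"
        using Qw Qnn by (intro mult_mono) auto
      also have "\<dots> \<le> q (?Z A)"
        unfolding q_def
        by (rule member_le_sum[where f = "\<lambda>w. ?Q w * (\<Prod>i<n. s (?Z A ! i) (g w i))", OF wE])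
          (auto intro!: mult_nonneg_nonneg Qnn prod_nonneg less_imp_le[OF s_pos] finite_words_over finite_alphabet)
      finally show ?thesis unfolding cost_def by (simp add: exp_add[symmetric])
    qed
    have q_sum: "(\<Sum>z\<in>?Z ` space \<mu>. q z) \<le> 1"
    proof -
      have qnn: "q z \<ge> 0" for z unfolding q_def
        by (auto intro!: sum_nonneg mult_nonneg_nonneg Qnn prod_nonneg less_imp_le[OF s_pos])
      have "?Z ` space \<mu> \<subseteq> words_over V n"
        unfolding words_over_def name_def V_def space using funpow_left_shift_S by auto
      then have "(\<Sum>z\<in>?Z ` space \<mu>. q z) \<le> (\<Sum>z\<in>words_over V n. q z)"
        by (intro sum_mono2 finite_words_over V qnn)
      \<comment> \<open>Names are summed first: for a fixed word the guesses are independent, so the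
        inner sum is a product of totals at most 1.\<close>
      also have "\<dots> = (\<Sum>w\<in>words_over E N. ?Q w * (\<Sum>z\<in>words_over V n. \<Prod>i<n. s (z ! i) (g w i)))"
        unfolding q_def by (subst sum.swap) (simp add: sum_distrib_left)
      also have "\<dots> = (\<Sum>w\<in>words_over E N. ?Q w * (\<Prod>i<n. \<Sum>y\<in>V. s y (g w i)))"
        by (intro sum.cong refl arg_cong2[where f = "(*)"]) (rule sum_words_over_prod)
      also have "\<dots> \<le> (\<Sum>w\<in>words_over E N. ?Q w * 1)"
        by (intro sum_mono mult_left_mono Qnn prod_le_1) (auto intro: s_sum sum_nonneg less_imp_le[OF s_pos])
      also have "\<dots> \<le> 1" using sum_code_weight_le_1[OF prefix_weight_nonneg M(2), of N] by simp
      finally show ?thesis .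
    qed
    have ind: "integrable \<mu> (\<lambda>A. indicator D ((left_shift ^^ p) A) :: real)"
      "(\<integral>A. indicator D ((left_shift ^^ p) A) \<partial>\<mu>) = measure \<mu> D" if D: "D \<in> sets \<mu>" for D p
    proof -
      let ?D = "(left_shift ^^ p) -` D \<inter> space \<mu>"
      have Dm: "?D \<in> sets \<mu>" by (rule measurable_sets[OF funpow_measurable[OF meas] D])
      have eq: "indicator D ((left_shift ^^ p) A) = (indicator ?D A :: real)" if "A \<in> space \<mu>" for A
        using that by (simp add: indicator_def)
      have "integrable \<mu> (indicator ?D :: _ \<Rightarrow> real)" using Dm by (simp add: emeasure_finite less_top[symmetric])
      then show "integrable \<mu> (\<lambda>A. indicator D ((left_shift ^^ p) A) :: real)"
        using Bochner_Integration.integrable_cong[where f = "\<lambda>A. indicator D ((left_shift ^^ p) A) :: real"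
          and g = "indicator ?D", OF refl eq] by blast
      have "(\<integral>A. indicator D ((left_shift ^^ p) A) \<partial>\<mu>) = (\<integral>A. indicator ?D A \<partial>\<mu> :: real)"
        by (rule Bochner_Integration.integral_cong[OF refl eq])
      also have "\<dots> = measure \<mu> ?D" by simp
      also have "\<dots> = measure \<mu> D" by (rule funpow_measure[OF meas distr D])
      finally show "(\<integral>A. indicator D ((left_shift ^^ p) A) \<partial>\<mu>) = measure \<mu> D" .
    qed
    have cost_int: "integrable \<mu> cost"
      unfolding cost_def using ind[OF B(1)] ind[OF B'(1)] by auto
    have "partition_entropy \<mu> ?Z \<le> (\<integral>A. cost A \<partial>\<mu>)"
    proof (rule partition_entropy_le_code[OF Z _ q_sum cost_int])
      fix A assume "A \<in> space \<mu>"
      then have *: "exp (- cost A) \<le> q (?Z A)" using q_lower space by simp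
      then show pos: "0 < q (?Z A)" by (rule less_le_trans[OF exp_gt_zero])
      have "- cost A \<le> ln (q (?Z A))" using * pos by (simp add: ln_ge_iff)
      then show "- ln (q (?Z A)) \<le> cost A" by simp
    qed
    also have "(\<integral>A. cost A \<partial>\<mu>) = \<epsilon> / 4 * real N + d * (real L + real r + real (n + r) * measure \<mu> B)
        + real n * (\<epsilon> / 4 + \<beta> * measure \<mu> B')"
      unfolding cost_def using ind[OF B(1)] ind[OF B'(1)] by (simp add: prob_space)
    also have "\<dots> \<le> real n * \<epsilon> + C"
    proof -
      have small: "x * m \<le> \<epsilon> / 4" if "0 \<le> x" "0 \<le> m" "m < \<epsilon> / (4 * (x + 1))" for x m
      proof -
        have "m * (4 * (x + 1)) < \<epsilon>" using that by (simp add: pos_less_divide_eq)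
        then show ?thesis using that(2) by (simp add: algebra_simps)
      qed
      have dB: "d * measure \<mu> B \<le> \<epsilon> / 4" by (rule small[OF d measure_nonneg B(2)])
      have "\<beta> * measure \<mu> B' \<le> \<epsilon> / 4" by (rule small[OF \<beta> measure_nonneg B'(2)])
      then have "real n * (\<epsilon> / 4 + \<beta> * measure \<mu> B') \<le> real n * (\<epsilon> / 4 + \<epsilon> / 4)" by (intro mult_left_mono) auto
      moreover have "real (n + r) * (d * measure \<mu> B) \<le> real (n + r) * (\<epsilon> / 4)" using dB by (intro mult_left_mono) auto
      ultimately show ?thesis unfolding C_def N_def by (simp add: algebra_simps)
    qed
    finally show ?thesis .
  qed
  then show ?thesis by blast
qed

text \<open>Since the definition of the entropy uses \<open>lim\<close>, actual convergence is
  proved: the normalized entropies lie between 0 and an arbitrarily small constant plus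
  \<open>C / n\<close>.\<close>

lemma KS_entropy_shadowed:
  assumes inv: "invariant_prob seqtop left_shift \<mu>" and K: "finite K"
    and sh: "AE A in \<mu>. shadowed_at K A 0"
  shows "KS_entropy \<mu> left_shift = 0"
proof -
  have prob: "prob_space \<mu>" and meas: "left_shift \<in> \<mu> \<rightarrow>\<^sub>M \<mu>"
    using inv unfolding invariant_prob_def by auto
  interpret prob_space \<mu> by fact
  have "lim (\<lambda>n. partition_entropy \<mu> (name left_shift Y n) / real n) = 0" if Y: "simple_function \<mu> Y" for Y :: "_ \<Rightarrow> nat"
  proof (rule limI, rule LIMSEQ_I)
    let ?H = "\<lambda>n. partition_entropy \<mu> (name left_shift Y n)"
    fix \<epsilon> :: real assume \<epsilon>: "0 < \<epsilon>"
    then obtain C where C: "\<And>n. ?H n \<le> real n * (\<epsilon> / 2) + C"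
      using entropy_name_bound[OF inv K sh Y, of "\<epsilon> / 2"] by auto
    obtain n0 where n0: "real n0 > 2 * \<bar>C\<bar> / \<epsilon>" using reals_Archimedean2 by blast
    have "norm (?H n / real n - 0) < \<epsilon>" if "n \<ge> Suc n0" for n
    proof -
      have n: "real n > 0" "real n > 2 * \<bar>C\<bar> / \<epsilon>" using that n0 by auto
      have "0 \<le> ?H n" by (rule partition_entropy_nonneg[OF simple_function_name[OF meas Y]])
      moreover have "?H n < real n * \<epsilon>"
      proof -
        have "2 * \<bar>C\<bar> < real n * \<epsilon>" using n(2) \<epsilon> by (simp add: field_simps)
        then show ?thesis using C[of n] by (simp add: field_simps)
      qed
      ultimately show ?thesis using n(1) by (simp add: field_simps)
    qed
    then show "\<exists>no. \<forall>n\<ge>no. norm (?H n / real n - 0) < \<epsilon>" by blast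
  qed
  \<comment> \<open>Over an empty family the supremum would be -\<infinity>.\<close>
  moreover have "{Y :: _ \<Rightarrow> nat. simple_function \<mu> Y} \<noteq> {}"
    using simple_function_const[of \<mu> "0 :: nat"] by blast
  ultimately show ?thesis unfolding KS_entropy_def by (simp cong: SUP_cong_simp)
qed

lemma KS_entropy_non_markov:
  assumes inv: "invariant_prob seqtop left_shift \<mu>" and K: "finite K"
    and sh: "\<And>A. A \<in> S \<Longrightarrow> \<not> markov_at S A 0 \<Longrightarrow> shadowed_at K A 0"
    and null: "emeasure \<mu> (markov_part S) = 0"
  shows "KS_entropy \<mu> left_shift = 0"
proof (rule KS_entropy_shadowed[OF inv K])
  have prob: "prob_space \<mu>" and sets: "sets \<mu> = sets (borel_of seqtop)"
    and meas: "left_shift \<in> \<mu> \<rightarrow>\<^sub>M \<mu>" and distr: "distr \<mu> \<mu> left_shift = \<mu>"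
    using inv unfolding invariant_prob_def by auto
  interpret prob_space \<mu> by fact
  have space: "space \<mu> = S" using sets_eq_imp_space_eq[OF sets] unfolding space_borel_of topspace_seqtop .
  define F where "F = (\<lambda>p. {A \<in> S. markov_at S A p})"
  have Fs: "F p \<in> sets \<mu>" for p unfolding F_def sets by (rule markov_at_sets)
  have step: "measure \<mu> (F (p + 1)) = measure \<mu> (F p)" for p
  proof -
    have "(left_shift ^^ 1) -` F p \<inter> space \<mu> = F (p + 1)"
      unfolding F_def space using left_shift_S by (auto simp: markov_at_left_shift)
    then show ?thesis using funpow_measure[OF meas distr Fs, of 1 p] by simp
  qed
  have const: "measure \<mu> (F (- int n)) = measure \<mu> (F 0)" for n
  proof (induction n)
    case (Suc n)
    then show ?case using step[of "- int (Suc n)"] by simp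
  qed simp
  \<comment> \<open>Time runs to -\<infinity>, because the Markov part is the decreasing limit of
    these sets, all of the same measure.\<close>
  have "decseq (\<lambda>n. F (- int n))"
    unfolding F_def by (rule decseq_SucI) (auto intro: markov_at_mono)
  then have "(\<lambda>n. measure \<mu> (F (- int n))) \<longlonglongrightarrow> measure \<mu> (\<Inter>n. F (- int n))"
    by (intro finite_Lim_measure_decseq) (use Fs in auto)
  then have "measure \<mu> (F 0) = measure \<mu> (\<Inter>n. F (- int n))"
    unfolding const by (simp add: LIMSEQ_const_iff)
  also have "(\<Inter>n. F (- int n)) = markov_part S"
  proof (intro equalityI subsetI)
    fix A assume A: "A \<in> (\<Inter>n. F (- int n))"
    have "markov_at S A p" for p
    proof -
      have "markov_at S A (- int (nat (- p)))" using A unfolding F_def by blast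
      then show ?thesis by (rule markov_at_mono) simp
    qed
    moreover have "A \<in> S" using A unfolding F_def by blast
    ultimately show "A \<in> markov_part S" unfolding markov_part_def by blast
  qed (auto simp: F_def markov_part_def)
  finally have "measure \<mu> (F 0) = 0" using null by (simp add: measure_def)
  then have "AE A in \<mu>. A \<notin> F 0" using prob_eq_0[OF Fs] by simp
  then show "AE A in \<mu>. shadowed_at K A 0"
    using AE_space by eventually_elim (use sh space in \<open>auto simp: F_def\<close>)
qed

end

section \<open>Cylinders of a piecewise monotone map\<close>

definition mono_or_anti :: "(real \<Rightarrow> real) \<Rightarrow> real set \<Rightarrow> bool" where
  "mono_or_anti f X \<longleftrightarrow> strict_mono_on X f \<or> strict_antimono_on X f"

lemma mono_or_anti_inj_on: "mono_or_anti f X \<Longrightarrow> inj_on f X"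
  unfolding mono_or_anti_def
  by (auto simp: inj_on_def monotone_on_def) (metis less_irrefl linorder_neqE)+

lemma mono_or_anti_subset: "mono_or_anti f X \<Longrightarrow> Y \<subseteq> X \<Longrightarrow> mono_or_anti f Y"
  unfolding mono_or_anti_def monotone_on_def by blast

lemma mono_or_anti_compose:
  assumes "mono_or_anti f X" "mono_or_anti g Y" "f ` X \<subseteq> Y"
  shows "mono_or_anti (g \<circ> f) X"
proof -
  have "f x \<in> Y" if "x \<in> X" for x using assms(3) that by auto
  then show ?thesis using assms(1,2) unfolding mono_or_anti_def monotone_on_def comp_def by metis
qed

lemma mono_or_anti_between:
  assumes "mono_or_anti f X" "x \<in> X" "y \<in> X" "z \<in> X" "f x < f y" "f y < f z"
  shows "x < y \<and> y < z \<or> z < y \<and> y < x"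
proof -
  have "x < y \<or> x = y \<or> y < x" "y < z \<or> y = z \<or> z < y" by auto
  then show ?thesis using assms unfolding mono_or_anti_def monotone_on_def by (metis less_asym less_irrefl)
qed

lemma is_interval_betweenD: "is_interval X \<Longrightarrow> x \<in> X \<Longrightarrow> z \<in> X \<Longrightarrow> x \<le> y \<Longrightarrow> y \<le> z \<Longrightarrow> y \<in> X" for X :: "real set"
  using is_interval_1 by blast

locale monotone_partition =
  fixes a b :: real and T :: "real \<Rightarrow> real" and P :: "real set set"
  assumes ab: "a < b"
    and finite_P: "finite P"
    and pieces_open: "s \<in> P \<Longrightarrow> open s"
    and pieces_nonempty: "s \<in> P \<Longrightarrow> s \<noteq> {}"
    and pieces_subset: "s \<in> P \<Longrightarrow> s \<subseteq> {a..b}"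
    and pieces_interval: "s \<in> P \<Longrightarrow> is_interval s"
    and pieces_continuous: "s \<in> P \<Longrightarrow> continuous_on s T"
    and pieces_monotone: "s \<in> P \<Longrightarrow> mono_or_anti T s"
    and pieces_disjoint: "s \<in> P \<Longrightarrow> t \<in> P \<Longrightarrow> x \<in> s \<Longrightarrow> x \<in> t \<Longrightarrow> s = t"
    and finite_rest: "finite ({a..b} - \<Union>P)"
    and maps: "T \<in> {a..b} \<rightarrow> {a..b}"
begin

definition cyl :: "real set list \<Rightarrow> real set" where
  "cyl w = {x. \<forall>k<length w. (T ^^ k) x \<in> w ! k}"

lemma cyl_Nil [simp]: "cyl [] = UNIV" unfolding cyl_def by simp

lemma cyl_Cons: "cyl (s # w) = {x \<in> s. T x \<in> cyl w}"
  unfolding cyl_def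
  by (auto simp: less_Suc_eq_0_disj funpow_swap1 nth_Cons split: nat.splits)

lemma cyl_append: "cyl (u @ v) = {x \<in> cyl u. (T ^^ length u) x \<in> cyl v}"
proof (induction u)
  case (Cons s u)
  then show ?case by (auto simp: cyl_Cons funpow_swap1)
qed simp

lemma cyl_append_subset: "cyl (u @ v) \<subseteq> cyl u" unfolding cyl_append by blast

lemma cyl_map_upt: "cyl (map f [0..<n]) = {x. \<forall>k<n. (T ^^ k) x \<in> f k}"
  unfolding cyl_def by auto

lemma cyl_open: "set w \<subseteq> P \<Longrightarrow> open (cyl w)"
proof (induction w)
  case (Cons s w)
  then have "open (T -` cyl w \<inter> s)"
    using pieces_continuous[of s] pieces_open[of s] by (auto simp: continuous_on_open_vimage)
  moreover have "cyl (s # w) = T -` cyl w \<inter> s" unfolding cyl_Cons by blast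
  ultimately show ?case by simp
qed simp

text \<open>Monotonicity on the first piece turns betweenness of points into betweenness of their
  images.\<close>

lemma cyl_interval: "set w \<subseteq> P \<Longrightarrow> is_interval (cyl w)"
proof (induction w)
  case (Cons s w)
  then have s: "s \<in> P" and w: "is_interval (cyl w)" by auto
  show ?case unfolding is_interval_1
  proof (intro ballI allI impI)
    fix x z y assume x: "x \<in> cyl (s # w)" and z: "z \<in> cyl (s # w)" and y: "x \<le> y \<and> y \<le> z"
    then have ys: "y \<in> s" using is_interval_betweenD[OF pieces_interval[OF s], of x z y] unfolding cyl_Cons by simp
    have "T x \<le> T y \<and> T y \<le> T z \<or> T z \<le> T y \<and> T y \<le> T x"
      using pieces_monotone[OF s] x z y ys unfolding cyl_Cons mono_or_anti_def monotone_on_def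
      by (metis (no_types, lifting) mem_Collect_eq order_le_less)
    then have "T y \<in> cyl w"
      using is_interval_betweenD[OF w, of "T x" "T z" "T y"] is_interval_betweenD[OF w, of "T z" "T x" "T y"] x z
      unfolding cyl_Cons by blast
    then show "y \<in> cyl (s # w)" unfolding cyl_Cons using ys by simp
  qed
qed simp

lemma cyl_iterate:
  "set w \<subseteq> P \<Longrightarrow> n \<le> length w \<Longrightarrow> continuous_on (cyl w) (T ^^ n) \<and> mono_or_anti (T ^^ n) (cyl w)"
proof (induction w arbitrary: n)
  case Nil
  then show ?case by (simp add: mono_or_anti_def monotone_on_def)
next
  case (Cons s w)
  show ?case
  proof (cases n)
    case 0
    then show ?thesis by (simp add: mono_or_anti_def monotone_on_def)
  next
    case (Suc m)
    have IH: "continuous_on (cyl w) (T ^^ m)" "mono_or_anti (T ^^ m) (cyl w)" using Cons Suc by auto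
    have s: "s \<in> P" using Cons by simp
    have sub: "cyl (s # w) \<subseteq> s" "T ` cyl (s # w) \<subseteq> cyl w" unfolding cyl_Cons by auto
    have T: "continuous_on (cyl (s # w)) T" "mono_or_anti T (cyl (s # w))"
      using pieces_continuous[OF s] pieces_monotone[OF s] sub continuous_on_subset mono_or_anti_subset by blast+
    have eq: "T ^^ n = (T ^^ m) \<circ> T" using Suc by (simp add: funpow_Suc_right del: funpow.simps)
    show ?thesis unfolding eq
      using continuous_on_compose[OF T(1) continuous_on_subset[OF IH(1) sub(2)]]
        mono_or_anti_compose[OF T(2) IH(2) sub(2)] by blast
  qed
qed

lemma cyl_same_length_disjoint:
  assumes "set u \<subseteq> P" "set v \<subseteq> P" "length u = length v" "x \<in> cyl u" "x \<in> cyl v"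
  shows "u = v"
proof (rule nth_equalityI[OF assms(3)])
  fix k assume k: "k < length u"
  have "u ! k \<in> P" "v ! k \<in> P" using k assms(1,2,3) by (auto simp: subset_iff)
  moreover have "(T ^^ k) x \<in> u ! k" "(T ^^ k) x \<in> v ! k" using k assms(3,4,5) unfolding cyl_def by auto
  ultimately show "u ! k = v ! k" by (rule pieces_disjoint)
qed

lemma piece_bounds:
  assumes "s \<in> P"
  shows "s = {Inf s<..<Sup s}" "Inf s < Sup s" "a \<le> Inf s" "Sup s \<le> b"
proof -
  have bdd: "bdd_below s" "bdd_above s" using pieces_subset[OF assms] by (auto intro: bdd_below_mono bdd_above_mono)
  have ne: "s \<noteq> {}" by (rule pieces_nonempty[OF assms])
  have "Inf s < x \<and> x < Sup s" if "x \<in> s" for x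
  proof -
    obtain e where e: "e > 0" "ball x e \<subseteq> s" using openE[OF pieces_open[OF assms] \<open>x \<in> s\<close>] by metis
    have "x - e/2 \<in> s" "x + e/2 \<in> s" using e by (auto simp: subset_iff dist_real_def)
    then show ?thesis using cInf_lower[OF _ bdd(1)] cSup_upper[OF _ bdd(2)] e(1) by fastforce
  qed
  moreover have "x \<in> s" if "Inf s < x" "x < Sup s" for x
    using that cInf_lessD[OF ne, of x] less_cSupD[OF ne, of x] is_interval_betweenD[OF pieces_interval[OF assms]]
    by (meson less_imp_le)
  ultimately show eq: "s = {Inf s<..<Sup s}" by auto
  show "Inf s < Sup s" using eq ne by (metis greaterThanLessThan_empty_iff linorder_not_less)
  show "a \<le> Inf s" using pieces_subset[OF assms] ne by (intro cInf_greatest) auto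
  show "Sup s \<le> b" using pieces_subset[OF assms] ne by (intro cSup_least) auto
qed

text \<open>For each \<open>k\<close> only finitely many points are outside the pieces at time
  \<open>k\<close>: \<open>T\<close> is injective on every piece, so finite sets have finite
  preimages there. A nonempty open set is uncountable.\<close>

lemma regular_dense:
  assumes "open U" "U \<noteq> {}" "U \<subseteq> {a..b}"
  obtains x where "x \<in> U" "x \<in> regular_points T P"
proof -
  define N where "N = (\<lambda>k. {x \<in> {a..b}. (T ^^ k) x \<notin> \<Union>P})"
  have fin: "finite (N k)" for k
  proof (induction k)
    case 0
    have "N 0 = {a..b} - \<Union>P" unfolding N_def by auto
    then show ?case using finite_rest by simp
  next
    case (Suc k)
    have "N (Suc k) \<subseteq> ({a..b} - \<Union>P) \<union> (\<Union>s\<in>P. T -` N k \<inter> s)"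
    proof
      fix x assume x: "x \<in> N (Suc k)"
      then have "T x \<in> N k" using maps unfolding N_def by (auto simp: funpow_swap1 simp del: UN_iff Union_iff)
      then show "x \<in> ({a..b} - \<Union>P) \<union> (\<Union>s\<in>P. T -` N k \<inter> s)" using x unfolding N_def by blast
    qed
    moreover have "finite (T -` N k \<inter> s)" if "s \<in> P" for s
      using Suc mono_or_anti_inj_on[OF pieces_monotone[OF that]] by (rule finite_vimage_IntI)
    ultimately show ?case using finite_rest finite_P by (meson finite_UN_I finite_UnI finite_subset)
  qed
  have "countable (\<Union>k. N k)" using fin by (auto intro: countable_finite)
  then obtain x where x: "x \<in> U" "x \<notin> (\<Union>k. N k)" using open_minus_countable[OF _ assms(2,1)] by metis
  then have "x \<in> regular_points T P" using assms(3) unfolding N_def regular_points_def by auto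
  with x that show ?thesis by blast
qed

lemma regular_points_itinerary:
  assumes "x \<in> regular_points T P"
  shows "itinerary T P x k \<in> P" "(T ^^ k) x \<in> itinerary T P x k"
proof -
  obtain s where s: "s \<in> P" "(T ^^ k) x \<in> s" using assms unfolding regular_points_def by auto
  have "itinerary T P x k = s" unfolding itinerary_def
    by (rule the_equality) (use s pieces_disjoint in auto)
  with s show "itinerary T P x k \<in> P" "(T ^^ k) x \<in> itinerary T P x k" by auto
qed

lemma itinerary_eqI:
  assumes "s \<in> P" "(T ^^ k) x \<in> s" shows "itinerary T P x k = s"
  unfolding itinerary_def by (rule the_equality) (use assms pieces_disjoint in auto)

text \<open>Cylinders are open, so a nonempty one contains a regular point, whose itinerary begins
  with the given word. This turns the closure into a condition on finite words.\<close>

lemma mem_symb_dyn_iff: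
  "C \<in> symb_dyn T P \<longleftrightarrow> (\<forall>k. C k \<in> P) \<and> (\<forall>n. cyl (map C [0..<n]) \<noteq> {})"
proof
  assume C: "C \<in> symb_dyn T P"
  then have CP: "\<forall>k. C k \<in> P" unfolding symb_dyn_def
    using closure_of_subset_topspace[of "seq_topology P"] by (auto simp: topspace_seq_topology)
  have "cyl (map C [0..<n]) \<noteq> {}" for n
  proof -
    let ?U = "{B. (\<forall>k. B k \<in> P) \<and> (\<forall>k<n. B k = C k)}"
    have U: "openin (seq_topology P) ?U" unfolding openin_seq_topology
      by (auto intro!: exI[of _ "{..<n}"])
    have CU: "C \<in> ?U" using CP by simp
    have "\<forall>U. C \<in> U \<and> openin (seq_topology P) U \<longrightarrow> (\<exists>y. y \<in> itinerary T P ` regular_points T P \<and> y \<in> U)"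
      using C unfolding symb_dyn_def in_closure_of by (rule conjunct2)
    from this[rule_format, OF conjI, OF CU U]
    have "\<exists>y. y \<in> itinerary T P ` regular_points T P \<and> y \<in> ?U" .
    then obtain x where x: "x \<in> regular_points T P" "\<forall>k<n. itinerary T P x k = C k" by blast
    have "(T ^^ k) x \<in> C k" if "k < n" for k
      using regular_points_itinerary(2)[OF x(1), of k] x(2) that by simp
    then have "x \<in> cyl (map C [0..<n])" unfolding cyl_map_upt by blast
    then show ?thesis by blast
  qed
  with CP show "(\<forall>k. C k \<in> P) \<and> (\<forall>n. cyl (map C [0..<n]) \<noteq> {})" by blast
next
  assume R: "(\<forall>k. C k \<in> P) \<and> (\<forall>n. cyl (map C [0..<n]) \<noteq> {})"
  show "C \<in> symb_dyn T P" unfolding symb_dyn_def in_closure_of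
  proof (intro conjI allI impI)
    show "C \<in> topspace (seq_topology P)" using R by (simp add: topspace_seq_topology)
    fix U assume "C \<in> U \<and> openin (seq_topology P) U"
    then obtain F where F: "finite F" "\<And>B. (\<forall>i. B i \<in> P) \<and> (\<forall>i\<in>F. B i = C i) \<Longrightarrow> B \<in> U"
      unfolding openin_seq_topology by blast
    obtain n0 where n0: "\<forall>k\<in>F. k < n0" using F(1) finite_nat_set_iff_bounded by blast
    \<comment> \<open>At least one symbol is needed: the cylinder of the empty word is the whole
      line and not contained in \<open>{a..b}\<close>.\<close>
    define n where "n = Suc n0"
    have n: "k < n" if "k \<in> F" for k using n0 that unfolding n_def by (simp add: less_SucI)
    let ?w = "map C [0..<n]"
    have "set ?w \<subseteq> P" using R by auto
    moreover have "cyl ?w \<subseteq> {a..b}"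
      using pieces_subset[of "C 0"] R unfolding cyl_map_upt n_def by fastforce
    ultimately obtain x where x: "x \<in> cyl ?w" "x \<in> regular_points T P"
      using regular_dense[OF cyl_open[of ?w]] R by metis
    have "itinerary T P x \<in> U"
    proof (rule F(2), intro conjI allI ballI)
      show "itinerary T P x i \<in> P" for i by (rule regular_points_itinerary[OF x(2)])
      fix i assume "i \<in> F"
      then show "itinerary T P x i = C i"
        using x(1) n R unfolding cyl_map_upt by (intro itinerary_eqI) auto
    qed
    with x(2) show "\<exists>y. y \<in> itinerary T P ` regular_points T P \<and> y \<in> U" by blast
  qed
qed

lemma mem_nat_extension_iff:
  "A \<in> nat_extension T P \<longleftrightarrow> (\<forall>p. A p \<in> P) \<and> (\<forall>m p. cyl (map A [m..p]) \<noteq> {})"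
proof -
  have eq: "map (\<lambda>k. A (m + int k)) [0..<n] = map A [m..m + int n - 1]" for m n
    by (rule nth_equalityI) auto
  have "(\<forall>n. cyl (map A [m..m + int n - 1]) \<noteq> {}) \<longleftrightarrow> (\<forall>p. cyl (map A [m..p]) \<noteq> {})" for m
  proof
    assume *: "\<forall>n. cyl (map A [m..m + int n - 1]) \<noteq> {}"
    show "\<forall>p. cyl (map A [m..p]) \<noteq> {}"
    proof
      fix p show "cyl (map A [m..p]) \<noteq> {}"
      proof (cases "m \<le> p")
        case True
        then show ?thesis using *[rule_format, of "nat (p - m + 1)"] by simp
      qed simp
    qed
  qed simp
  then show ?thesis unfolding nat_extension_def by (auto simp: mem_symb_dyn_iff eq)
qed

abbreviation "\<Sigma> \<equiv> nat_extension T P"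

lemma alphabet_subshift_nat_extension: "alphabet_subshift \<Sigma> P"
proof unfold_locales
  fix A k assume "A \<in> \<Sigma>"
  then show "(\<lambda>i. A (i + k)) \<in> \<Sigma>"
    unfolding mem_nat_extension_iff by (simp flip: map_upto_shift)
next
  fix A :: "int \<Rightarrow> real set"
  assume *: "\<And>m p. m \<le> p \<Longrightarrow> map A [m..p] \<in> words \<Sigma>"
  show "A \<in> \<Sigma>" unfolding mem_nat_extension_iff
  proof (intro conjI allI)
    fix p
    obtain B m q where "B \<in> \<Sigma>" "map A [p..p] = map B [m..q]" using *[of p p] unfolding words_def by blast
    then have "set (map A [p..p]) \<subseteq> P" unfolding mem_nat_extension_iff by auto
    then show "A p \<in> P" by simp
  next
    fix m p
    show "cyl (map A [m..p]) \<noteq> {}"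
    proof (cases "m \<le> p")
      case True
      then obtain B n q where "B \<in> \<Sigma>" "map A [m..p] = map B [n..q]" using * unfolding words_def by blast
      then show ?thesis unfolding mem_nat_extension_iff by simp
    qed simp
  qed
next
  show "finite P" by (rule finite_P)
qed (simp add: mem_nat_extension_iff)

end

sublocale monotone_partition \<subseteq> alphabet_subshift "nat_extension T P" P
  by (rule alphabet_subshift_nat_extension)

context monotone_partition
begin

section \<open>Kneading invariants\<close>

definition side :: "real \<Rightarrow> real filter \<Rightarrow> bool" where
  "side c G \<longleftrightarrow> a \<le> c \<and> c < b \<and> G = at_right c \<or> a < c \<and> c \<le> b \<and> G = at_left c"

text \<open>The one-sided itinerary at a point, expressed by all nearby points instead of the
  regular ones only, which makes connectedness arguments available.
  \<open>limitin_itinerary_iff_germ\<close> links it to the limits that define the kneading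
  invariants.\<close>

definition germ :: "real filter \<Rightarrow> (nat \<Rightarrow> real set) \<Rightarrow> bool" where
  "germ G \<kappa> \<longleftrightarrow> (\<forall>k. \<kappa> k \<in> P) \<and> (\<forall>k. eventually (\<lambda>x. (T ^^ k) x \<in> \<kappa> k) G)"

lemma side_nontrivial: "side c G \<Longrightarrow> G \<noteq> bot"
  unfolding side_def using trivial_limit_at_right_real[of c] trivial_limit_at_left_real[of c] by metis

lemma side_interval:
  assumes "side c G" "eventually R G"
  obtains X where "connected X" "open X" "X \<noteq> {}" "X \<subseteq> {a..b}" "\<And>x. x \<in> X \<Longrightarrow> R x" "eventually (\<lambda>x. x \<in> X) G"
proof -
  consider "a \<le> c" "c < b" "G = at_right c" | "a < c" "c \<le> b" "G = at_left c"
    using assms(1) unfolding side_def by blast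
  then show thesis
  proof cases
    case 1
    then obtain d where d: "d > c" "\<And>y. c < y \<Longrightarrow> y < d \<Longrightarrow> R y"
      using assms(2) unfolding 1(3) eventually_at_right[OF \<open>c < b\<close>] by auto
    show thesis
    proof (rule that[of "{c<..<min d b}"])
      show "eventually (\<lambda>x. x \<in> {c<..<min d b}) G"
        using 1 d(1) by (auto simp: eventually_at_right[OF \<open>c < b\<close>] intro!: exI[of _ "min d b"])
    qed (use 1 d in auto)
  next
    case 2
    then obtain d where d: "d < c" "\<And>y. d < y \<Longrightarrow> y < c \<Longrightarrow> R y"
      using assms(2) unfolding 2(3) eventually_at_left[OF \<open>a < c\<close>] by auto
    show thesis
    proof (rule that[of "{max d a<..<c}"])
      show "eventually (\<lambda>x. x \<in> {max d a<..<c}) G"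
        using 2 d(1) by (auto simp: eventually_at_left[OF \<open>a < c\<close>] intro!: exI[of _ "max d a"])
    qed (use 2 d in auto)
  qed
qed

lemma side_avoids_finite:
  assumes "side c G" "finite F" shows "eventually (\<lambda>x. x \<notin> F) G"
proof -
  have "eventually (\<lambda>x. x \<noteq> y) G" for y
  proof -
    have "eventually (\<lambda>x. x \<noteq> y) (at c)"
    proof (cases "y = c")
      case False
      then show ?thesis unfolding eventually_at_filter
        using t1_space_nhds[of c y] by (auto elim: eventually_mono)
    qed (simp add: eventually_at_filter)
    moreover have "G \<le> at c" using assms(1) unfolding side_def by (auto intro: at_le)
    ultimately show ?thesis using filter_leD by blast
  qed
  then have "eventually (\<lambda>x. \<forall>y\<in>F. x \<noteq> y) G" using assms(2) by (simp add: eventually_ball_finite)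
  then show ?thesis by (rule eventually_mono) blast
qed

lemma connected_in_piece:
  assumes "connected X" "X \<noteq> {}" "X \<subseteq> \<Union>P"
  obtains s where "s \<in> P" "X \<subseteq> s"
proof -
  obtain x s where s: "x \<in> X" "x \<in> s" "s \<in> P" using assms by blast
  have "open s" "open (\<Union>(P - {s}))" using s pieces_open by auto
  moreover have "X \<subseteq> s \<union> \<Union>(P - {s})" using assms(3) by blast
  moreover have "s \<inter> \<Union>(P - {s}) \<inter> X = {}" using pieces_disjoint s(3) by blast
  moreover have "s \<inter> X \<noteq> {}" using s by blast
  ultimately have "\<Union>(P - {s}) \<inter> X = {}" using connectedD[OF assms(1)] by metis
  then have "X \<subseteq> s" using assms(3) by blast
  with s that show thesis by blast
qed

text \<open>Strong induction: near \<open>c\<close> the points share a cylinder of length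
  \<open>k\<close>, on which \<open>T ^^ k\<close> is continuous and injective. So a smaller
  one-sided neighbourhood avoids the finitely many points sent outside the pieces, and its connected
  image lies in a single piece.\<close>

lemma germ_exists:
  assumes "side c G" obtains \<kappa> where "germ G \<kappa>"
proof -
  have "\<exists>s\<in>P. eventually (\<lambda>x. (T ^^ k) x \<in> s) G" for k
  proof (induction k rule: less_induct)
    case (less k)
    then obtain f where f: "\<And>j. j < k \<Longrightarrow> f j \<in> P \<and> eventually (\<lambda>x. (T ^^ j) x \<in> f j) G"
      by metis
    define w where "w = map f [0..<k]"
    have w: "set w \<subseteq> P" "length w = k" unfolding w_def using f by auto
    have "eventually (\<lambda>x. \<forall>j\<in>{..<k}. (T ^^ j) x \<in> f j) G" using f by (intro eventually_ball_finite) auto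
    then have ev: "eventually (\<lambda>x. x \<in> cyl w) G" unfolding w_def cyl_map_upt by (simp add: Ball_def)
    have T: "continuous_on (cyl w) (T ^^ k)" "inj_on (T ^^ k) (cyl w)"
      using cyl_iterate[OF w(1), of k] w(2) mono_or_anti_inj_on by auto
    have "finite ((T ^^ k) -` ({a..b} - \<Union>P) \<inter> cyl w)" using finite_rest T(2) by (rule finite_vimage_IntI)
    then have ev2: "eventually (\<lambda>x. x \<in> cyl w \<and> x \<notin> (T ^^ k) -` ({a..b} - \<Union>P) \<inter> cyl w) G"
      by (intro eventually_conj ev side_avoids_finite[OF assms])
    obtain X where X: "connected X" "open X" "X \<noteq> {}" "X \<subseteq> {a..b}"
      "\<And>x. x \<in> X \<Longrightarrow> x \<in> cyl w \<and> x \<notin> (T ^^ k) -` ({a..b} - \<Union>P) \<inter> cyl w"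
      "eventually (\<lambda>x. x \<in> X) G"
      by (rule side_interval[OF assms ev2]) (rule that)
    have inab: "(T ^^ j) x \<in> {a..b}" if "x \<in> {a..b}" for x j
      by (induction j) (use that maps in \<open>simp_all add: Pi_iff\<close>)
    have "connected ((T ^^ k) ` X)"
      using X(1,5) T(1) by (meson connected_continuous_image continuous_on_subset subsetI)
    moreover have "(T ^^ k) ` X \<subseteq> \<Union>P"
    proof (rule image_subsetI)
      fix x assume "x \<in> X"
      then have "(T ^^ k) x \<in> {a..b}" "x \<in> cyl w" "x \<notin> (T ^^ k) -` ({a..b} - \<Union>P) \<inter> cyl w"
        using X(5)[of x] inab[of x k] X(4) by auto
      then show "(T ^^ k) x \<in> \<Union>P" by simp
    qed
    ultimately obtain s where s: "s \<in> P" "(T ^^ k) ` X \<subseteq> s" using connected_in_piece X(3) by (metis image_is_empty)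
    have "eventually (\<lambda>x. (T ^^ k) x \<in> s) G" using X(6) by (rule eventually_mono) (use s in blast)
    with s(1) show ?case by blast
  qed
  then obtain \<kappa> where "\<And>k. \<kappa> k \<in> P \<and> eventually (\<lambda>x. (T ^^ k) x \<in> \<kappa> k) G" by metis
  with that show thesis unfolding germ_def by blast
qed

lemma germ_eventually_cyl:
  assumes "germ G \<kappa>" shows "eventually (\<lambda>x. x \<in> cyl (map \<kappa> [0..<n])) G"
proof -
  have "eventually (\<lambda>x. \<forall>j\<in>{..<n}. (T ^^ j) x \<in> \<kappa> j) G"
    using assms unfolding germ_def by (intro eventually_ball_finite) auto
  then show ?thesis unfolding cyl_map_upt by (simp add: Ball_def)
qed

lemma germ_prefix:
  assumes "side c G" "germ G \<kappa>" "set w \<subseteq> P" "eventually (\<lambda>x. x \<in> cyl w) G"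
  shows "map \<kappa> [0..<length w] = w"
proof -
  have "eventually (\<lambda>x. x \<in> cyl w \<and> x \<in> cyl (map \<kappa> [0..<length w])) G"
    using assms germ_eventually_cyl by (simp add: eventually_conj)
  then obtain x where x: "x \<in> cyl w" "x \<in> cyl (map \<kappa> [0..<length w])"
    using eventually_happens'[OF side_nontrivial[OF assms(1)]] by blast
  show ?thesis
    by (rule cyl_same_length_disjoint[OF _ assms(3) _ x(2,1)]) (use assms(2) in \<open>auto simp: germ_def\<close>)
qed

lemma germ_unique:
  assumes "side c G" "germ G \<kappa>" "germ G \<kappa>'" shows "\<kappa> = \<kappa>'"
proof
  fix k
  have "map \<kappa> [0..<length (map \<kappa>' [0..<Suc k])] = map \<kappa>' [0..<Suc k]"
    by (rule germ_prefix[OF assms(1,2)])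
      (use assms(3) germ_eventually_cyl[OF assms(3), of "Suc k"] in \<open>auto simp: germ_def simp del: upt_Suc\<close>)
  then show "\<kappa> k = \<kappa>' k" by simp
qed

lemma endpoints_finite: "finite (endpoints P)"
  unfolding endpoints_def using finite_P by auto

lemma endpoints_bounds: "c \<in> endpoints P \<Longrightarrow> a \<le> c \<and> c \<le> b"
  unfolding endpoints_def using piece_bounds by force

lemma endpoints_not_in_pieces: "c \<in> endpoints P \<Longrightarrow> s \<in> P \<Longrightarrow> c \<notin> s"
proof
  assume c: "c \<in> endpoints P" and s: "s \<in> P" "c \<in> s"
  then obtain t where t: "t \<in> P" "c = Inf t \<or> c = Sup t" unfolding endpoints_def by blast
  obtain e where e: "e > 0" "ball c e \<subseteq> s" using openE[OF pieces_open[OF s(1)] s(2)] by metis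
  note tb = piece_bounds[OF t(1)]
  define x where "x = (if c = Inf t then c + min (e/2) ((Sup t - Inf t)/2) else c - min (e/2) ((Sup t - Inf t)/2))"
  have "x \<in> t" by (subst tb(1)) (use t(2) e tb(2) in \<open>auto simp: x_def min_def field_simps\<close>)
  moreover have "x \<in> s" by (rule subsetD[OF e(2)]) (use e(1) tb(2) in \<open>auto simp: x_def dist_real_def min_def\<close>)
  ultimately have "s = t" using pieces_disjoint s t by blast
  then show False using s(2) t(2) tb(1) by (metis greaterThanLessThan_iff less_irrefl)
qed

lemma endpoint_side:
  assumes "c \<in> endpoints P"
  shows "c \<noteq> Max (endpoints P) \<Longrightarrow> side c (at_right c)" "c \<noteq> Min (endpoints P) \<Longrightarrow> side c (at_left c)"
proof -
  note fin = endpoints_finite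
  have mem: "Max (endpoints P) \<in> endpoints P" "Min (endpoints P) \<in> endpoints P"
    using assms by (auto intro!: Max_in Min_in fin)
  show "side c (at_right c)" if "c \<noteq> Max (endpoints P)"
    using that Max_ge[OF fin assms] endpoints_bounds[OF mem(1)] endpoints_bounds[OF assms] unfolding side_def by auto
  show "side c (at_left c)" if "c \<noteq> Min (endpoints P)"
    using that Min_le[OF fin assms] endpoints_bounds[OF mem(2)] endpoints_bounds[OF assms] unfolding side_def by auto
qed

lemma limitin_itinerary_iff_germ:
  assumes G: "side c G" "G = at c within D" and C: "c \<notin> D"
  shows "limitin (seq_topology P) (itinerary T P) C (at c within D \<inter> regular_points T P) \<longleftrightarrow> germ G C"
    (is "limitin _ _ _ ?H \<longleftrightarrow> _")
proof -
  have le: "?H \<le> G" unfolding G(2) by (rule at_le) simp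
  \<comment> \<open>Density of the regular points keeps the restricted filter nontrivial; otherwise
    limits would not be unique.\<close>
  have ne: "?H \<noteq> bot"
  proof
    assume "?H = bot"
    then have "eventually (\<lambda>x. False) ?H" by simp
    then have "eventually (\<lambda>x. x \<noteq> c \<longrightarrow> x \<notin> D \<inter> regular_points T P) (nhds c)"
      unfolding eventually_at_filter by (rule eventually_mono) blast
    then have "eventually (\<lambda>x. x \<notin> regular_points T P) G"
      unfolding G(2) eventually_at_filter by (rule eventually_mono) blast
    from side_interval[OF G(1) this] obtain X where "open X" "X \<noteq> {}" "X \<subseteq> {a..b}"
        "\<And>x. x \<in> X \<Longrightarrow> x \<notin> regular_points T P"
      by metis
    then show False using regular_dense by metis
  qed
  have germ_limit: "limitin (seq_topology P) (itinerary T P) \<kappa> ?H" if \<kappa>: "germ G \<kappa>" for \<kappa>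
    unfolding limitin_def
  proof (intro conjI allI impI)
    show "\<kappa> \<in> topspace (seq_topology P)" using \<kappa> by (simp add: topspace_seq_topology germ_def)
    fix U assume "openin (seq_topology P) U \<and> \<kappa> \<in> U"
    then obtain F where F: "finite F" "\<And>B. (\<forall>i. B i \<in> P) \<and> (\<forall>i\<in>F. B i = \<kappa> i) \<Longrightarrow> B \<in> U"
      unfolding openin_seq_topology by blast
    have "eventually (\<lambda>x. \<forall>i\<in>F. (T ^^ i) x \<in> \<kappa> i) ?H"
      using \<kappa> F(1) filter_leD[OF le] unfolding germ_def by (intro eventually_ball_finite) auto
    moreover have "eventually (\<lambda>x. x \<in> regular_points T P) ?H" unfolding eventually_at_filter by simp
    ultimately show "eventually (\<lambda>x. itinerary T P x \<in> U) ?H"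
    proof eventually_elim
      case (elim x)
      then show ?case using \<kappa> regular_points_itinerary(1)[of x] by (intro F(2)) (auto simp: germ_def itinerary_eqI)
    qed
  qed
  have limit_germ: "C = \<kappa>" if C: "limitin (seq_topology P) (itinerary T P) C ?H" and \<kappa>: "germ G \<kappa>" for \<kappa>
  proof
    fix k :: nat
    have CP: "\<forall>i. C i \<in> P" using C unfolding limitin_def by (simp add: topspace_seq_topology)
    have open_coord: "openin (seq_topology P) {B. (\<forall>i. B i \<in> P) \<and> B k = D k}" for D :: "nat \<Rightarrow> real set"
      unfolding openin_seq_topology by (auto intro!: exI[of _ "{k}"])
    have "eventually (\<lambda>x. itinerary T P x k = C k) ?H"
      using C open_coord[of C] CP unfolding limitin_def
      by (smt (verit, del_insts) eventually_mono mem_Collect_eq)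
    moreover have "eventually (\<lambda>x. itinerary T P x k = \<kappa> k) ?H"
      using germ_limit[OF \<kappa>] open_coord[of \<kappa>] \<kappa> unfolding limitin_def germ_def
      by (smt (verit, del_insts) eventually_mono mem_Collect_eq)
    ultimately have "eventually (\<lambda>x. C k = \<kappa> k) ?H" by eventually_elim simp
    then show "C k = \<kappa> k" using eventually_happens'[OF ne] by blast
  qed
  obtain \<kappa> where "germ G \<kappa>" using germ_exists[OF G(1)] by blast
  then show ?thesis using germ_limit limit_germ by blast
qed

lemma mem_kneading_iff:
  "\<kappa> \<in> kneading T P \<longleftrightarrow>
     (\<exists>c \<in> endpoints P - {Max (endpoints P)}. germ (at_right c) \<kappa>) \<or>
     (\<exists>c \<in> endpoints P - {Min (endpoints P)}. germ (at_left c) \<kappa>)"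
  unfolding kneading_def
  using limitin_itinerary_iff_germ[OF endpoint_side(1) refl] limitin_itinerary_iff_germ[OF endpoint_side(2) refl]
  by auto

lemma kneading_cases:
  assumes "\<kappa> \<in> kneading T P"
  obtains c G where "c \<in> endpoints P" "side c G" "germ G \<kappa>"
  using assms endpoint_side unfolding mem_kneading_iff by blast

lemma finite_kneading: "finite (kneading T P)"
proof -
  have "kneading T P \<subseteq> (\<Union>c\<in>endpoints P. {\<kappa>. side c (at_right c) \<and> germ (at_right c) \<kappa>} \<union>
      {\<kappa>. side c (at_left c) \<and> germ (at_left c) \<kappa>})"
  proof
    fix \<kappa> assume "\<kappa> \<in> kneading T P"
    then consider c where "c \<in> endpoints P" "side c (at_right c)" "germ (at_right c) \<kappa>"
      | c where "c \<in> endpoints P" "side c (at_left c)" "germ (at_left c) \<kappa>"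
      using endpoint_side unfolding mem_kneading_iff by blast
    then show "\<kappa> \<in> (\<Union>c\<in>endpoints P. {\<kappa>. side c (at_right c) \<and> germ (at_right c) \<kappa>} \<union>
      {\<kappa>. side c (at_left c) \<and> germ (at_left c) \<kappa>})" by cases blast+
  qed
  moreover have "finite {\<kappa>. side c G \<and> germ G \<kappa>}" for c G
  proof (rule finite_subset)
    show "{\<kappa>. side c G \<and> germ G \<kappa>} \<subseteq> {SOME \<kappa>. germ G \<kappa>}"
      using germ_unique someI[of "germ G"] by blast
  qed simp
  ultimately show ?thesis using endpoints_finite by (meson finite_UN_I finite_UnI finite_subset)
qed

lemma kneading_piece_right:
  assumes "s \<in> P"
  obtains \<kappa> where "\<kappa> \<in> kneading T P" "germ (at_right (Inf s)) \<kappa>" "side (Inf s) (at_right (Inf s))"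
proof -
  have "Inf s \<in> endpoints P" "Sup s \<in> endpoints P" using assms unfolding endpoints_def by auto
  then have *: "Inf s \<in> endpoints P - {Max (endpoints P)}"
    using Max_ge[OF endpoints_finite, of "Sup s"] piece_bounds(2)[OF assms] by auto
  then have "side (Inf s) (at_right (Inf s))" using endpoint_side(1) by blast
  then show thesis using that germ_exists * mem_kneading_iff by metis
qed

lemma kneading_piece_left:
  assumes "s \<in> P"
  obtains \<kappa> where "\<kappa> \<in> kneading T P" "germ (at_left (Sup s)) \<kappa>" "side (Sup s) (at_left (Sup s))"
proof -
  have "Inf s \<in> endpoints P" "Sup s \<in> endpoints P" using assms unfolding endpoints_def by auto
  then have *: "Sup s \<in> endpoints P - {Min (endpoints P)}"
    using Min_le[OF endpoints_finite, of "Inf s"] piece_bounds(2)[OF assms] by auto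
  then have "side (Sup s) (at_left (Sup s))" using endpoint_side(2) by blast
  then show thesis using that germ_exists * mem_kneading_iff by metis
qed

end

context monotone_partition
begin

section \<open>Shadowing and the Markov property\<close>

text \<open>If a point \<open>y\<close> of \<open>cyl (u @ v)\<close> were not a value of
  \<open>T\<close> on \<open>s\<close>, it would lie above or below the whole image of
  \<open>s\<close>. Then, from \<open>z\<close> up to one end of \<open>s\<close>, the piece is
  mapped between \<open>T z\<close> and \<open>y\<close>, hence into the interval
  \<open>cyl u\<close>. Points next to that end would follow \<open>s # u\<close>, making it the
  beginning of a kneading invariant.\<close>

lemma cyl_extend:
  assumes s: "s \<in> P" and u: "set u \<subseteq> P" and su: "cyl (s # u) \<noteq> {}" and uv: "cyl (u @ v) \<noteq> {}"
    and K: "\<And>\<kappa>. \<kappa> \<in> kneading T P \<Longrightarrow> map \<kappa> [0..<Suc (length u)] \<noteq> s # u"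
  shows "cyl (s # u @ v) \<noteq> {}"
proof -
  obtain z where z: "z \<in> s" "T z \<in> cyl u" using su unfolding cyl_Cons by blast
  obtain y where y: "y \<in> cyl (u @ v)" using uv by blast
  then have yu: "y \<in> cyl u" using cyl_append_subset by blast
  note between = is_interval_betweenD[OF cyl_interval[OF u]]
  note sb = piece_bounds[OF s]
  have zb: "Inf s < z" "z < Sup s" using z(1) sb(1) by (metis greaterThanLessThan_iff)+
  \<comment> \<open>\<open>right\<close> looks to the right of the left end of \<open>s\<close>,
    \<open>left\<close> to the left of its right end.\<close>
  have right: False if *: "\<And>x. x \<in> s \<Longrightarrow> x \<le> z \<Longrightarrow> T x \<in> cyl u"
  proof -
    obtain \<kappa> where \<kappa>: "\<kappa> \<in> kneading T P" "germ (at_right (Inf s)) \<kappa>" "side (Inf s) (at_right (Inf s))"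
      using kneading_piece_right[OF s] .
    have "eventually (\<lambda>x. x \<in> {Inf s<..<z}) (at_right (Inf s))" using zb by (intro eventually_at_right_real)
    then have "eventually (\<lambda>x. x \<in> cyl (s # u)) (at_right (Inf s))"
    proof (rule eventually_mono)
      fix x assume "x \<in> {Inf s<..<z}"
      then have "x \<in> s" "x \<le> z" using sb(1) zb by (metis greaterThanLessThan_iff less_trans, simp)
      then show "x \<in> cyl (s # u)" unfolding cyl_Cons using * by blast
    qed
    then have "map \<kappa> [0..<length (s # u)] = s # u" by (intro germ_prefix[OF \<kappa>(3,2)]) (use s u in auto)
    with K[OF \<kappa>(1)] show False by simp
  qed
  have left: False if *: "\<And>x. x \<in> s \<Longrightarrow> z \<le> x \<Longrightarrow> T x \<in> cyl u"
  proof -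
    obtain \<kappa> where \<kappa>: "\<kappa> \<in> kneading T P" "germ (at_left (Sup s)) \<kappa>" "side (Sup s) (at_left (Sup s))"
      using kneading_piece_left[OF s] .
    have "eventually (\<lambda>x. x \<in> {z<..<Sup s}) (at_left (Sup s))" using zb by (intro eventually_at_left_real)
    then have "eventually (\<lambda>x. x \<in> cyl (s # u)) (at_left (Sup s))"
    proof (rule eventually_mono)
      fix x assume "x \<in> {z<..<Sup s}"
      then have "x \<in> s" "z \<le> x" using sb(1) zb by (metis greaterThanLessThan_iff less_trans, simp)
      then show "x \<in> cyl (s # u)" unfolding cyl_Cons using * by blast
    qed
    then have "map \<kappa> [0..<length (s # u)] = s # u" by (intro germ_prefix[OF \<kappa>(3,2)]) (use s u in auto)
    with K[OF \<kappa>(1)] show False by simp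
  qed
  have "y \<in> T ` s"
  proof (rule ccontr)
    assume "y \<notin> T ` s"
    have "is_interval (T ` s)"
      using pieces_continuous[OF s] pieces_interval[OF s] connected_continuous_image is_interval_connected_1 by blast
    then have "\<not> (T x < y \<and> y < T x')" if "x \<in> s" "x' \<in> s" for x x'
      using is_interval_betweenD[of "T ` s" "T x" "T x'" y] \<open>y \<notin> T ` s\<close> that by auto
    then consider "\<And>x. x \<in> s \<Longrightarrow> T x < y" | "\<And>x. x \<in> s \<Longrightarrow> y < T x"
      using \<open>y \<notin> T ` s\<close> by (metis image_eqI linorder_neqE_linordered_idom)
    moreover have "(\<forall>x\<in>s. \<forall>x'\<in>s. x \<le> x' \<longrightarrow> T x \<le> T x') \<or> (\<forall>x\<in>s. \<forall>x'\<in>s. x \<le> x' \<longrightarrow> T x' \<le> T x)"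
      using pieces_monotone[OF s] unfolding mono_or_anti_def monotone_on_def by (metis order_le_less)
    \<comment> \<open>Four cases: \<open>T\<close> increasing or decreasing on \<open>s\<close>, and
      \<open>y\<close> above or below the image.\<close>
    ultimately consider "\<And>x. x \<in> s \<Longrightarrow> z \<le> x \<Longrightarrow> T z \<le> T x \<and> T x \<le> y"
      | "\<And>x. x \<in> s \<Longrightarrow> x \<le> z \<Longrightarrow> T z \<le> T x \<and> T x \<le> y"
      | "\<And>x. x \<in> s \<Longrightarrow> x \<le> z \<Longrightarrow> y \<le> T x \<and> T x \<le> T z"
      | "\<And>x. x \<in> s \<Longrightarrow> z \<le> x \<Longrightarrow> y \<le> T x \<and> T x \<le> T z"
      using z(1) by (metis less_imp_le)
    then show False
    proof cases
      case 1
      show False by (rule left) (use 1 between[OF z(2) yu] in blast)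
    next
      case 2
      show False by (rule right) (use 2 between[OF z(2) yu] in blast)
    next
      case 3
      show False by (rule right) (use 3 between[OF yu z(2)] in blast)
    next
      case 4
      show False by (rule left) (use 4 between[OF yu z(2)] in blast)
    qed
  qed
  then show ?thesis using y cyl_Cons[of s "u @ v"] by auto
qed

text \<open>Windows that start in the overlap or later are windows of \<open>B\<close>. Earlier ones
  that reach \<open>p\<close> arise by prepending symbols of \<open>A\<close> one at a time with
  \<open>cyl_extend\<close>, whose hypothesis on kneading invariants is the failure of shadowing at
  lengths beyond \<open>N\<close>.\<close>

lemma glue_not_shadowed:
  assumes A: "A \<in> \<Sigma>" and B: "B \<in> \<Sigma>" and eq: "\<forall>i\<in>{p - int N..p}. B i = A i"
    and K: "\<And>n \<kappa>. n \<ge> N \<Longrightarrow> \<kappa> \<in> kneading T P \<Longrightarrow> map A [p - int n..p] \<noteq> map \<kappa> [0..<Suc n]"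
  shows "(\<lambda>i. if i \<le> p then A i else B i) \<in> \<Sigma>"
proof -
  let ?G = "\<lambda>i. if i \<le> p then A i else B i"
  have GP: "?G i \<in> P" for i using A B unfolding mem_nat_extension_iff by simp
  have late: "cyl (map ?G [m..q]) \<noteq> {}" if "m \<ge> p - int N" for m q
  proof -
    have e: "map ?G [m..q] = map B [m..q]" using that eq by auto
    show ?thesis using B unfolding e mem_nat_extension_iff by blast
  qed
  have early: "cyl (map ?G [m..q]) \<noteq> {}" if "m \<le> p - int N" "p \<le> q" for m q
    using that(1)
  proof (induction m rule: int_le_induct)
    case base
    show ?case by (rule late) simp
  next
    case (step i)
    have ip: "i \<le> p" using step by simp
    let ?s = "A (i - 1)" and ?u = "map A [i..p]" and ?v = "map B [p + 1..q]"
    have iq: "map ?G [i..q] = ?u @ ?v" using upto_split2[OF ip that(2)] by auto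
    have su: "?s # ?u = map A [i - 1..p]" using ip upto_rec1[of "i - 1" p] by simp
    have "cyl (?s # ?u @ ?v) \<noteq> {}"
    proof (rule cyl_extend)
      show "?s \<in> P" "set ?u \<subseteq> P" using A unfolding mem_nat_extension_iff by auto
      show "cyl (?s # ?u) \<noteq> {}" using A unfolding su mem_nat_extension_iff by blast
      show "cyl (?u @ ?v) \<noteq> {}" using step.IH unfolding iq .
      fix \<kappa> assume "\<kappa> \<in> kneading T P"
      then have "map A [p - int (nat (p - i + 1))..p] \<noteq> map \<kappa> [0..<Suc (nat (p - i + 1))]"
        using step by (intro K) auto
      then show "map \<kappa> [0..<Suc (length ?u)] \<noteq> ?s # ?u" unfolding su using ip by auto
    qed
    moreover have "map ?G [i - 1..q] = ?s # ?u @ ?v"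
      using iq ip that(2) upto_rec1[of "i - 1" q] by simp
    ultimately show ?case by simp
  qed
  have "cyl (map ?G [m..q]) \<noteq> {}" for m q
  proof (cases "p \<le> q")
    case True
    then show ?thesis using late early by (meson linorder_le_cases)
  next
    case False
    then have e: "map ?G [m..q] = map A [m..q]" by simp
    show ?thesis using A unfolding e mem_nat_extension_iff by blast
  qed
  then show ?thesis using GP unfolding mem_nat_extension_iff by blast
qed

lemma markov_at_if_not_shadowed:
  assumes A: "A \<in> \<Sigma>" and "\<not> shadowed_at (kneading T P) A p"
  shows "markov_at \<Sigma> A p"
proof -
  obtain N where K: "\<And>n \<kappa>. n \<ge> N \<Longrightarrow> \<kappa> \<in> kneading T P \<Longrightarrow> map A [p - int n..p] \<noteq> map \<kappa> [0..<Suc n]"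
    using assms(2) unfolding shadowed_at_def by blast
  have "fol \<Sigma> (map A [p - int n..p]) = fol \<Sigma> (map A [p - int N..p])" if "n \<ge> N" for n
  proof
    show "fol \<Sigma> (map A [p - int n..p]) \<subseteq> fol \<Sigma> (map A [p - int N..p])"
      using that by (intro fol_map_upto_mono) auto
    show "fol \<Sigma> (map A [p - int N..p]) \<subseteq> fol \<Sigma> (map A [p - int n..p])"
    proof
      have le: "p - int n \<le> p" for n by simp
      fix D assume "D \<in> fol \<Sigma> (map A [p - int N..p])"
      then obtain B where B: "B \<in> \<Sigma>" "\<forall>i\<in>{p - int N..p}. B i = A i" "D = (\<lambda>k. B (p + int k))"
        unfolding fol_map_upto[OF le] by blast
      let ?G = "\<lambda>i. if i \<le> p then A i else B i"
      have "?G \<in> \<Sigma>" using glue_not_shadowed[OF A B(1,2) K] .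
      moreover have "D = (\<lambda>k. ?G (p + int k))" using B(2,3) by (auto simp: fun_eq_iff)
      ultimately show "D \<in> fol \<Sigma> (map A [p - int n..p])"
        unfolding fol_map_upto[OF le] by (intro CollectI exI[of _ ?G]) auto
    qed
  qed
  then show ?thesis unfolding markov_at_def by blast
qed

text \<open>The endpoint belongs to no piece, so the piece \<open>\<kappa> 0\<close> lies entirely
  on one side of it, and points close enough to the endpoint are beyond any given point of the
  piece.\<close>

lemma kneading_extremal:
  assumes "\<kappa> \<in> kneading T P"
  obtains c G where "side c G" "germ G \<kappa>"
    "(\<forall>x\<in>\<kappa> 0. eventually (\<lambda>y. y < x) G) \<or> (\<forall>x\<in>\<kappa> 0. eventually (\<lambda>y. x < y) G)"
proof -
  obtain c G where c: "c \<in> endpoints P" "side c G" "germ G \<kappa>" using kneading_cases[OF assms] .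
  have s: "\<kappa> 0 \<in> P" and ev: "eventually (\<lambda>x. x \<in> \<kappa> 0) G"
    using c(3) unfolding germ_def by (auto dest: spec[of _ 0])
  have cs: "c \<notin> \<kappa> 0" using endpoints_not_in_pieces[OF c(1) s] .
  note between = is_interval_betweenD[OF pieces_interval[OF s]]
  consider "c < b" "G = at_right c" | "a < c" "G = at_left c" using c(2) unfolding side_def by blast
  then show thesis
  proof cases
    case 1
    have "eventually (\<lambda>y. y \<in> {c<..<b}) G" unfolding 1(2) using 1(1) by (rule eventually_at_right_real)
    with ev have "eventually (\<lambda>y. y \<in> \<kappa> 0 \<and> y \<in> {c<..<b}) G" by (rule eventually_conj)
    then obtain y where y: "y \<in> \<kappa> 0" "c < y" using eventually_happens'[OF side_nontrivial[OF c(2)]] by auto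
    have "eventually (\<lambda>y. y < x) G" if "x \<in> \<kappa> 0" for x
    proof -
      have "c < x" using between[OF that y(1), of c] cs y(2) by force
      then show ?thesis unfolding 1(2) by (rule eventually_mono[OF eventually_at_right_real]) simp
    qed
    then show thesis using that[OF c(2,3)] by blast
  next
    case 2
    have "eventually (\<lambda>y. y \<in> {a<..<c}) G" unfolding 2(2) using 2(1) by (rule eventually_at_left_real)
    with ev have "eventually (\<lambda>y. y \<in> \<kappa> 0 \<and> y \<in> {a<..<c}) G" by (rule eventually_conj)
    then obtain y where y: "y \<in> \<kappa> 0" "y < c" using eventually_happens'[OF side_nontrivial[OF c(2)]] by auto
    have "eventually (\<lambda>y. x < y) G" if "x \<in> \<kappa> 0" for x
    proof -
      have "x < c" using between[OF y(1) that, of c] cs y(2) by force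
      then show ?thesis unfolding 2(2) by (rule eventually_mono[OF eventually_at_left_real]) simp
    qed
    then show thesis using that[OF c(2,3)] by blast
  qed
qed

text \<open>Points next to the endpoint realize the middle tail after the prefix of length
  \<open>n\<close>, and they can be chosen beyond two points that realize the outer tails after the
  same prefix. Monotonicity of \<open>T ^^ n\<close> on the cylinder of the prefix forbids moving
  them in between.\<close>

lemma kneading_not_between:
  assumes \<kappa>: "\<kappa> \<in> kneading T P" and XZ: "X \<noteq> []" "Z \<noteq> []" "hd X = \<kappa> n" "hd Z = \<kappa> n"
    and nonempty: "cyl (map \<kappa> [0..<n] @ X) \<noteq> {}" "cyl (map \<kappa> [0..<n] @ Z) \<noteq> {}"
    and less: "\<And>x y. x \<in> cyl X \<Longrightarrow> y \<in> cyl (map \<kappa> [n..<n + j]) \<Longrightarrow> x < y"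
      "\<And>y z. y \<in> cyl (map \<kappa> [n..<n + j]) \<Longrightarrow> z \<in> cyl Z \<Longrightarrow> y < z"
  shows False
proof -
  let ?w = "map \<kappa> [0..<n]" and ?Y = "map \<kappa> [n..<n + j]"
  obtain c G where G: "side c G" "germ G \<kappa>"
    "(\<forall>x\<in>\<kappa> 0. eventually (\<lambda>y. y < x) G) \<or> (\<forall>x\<in>\<kappa> 0. eventually (\<lambda>y. x < y) G)"
    using kneading_extremal[OF \<kappa>] .
  \<comment> \<open>The conditions on the first letters matter for n = 0, where the empty prefix
    does not force the points into \<open>\<kappa> 0\<close>.\<close>
  have hd0: "x \<in> \<kappa> 0" if "x \<in> cyl (?w @ X)" "X \<noteq> []" "hd X = \<kappa> n" for x X
  proof -
    have "(?w @ X) ! 0 = \<kappa> 0" using that(2,3) by (cases n) (auto simp: hd_conv_nth nth_append)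
    moreover have "x \<in> (?w @ X) ! 0" using that(1,2) unfolding cyl_def by (auto dest: spec[of _ 0])
    ultimately show ?thesis by simp
  qed
  obtain x z where x: "x \<in> cyl (?w @ X)" and z: "z \<in> cyl (?w @ Z)" using nonempty by blast
  have x0: "x \<in> \<kappa> 0" and z0: "z \<in> \<kappa> 0" using hd0[OF x] hd0[OF z] XZ by auto
  have "map \<kappa> [0..<n + j] = ?w @ ?Y" by (simp flip: map_append upt_add_eq_append)
  then have evY: "eventually (\<lambda>y. y \<in> cyl (?w @ ?Y)) G" using germ_eventually_cyl[OF G(2), of "n + j"] by simp
  have "\<exists>y. y \<in> cyl (?w @ ?Y) \<and> (y < x \<and> y < z \<or> x < y \<and> z < y)"
    using G(3)
  proof
    assume "\<forall>x\<in>\<kappa> 0. eventually (\<lambda>y. y < x) G"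
    then have "eventually (\<lambda>y. y \<in> cyl (?w @ ?Y) \<and> y < x \<and> y < z) G"
      using x0 z0 evY by (simp add: eventually_conj)
    then show ?thesis using eventually_happens'[OF side_nontrivial[OF G(1)]] by blast
  next
    assume "\<forall>x\<in>\<kappa> 0. eventually (\<lambda>y. x < y) G"
    then have "eventually (\<lambda>y. y \<in> cyl (?w @ ?Y) \<and> x < y \<and> z < y) G"
      using x0 z0 evY by (simp add: eventually_conj)
    then show ?thesis using eventually_happens'[OF side_nontrivial[OF G(1)]] by blast
  qed
  then obtain y where y: "y \<in> cyl (?w @ ?Y)" "y < x \<and> y < z \<or> x < y \<and> z < y" by blast
  have w: "set ?w \<subseteq> P" using G(2) unfolding germ_def by auto
  have "mono_or_anti (T ^^ n) (cyl ?w)" using cyl_iterate[OF w, of n] by simp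
  moreover have "x \<in> cyl ?w" "y \<in> cyl ?w" "z \<in> cyl ?w" "(T ^^ n) x \<in> cyl X" "(T ^^ n) y \<in> cyl ?Y" "(T ^^ n) z \<in> cyl Z"
    using x y(1) z unfolding cyl_append by auto
  ultimately have "x < y \<and> y < z \<or> z < y \<and> y < x" using mono_or_anti_between less by blast
  with y(2) show False by auto
qed

end

lemma disjoint_intervals_less:
  fixes X Y :: "real set"
  assumes "is_interval X" "is_interval Y" "X \<inter> Y = {}"
  shows "(\<forall>x\<in>X. \<forall>y\<in>Y. x < y) \<or> (\<forall>x\<in>X. \<forall>y\<in>Y. y < x)"
proof (rule ccontr)
  assume "\<not> ?thesis"
  then obtain x y x' y' where *: "x \<in> X" "y \<in> Y" "y \<le> x" "x' \<in> X" "y' \<in> Y" "x' \<le> y'"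
    by (meson linorder_not_less)
  show False
  proof (cases "x' \<le> y")
    case True
    then show False using is_interval_betweenD[OF assms(1) *(4,1), of y] * assms(3) by blast
  next
    case False
    then show False using is_interval_betweenD[OF assms(2) *(2,5), of x'] * assms(3) by auto
  qed
qed

section \<open>Sequences that are both Markov and shadowed\<close>

context monotone_partition
begin

lemma shadowed_prefix_iff:
  "map A [p - int n..p] = map \<kappa> [0..<Suc n] \<longleftrightarrow> (\<forall>i\<le>n. A (p - int n + int i) = \<kappa> i)"
  by (auto simp: list_eq_iff_nth_eq less_Suc_eq_le simp del: upt_Suc)

text \<open>If the follower set \<open>F\<close> of \<open>A\<close> at time \<open>p\<close> stabilizes, the tails of \<open>\<kappa>\<close> at the times when it
  shadows \<open>A\<close> are all extremal in \<open>F\<close>, hence at most two of them are distinct.\<close>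

lemma shadowing_markov_eventually_periodic:
  assumes A: "A \<in> \<Sigma>" and markov: "markov_at \<Sigma> A p" and \<kappa>: "\<kappa> \<in> kneading T P"
    and inf: "infinite {n. map A [p - int n..p] = map \<kappa> [0..<Suc n]}" (is "infinite ?N")
  shows "\<exists>q>0. \<exists>n0. \<forall>k\<ge>n0. \<kappa> (k + q) = \<kappa> k"
proof (rule ccontr)
  assume nper: "\<not> ?thesis"
  obtain m0 where m0: "stable_from A p m0" using markov markov_at_iff by blast
  define N where "N = {n \<in> ?N. n \<ge> nat (p - m0)}"
  have "infinite (?N - {..<nat (p - m0)})" using inf by (rule Diff_infinite_finite[rotated]) simp
  moreover have "?N - {..<nat (p - m0)} = N" unfolding N_def by auto
  ultimately have infN: "infinite N" by (rule back_subst[of infinite])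
  have NA: "A (p - int n + int i) = \<kappa> i" if "n \<in> N" "i \<le> n" for n i
    using that unfolding N_def shadowed_prefix_iff by blast
  have Nm0: "p - int n \<le> m0" if "n \<in> N" for n
  proof -
    have "nat (p - m0) \<le> n" using that unfolding N_def by blast
    then show ?thesis by linarith
  qed
  have NAp: "\<kappa> n = A p" if "n \<in> N" for n using NA[OF that, of n] by simp
  have \<kappa>P: "\<kappa> k \<in> P" for k using kneading_cases[OF \<kappa>] unfolding germ_def by metis
  have word: "cyl (map \<kappa> [0..<n] @ map \<kappa> [n'..<n' + Suc j]) \<noteq> {}" if n: "n \<in> N" "n' \<in> N" for n n' j
  proof -
    \<comment> \<open>A later shadowing time displays more of \<kappa>: translating \<open>A\<close>
      so that \<open>\<kappa> n'\<close> sits at time \<open>p\<close> gives a sequence that agrees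
      with \<open>A\<close> on the last n' + 1 symbols and continues with the tail at
      \<open>n'\<close>. By stability its future also follows the window of \<open>A\<close> with n
      + 1 symbols.\<close>
    obtain n2 where n2: "n2 > n' + j" "n2 \<in> N" using infN infinite_nat_iff_unbounded by blast
    define B where "B = (\<lambda>i. A (i + (int n' - int n2)))"
    have B: "B \<in> \<Sigma>" unfolding B_def by (rule shift[OF A])
    have B\<kappa>: "B (p - int n' + int i) = \<kappa> i" if "i \<le> n2" for i
      using NA[OF n2(2) that] unfolding B_def by (simp add: algebra_simps)
    have BA: "B i = A i" if "i \<in> {p - int n'..p}" for i
    proof -
      have i: "i = p - int n' + int (nat (i - (p - int n')))" "nat (i - (p - int n')) \<le> n'" using that by auto
      show ?thesis using B\<kappa>[of "nat (i - (p - int n'))"] NA[OF n(2) i(2)] i n2(1) by simp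
    qed
    have le: "p - int n \<le> p" for n by simp
    have "(\<lambda>k. B (p + int k)) \<in> fol \<Sigma> (map A [p - int n'..p])"
      unfolding fol_map_upto[OF le] using B BA by blast
    also have "fol \<Sigma> (map A [p - int n'..p]) = fol \<Sigma> (map A [m0..p])"
      by (rule stable_fromD[OF m0 Nm0[OF n(2)]])
    also have "\<dots> = fol \<Sigma> (map A [p - int n..p])"
      by (rule stable_fromD[OF m0 Nm0[OF n(1)], symmetric])
    finally obtain B' where B': "B' \<in> \<Sigma>" "\<forall>i\<in>{p - int n..p}. B' i = A i"
        "(\<lambda>k. B (p + int k)) = (\<lambda>k. B' (p + int k))"
      unfolding fol_map_upto[OF le] by blast
    have "map B' [p - int n..p + int j] = map \<kappa> [0..<n] @ map \<kappa> [n'..<n' + Suc j]"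
    proof (rule nth_equalityI)
      show "length (map B' [p - int n..p + int j]) = length (map \<kappa> [0..<n] @ map \<kappa> [n'..<n' + Suc j])" by simp
      fix k assume "k < length (map B' [p - int n..p + int j])"
      then have k: "k < n + Suc j" by simp
      show "map B' [p - int n..p + int j] ! k = (map \<kappa> [0..<n] @ map \<kappa> [n'..<n' + Suc j]) ! k"
      proof (cases "k < n")
        case True
        then show ?thesis using B'(2) NA[OF n(1), of k] by (simp add: nth_append)
      next
        case False
        have "B' (p + int (k - n)) = B (p + int (k - n))" using fun_cong[OF B'(3), of "k - n"] by simp
        also have "\<dots> = \<kappa> (n' + (k - n))" using B\<kappa>[of "n' + (k - n)"] k False n2(1) by simp
        moreover have "p + int (k - n) = p - int n + int k" using False by simp
        ultimately have "B' (p - int n + int k) = \<kappa> (n' + (k - n))" by metis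
        then show ?thesis using False k by (simp add: nth_append del: upt_Suc)
      qed
    qed
    then show ?thesis using B'(1) unfolding mem_nat_extension_iff by metis
  qed
  \<comment> \<open>Two equal tails would make \<kappa> eventually periodic.\<close>
  have "\<exists>d. \<kappa> (n + d) \<noteq> \<kappa> (m + d)" if "n < m" for n m
  proof (rule ccontr)
    assume "\<not> ?thesis"
    then have eq: "\<kappa> (m + d) = \<kappa> (n + d)" for d by simp
    have "\<kappa> (k + (m - n)) = \<kappa> k" if "k \<ge> n" for k
      using eq[of "k - n"] that \<open>n < m\<close> by (simp add: add.commute)
    with nper \<open>n < m\<close> show False by (metis zero_less_diff)
  qed
  then obtain d where d: "n < m \<Longrightarrow> \<kappa> (n + d n m) \<noteq> \<kappa> (m + d n m)" for n m by metis
  obtain n1 where n1: "n1 \<in> N" using infN by (metis equals0I finite.emptyI)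
  obtain n2 where n2: "n2 > n1" "n2 \<in> N" using infN infinite_nat_iff_unbounded by blast
  obtain n3 where n3: "n3 > n2" "n3 \<in> N" using infN infinite_nat_iff_unbounded by blast
  \<comment> \<open>Truncated after j + 1 letters the three tails still differ, so their cylinders
    are disjoint intervals and hence comparable.\<close>
  define j where "j = Max {d n1 n2, d n1 n3, d n2 n3}"
  have j: "d n1 n2 \<le> j" "d n1 n3 \<le> j" "d n2 n3 \<le> j" unfolding j_def by auto
  define W where "W = (\<lambda>n. map \<kappa> [n..<n + Suc j])"
  define less where "less = (\<lambda>n m. \<forall>x\<in>cyl (W n). \<forall>y\<in>cyl (W m). x < y)"
  have Wne: "W n \<noteq> W m" if "n < m" "d n m \<le> j" for n m
  proof
    assume "W n = W m"
    then have "W n ! d n m = W m ! d n m" by simp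
    then show False using d[OF that(1)] that(2) unfolding W_def by (simp del: upt_Suc)
  qed
  have total: "less n m \<or> less m n" if "n < m" "d n m \<le> j" for n m
  proof -
    have sub: "set (W n) \<subseteq> P" for n unfolding W_def using \<kappa>P by auto
    have "cyl (W n) \<inter> cyl (W m) = {}"
      using cyl_same_length_disjoint[OF sub sub, of n m] Wne[OF that] by (auto simp: W_def)
    from disjoint_intervals_less[OF cyl_interval[OF sub] cyl_interval[OF sub] this]
    show ?thesis unfolding less_def by blast
  qed
  have no_path: False if "n \<in> N" "m \<in> N" "l \<in> N" "less n m" "less m l" for n m l
  proof (rule kneading_not_between[OF \<kappa>, of "W n" "W l" m "Suc j"])
    show "W n \<noteq> []" "W l \<noteq> []" unfolding W_def by auto
    show "hd (W n) = \<kappa> m" "hd (W l) = \<kappa> m"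
      using NAp that(1,2,3) unfolding W_def by (auto simp: hd_map simp del: upt_Suc)
    show "cyl (map \<kappa> [0..<m] @ W n) \<noteq> {}" "cyl (map \<kappa> [0..<m] @ W l) \<noteq> {}"
      unfolding W_def using word that(1,2,3) by blast+
  qed (use that(4,5) in \<open>auto simp: less_def W_def simp del: upt_Suc\<close>)
  have "less n1 n2 \<or> less n2 n1" "less n1 n3 \<or> less n3 n1" "less n2 n3 \<or> less n3 n2"
    using total[OF n2(1) j(1)] total[OF less_trans[OF n2(1) n3(1)] j(2)] total[OF n3(1) j(3)] by auto
  \<comment> \<open>A tournament on three vertices contains a directed path of length two, which
    \<open>no_path\<close> excludes.\<close>
  then show False using no_path n1 n2(2) n3(2) by blast
qed

text \<open>Prefixes of \<kappa> of unbounded length end at time \<open>p\<close> in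
  \<open>A\<close>, so any fixed position \<open>i\<close> falls into the periodic part of a long
  enough one.\<close>

lemma eventually_periodic_shadow:
  assumes inf: "infinite {n. map A [p - int n..p] = map \<kappa> [0..<Suc n]}"
    and per: "\<forall>k\<ge>n0. \<kappa> (k + q) = \<kappa> k" and "i \<le> p"
  shows "A (i - int (q * c)) = A i"
proof -
  have step: "A (i - int q) = A i" if "i \<le> p" for i
  proof -
    obtain n where n: "n > n0 + q + nat (p - i)" "map A [p - int n..p] = map \<kappa> [0..<Suc n]"
      using inf unfolding infinite_nat_iff_unbounded mem_Collect_eq by blast
    define k where "k = n - nat (p - i) - q"
    have eq: "A (p - int n + int l) = \<kappa> l" if "l \<le> n" for l using n(2) that unfolding shadowed_prefix_iff by blast
    have "p - int n + int (k + q) = i" "p - int n + int k = i - int q" "k + q \<le> n" "k \<ge> n0"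
      using n(1) that unfolding k_def by auto
    moreover have "A (p - int n + int (k + q)) = \<kappa> (k + q)" "A (p - int n + int k) = \<kappa> k"
      using calculation(3) by (intro eq; simp)+
    ultimately show ?thesis using per by metis
  qed
  show ?thesis
  proof (induction c)
    case (Suc c)
    have "A (i - int (q * c) - int q) = A (i - int (q * c))" using \<open>i \<le> p\<close> by (intro step) (use of_nat_0_le_iff[of "q * c", where ?'a = int] in linarith)
    then show ?case using Suc by (simp add: algebra_simps)
  qed simp
qed

lemma shadowed_atD:
  assumes "shadowed_at (kneading T P) A p"
  obtains \<kappa> where "\<kappa> \<in> kneading T P" "infinite {n. map A [p - int n..p] = map \<kappa> [0..<Suc n]}"
proof -
  have "infinite (\<Union>\<kappa>\<in>kneading T P. {n. map A [p - int n..p] = map \<kappa> [0..<Suc n]})"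
    unfolding infinite_nat_iff_unbounded_le using assms unfolding shadowed_at_def by (simp del: upt_Suc)
  then show thesis using finite_kneading that by blast
qed

lemma shadowed_iff_non_markov:
  "\<exists>F. finite F \<and> F \<subseteq> {A \<in> \<Sigma>. periodic left_shift A} \<and>
     (\<forall>A \<in> \<Sigma> - F. (\<forall>p. shadowed_at (kneading T P) A p) \<longleftrightarrow> (\<forall>p. \<not> markov_at \<Sigma> A p))"
proof -
  define per where "per = (\<lambda>\<kappa> q. \<exists>n0::nat. \<forall>k\<ge>n0. \<kappa> (k + q) = (\<kappa> k :: real set))"
  \<comment> \<open>The value 1 for invariants that are not eventually periodic keeps the product
    \<open>L\<close> positive; \<open>L\<close> is a common multiple of the chosen periods.\<close>
  define pr where "pr = (\<lambda>\<kappa>. if \<exists>q>0. per \<kappa> q then SOME q. q > 0 \<and> per \<kappa> q else 1)"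
  have pr: "per \<kappa> (pr \<kappa>)" if "\<exists>q>0. per \<kappa> q" for \<kappa>
    using someI_ex[of "\<lambda>q. q > 0 \<and> per \<kappa> q"] that unfolding pr_def by auto
  have pr_pos: "pr \<kappa> > 0" for \<kappa>
    using someI_ex[of "\<lambda>q. q > 0 \<and> per \<kappa> q"] unfolding pr_def by auto
  define L where "L = (\<Prod>\<kappa>\<in>kneading T P. pr \<kappa>)"
  have L: "L > 0" unfolding L_def using pr_pos by (simp add: prod_pos)
  define F where "F = {A \<in> \<Sigma>. \<forall>i. A (i - int L) = A i}"
  have F_eq: "A i = A (i mod int L)" if "A \<in> F" for A i
  proof -
    have "A (j - int L * int c) = A j" for j c
    proof (induction c)
      case (Suc c)
      have "A (j - int L * int c - int L) = A (j - int L * int c)" using that unfolding F_def by blast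
      then show ?case using Suc by (simp add: algebra_simps)
    qed simp
    note * = this
    have "A j = A (j + int L * c)" for j c
      using *[of "j + int L * c" "nat c"] *[of j "nat (- c)"] by (cases "c \<ge> 0") auto
    from this[of "i mod int L" "i div int L"] show ?thesis by simp
  qed
  have "inj_on (\<lambda>A. map A [0..int L - 1]) F"
  proof (rule inj_onI, rule ext)
    fix A B i assume AB: "A \<in> F" "B \<in> F" "map A [0..int L - 1] = map B [0..int L - 1]"
    have "i mod int L \<in> {0..int L - 1}" using L by simp
    then have "A (i mod int L) = B (i mod int L)" using AB(3) unfolding map_upto_eq_iff by blast
    then show "A i = B i" using F_eq[OF AB(1), of i] F_eq[OF AB(2), of i] by simp
  qed
  moreover have "(\<lambda>A. map A [0..int L - 1]) ` F \<subseteq> {xs. set xs \<subseteq> P \<and> length xs = L}"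
    unfolding F_def mem_nat_extension_iff by auto
  ultimately have "finite F"
    by (rule inj_on_finite[OF _ _ finite_lists_length_eq[OF finite_P]])
  moreover have "F \<subseteq> {A \<in> \<Sigma>. periodic left_shift A}"
  proof
    fix A assume A: "A \<in> F"
    have "A (i + int L) = A i" for i
      using A unfolding F_def by (metis (mono_tags, lifting) add_diff_cancel_right' mem_Collect_eq)
    then have "(left_shift ^^ L) A = A" unfolding left_shift_funpow_int by simp
    with A L show "A \<in> {A \<in> \<Sigma>. periodic left_shift A}" unfolding F_def periodic_def by blast
  qed
  moreover have "(\<forall>p. shadowed_at (kneading T P) A p) \<longleftrightarrow> (\<forall>p. \<not> markov_at \<Sigma> A p)" if A: "A \<in> \<Sigma> - F" for A
  proof
    assume sh: "\<forall>p. shadowed_at (kneading T P) A p"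
    show "\<forall>p. \<not> markov_at \<Sigma> A p"
    proof (rule ccontr)
      assume "\<not> (\<forall>p. \<not> markov_at \<Sigma> A p)"
      then obtain p0 where p0: "markov_at \<Sigma> A p0" by blast
      have "A (i - int L) = A i" for i
      proof -
        \<comment> \<open>Being Markov persists after \<open>p0\<close>, and \<open>i\<close> has to
          lie in the past of \<open>p\<close>. The shadowing invariant may change with
          \<open>p\<close>, which is why the common multiple \<open>L\<close> is used.\<close>
        define p where "p = max i p0"
        have "markov_at \<Sigma> A p" using markov_at_mono[OF p0] unfolding p_def by simp
        moreover obtain \<kappa> where \<kappa>: "\<kappa> \<in> kneading T P" "infinite {n. map A [p - int n..p] = map \<kappa> [0..<Suc n]}"
          using shadowed_atD sh by blast
        ultimately have "\<exists>q>0. per \<kappa> q" unfolding per_def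
          using shadowing_markov_eventually_periodic A by blast
        then have "per \<kappa> (pr \<kappa>)" by (rule pr)
        then obtain n0 where "\<forall>k\<ge>n0. \<kappa> (k + pr \<kappa>) = \<kappa> k" unfolding per_def by blast
        from eventually_periodic_shadow[OF \<kappa>(2) this, of i "L div pr \<kappa>"]
        have "A (i - int (pr \<kappa> * (L div pr \<kappa>))) = A i" unfolding p_def by simp
        moreover have "pr \<kappa> dvd L" unfolding L_def using \<kappa>(1) finite_kneading by (rule dvd_prodI[rotated])
        ultimately show ?thesis by simp
      qed
      then show False using A unfolding F_def by blast
    qed
  next
    have "A \<in> \<Sigma>" using A by simp
    then show "\<forall>p. shadowed_at (kneading T P) A p" if "\<forall>p. \<not> markov_at \<Sigma> A p"
      using markov_at_if_not_shadowed[of A] that by metis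
  qed
  ultimately show ?thesis by (intro exI[of _ F] conjI ballI)
qed

end

section \<open>Periodic orbits and entropy-conjugacy\<close>

lemma bij_betw_images:
  assumes "inj_on R Z" "\<And>X. X \<in> F \<Longrightarrow> X \<subseteq> Z"
  shows "bij_betw (\<lambda>X. R ` X) F ((\<lambda>X. R ` X) ` F)"
  unfolding bij_betw_def using assms by (auto intro!: inj_onI simp: inj_on_image_eq_iff)

context alphabet_subshift
begin

lemma invariant_hofbauer_shift: "invariant_borel_subset hof.seqtop left_shift (hofbauer_shift S)"
  unfolding invariant_borel_subset_def hof.topspace_seqtop
proof
  show "hofbauer_shift S \<in> sets (borel_of hof.seqtop)"
    using openin_sets_borel_of[OF openin_topspace, of hof.seqtop] unfolding hof.topspace_seqtop .
qed (auto simp: left_shift_hofbauer_iff)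

lemma invariant_markov_part: "invariant_borel_subset seqtop left_shift (markov_part S)"
  unfolding invariant_borel_subset_def topspace_seqtop
proof
  have "(\<forall>p. markov_at S A (p + 1)) \<longleftrightarrow> (\<forall>p. markov_at S A p)" for A by (metis diff_add_cancel)
  then have "left_shift A \<in> markov_part S \<longleftrightarrow> A \<in> markov_part S" if "A \<in> S" for A
    unfolding markov_part_def mem_Collect_eq markov_at_left_shift using left_shift_S[OF that] that by blast
  moreover have "markov_part S \<subseteq> S" unfolding markov_part_def by blast
  ultimately show "left_shift -` markov_part S \<inter> S = markov_part S" by blast
qed (rule markov_part_sets)

lemma entropy_conjugacy_hofbauer_proj:
  assumes "zero_entropy_outside seqtop left_shift (markov_part S)"
  shows "entropy_conjugacy hof.seqtop left_shift (hofbauer_shift S) seqtop left_shift (markov_part S) hofbauer_proj"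
  unfolding entropy_conjugacy_def
proof (intro conjI ballI)
  show "zero_entropy_outside hof.seqtop left_shift (hofbauer_shift S)"
    unfolding zero_entropy_outside_def
  proof (intro allI impI)
    \<comment> \<open>Vacuous: the Hofbauer shift is the whole space, so it has probability
      one.\<close>
    fix M assume M: "invariant_prob hof.seqtop left_shift M" "emeasure M (hofbauer_shift S) = 0"
    have "space M = hofbauer_shift S" using sets_invariant_prob_space[OF M(1)] unfolding hof.topspace_seqtop .
    moreover have "prob_space M" using M(1) unfolding invariant_prob_def by blast
    ultimately show "KS_entropy M left_shift = 0" using M(2) prob_space.emeasure_space_1 by fastforce
  qed
qed (rule invariant_hofbauer_shift invariant_markov_part borel_isomorphism_hofbauer_proj
    hofbauer_proj_left_shift assms)+

text \<open>Periodicity recovers the two-sided projection from its nonnegative coordinates; then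
  injectivity of \<open>hofbauer_proj\<close> on the whole Hofbauer shift applies.\<close>

lemma inj_on_hofbauer_one_sided:
  "inj_on (\<lambda>\<alpha> k. hofbauer_proj \<alpha> (int k)) {\<alpha> \<in> hofbauer_shift S. periodic left_shift \<alpha>}"
proof (rule inj_onI)
  fix \<alpha> \<beta> assume \<alpha>: "\<alpha> \<in> {\<alpha> \<in> hofbauer_shift S. periodic left_shift \<alpha>}"
    and \<beta>: "\<beta> \<in> {\<alpha> \<in> hofbauer_shift S. periodic left_shift \<alpha>}"
    and eq: "(\<lambda>k. hofbauer_proj \<alpha> (int k)) = (\<lambda>k. hofbauer_proj \<beta> (int k))"
  obtain m where m: "m > 0" "(\<lambda>i. \<alpha> (i + int m)) = \<alpha>"
    using \<alpha> unfolding periodic_def left_shift_funpow_int by blast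
  obtain n where n: "n > 0" "(\<lambda>i. \<beta> (i + int n)) = \<beta>"
    using \<beta> unfolding periodic_def left_shift_funpow_int by blast
  have per: "x (i + int q * int k) = x i" if "(\<lambda>i. x (i + int q)) = x" for x :: "int \<Rightarrow> 's list" and q k i
  proof (induction k)
    case (Suc k)
    have "x (i + int q * int (Suc k)) = x (i + int q * int k + int q)" by (simp add: algebra_simps)
    then show ?case using fun_cong[OF that, of "i + int q * int k"] Suc by simp
  qed simp
  have "hofbauer_proj \<alpha> i = hofbauer_proj \<beta> i" for i
  proof -
    \<comment> \<open>The number m * n * k is a multiple of both periods and at least |i|, so adding
      it makes the position nonnegative.\<close>
    define k where "k = nat \<bar>i\<bar>"
    have "int k \<le> int m * int n * int k" using m(1) n(1)
      by (metis mult.commute mult_le_mono2 mult_1_right nat_0_less_mult_iff of_nat_le_iff of_nat_mult One_nat_def Suc_leI)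
    then have nn: "i + int m * int n * int k \<ge> 0" unfolding k_def by linarith
    have "\<alpha> i = \<alpha> (i + int m * int n * int k)" "\<beta> i = \<beta> (i + int m * int n * int k)"
      using per[OF m(2), of i "n * k"] per[OF n(2), of i "m * k"] by (simp_all add: mult_ac)
    moreover have "hofbauer_proj \<alpha> (i + int m * int n * int k) = hofbauer_proj \<beta> (i + int m * int n * int k)"
      using fun_cong[OF eq, of "nat (i + int m * int n * int k)"] nn by simp
    ultimately show ?thesis unfolding hofbauer_proj_def by simp
  qed
  then have "hofbauer_proj \<alpha> = hofbauer_proj \<beta>" by blast
  then show "\<alpha> = \<beta>"
    by (rule inj_onD[OF bij_betw_imp_inj_on[OF bij_betw_hofbauer_proj]]) (use \<alpha> \<beta> in simp_all)
qed

lemma periodic_orbits_subset: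
  assumes "Orb \<in> periodic_orbits left_shift (hofbauer_shift S)"
  shows "Orb \<subseteq> {\<alpha> \<in> hofbauer_shift S. periodic left_shift \<alpha>}"
proof -
  obtain \<alpha> where \<alpha>: "\<alpha> \<in> hofbauer_shift S" "periodic left_shift \<alpha>" "Orb = {(left_shift ^^ n) \<alpha> | n. True}"
    using assms unfolding periodic_orbits_def by blast
  have "(left_shift ^^ n) \<alpha> \<in> hofbauer_shift S" for n
    by (induction n) (use \<alpha>(1) left_shift_hofbauer_iff in auto)
  moreover have "periodic left_shift ((left_shift ^^ n) \<alpha>)" for n
  proof -
    obtain m where "m > 0" "(left_shift ^^ m) \<alpha> = \<alpha>" using \<alpha>(2) unfolding periodic_def by blast
    have "(left_shift ^^ m) ((left_shift ^^ n) \<alpha>) = (left_shift ^^ n) ((left_shift ^^ m) \<alpha>)"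
      unfolding left_shift_funpow_int by (simp add: add_ac)
    then have "(left_shift ^^ m) ((left_shift ^^ n) \<alpha>) = (left_shift ^^ n) \<alpha>"
      unfolding \<open>(left_shift ^^ m) \<alpha> = \<alpha>\<close> .
    with \<open>m > 0\<close> show ?thesis unfolding periodic_def by blast
  qed
  ultimately show ?thesis using \<alpha>(3) by blast
qed

lemma bij_betw_one_sided_image:
  assumes "F = periodic_orbits left_shift (hofbauer_shift S)"
  shows "bij_betw one_sided_image F (one_sided_image ` F)"
    "\<And>Orb. Orb \<in> F \<Longrightarrow> card (one_sided_image Orb) = card Orb"
proof -
  have eq: "one_sided_image = (\<lambda>Orb. (\<lambda>\<alpha> k. hofbauer_proj \<alpha> (int k)) ` Orb)"
    unfolding one_sided_image_def by (rule ext) (rule refl)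
  show "bij_betw one_sided_image F (one_sided_image ` F)"
    unfolding eq assms by (rule bij_betw_images[OF inj_on_hofbauer_one_sided periodic_orbits_subset])
  show "card (one_sided_image Orb) = card Orb" if "Orb \<in> F" for Orb
    unfolding eq
    by (rule card_image[OF inj_on_subset[OF inj_on_hofbauer_one_sided periodic_orbits_subset]]) (use that assms in simp)
qed

lemma one_sided_image_periodic_orbit:
  assumes "Orb \<in> periodic_orbits left_shift (hofbauer_shift S)"
    and Z: "\<And>A. A \<in> S \<Longrightarrow> (\<lambda>k. A (int k)) \<in> Z"
  shows "one_sided_image Orb \<in> periodic_orbits left_shift Z"
proof -
  obtain \<alpha> where \<alpha>: "\<alpha> \<in> hofbauer_shift S" "periodic left_shift \<alpha>" "Orb = {(left_shift ^^ n) \<alpha> | n. True}"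
    using assms unfolding periodic_orbits_def by blast
  let ?R = "\<lambda>\<alpha> k. hofbauer_proj \<alpha> (int k)"
  have R: "?R ((left_shift ^^ n) \<alpha>) = (left_shift ^^ n) (?R \<alpha>)" for n
    unfolding left_shift_funpow_int left_shift_funpow_nat hofbauer_proj_def by simp
  have "one_sided_image Orb = {(left_shift ^^ n) (?R \<alpha>) | n. True}"
    unfolding one_sided_image_def \<alpha>(3) using R by (auto simp: image_iff) metis+
  moreover have "?R \<alpha> \<in> Z" using hofbauer_proj_mem[OF \<alpha>(1)] Z unfolding markov_part_def by blast
  moreover have "periodic left_shift (?R \<alpha>)" using \<alpha>(2) R unfolding periodic_def by metis
  ultimately show ?thesis unfolding periodic_orbits_def by blast
qed

end

section \<open>The natural partition\<close>

lemma finite_interval_minus_interior: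
  fixes J :: "real set"
  assumes "is_interval J" "J \<subseteq> {a..b}"
  shows "finite (J - interior J)"
proof (rule finite_subset)
  show "J - interior J \<subseteq> {Inf J, Sup J}"
  proof
    fix x assume x: "x \<in> J - interior J"
    have bdd: "bdd_below J" "bdd_above J" using assms(2) by (auto intro: bdd_below_mono bdd_above_mono)
    show "x \<in> {Inf J, Sup J}"
    proof (rule ccontr)
      assume "x \<notin> {Inf J, Sup J}"
      then have "Inf J < x" "x < Sup J"
        using cInf_lower[OF _ bdd(1), of x] cSup_upper[OF _ bdd(2), of x] x by auto
      then obtain y z where "y \<in> J" "y < x" "z \<in> J" "x < z" using cInf_lessD[of J x] less_cSupD[of J x] x by auto
      then have "{y<..<z} \<subseteq> J" "x \<in> {y<..<z}" using is_interval_betweenD[OF assms(1), of y z] by auto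
      then have "x \<in> interior J" using interior_maximal[of "{y<..<z}" J] by auto
      with x show False by simp
    qed
  qed
qed simp

text \<open>Points of \<open>{a..b}\<close> outside all the symbols are ends of the finitely many
  intervals of \<open>Q\<close>, one-point intervals included; this gives the finiteness of the
  rest.\<close>

lemma natural_partition_imp_monotone_partition:
  assumes "a < b" "piecewise_monotone a b T" "natural_partition a b T P"
  shows "monotone_partition a b T P"
proof -
  obtain Q where Q: "monotone_pieces a b T Q" and P: "P = interior ` Q - {{}}"
    using assms(3) unfolding natural_partition_def is_arg_min_def by blast
  have fin: "finite Q" and cover: "\<Union>Q = {a..b}" and disj: "disjoint Q"
    and J: "\<And>J. J \<in> Q \<Longrightarrow> is_interval J \<and> continuous_on J T \<and> (strict_mono_on J T \<or> strict_antimono_on J T)"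
    using Q unfolding monotone_pieces_def partition_on_def by auto
  have obt: "\<exists>J\<in>Q. s = interior J \<and> s \<subseteq> J \<and> J \<subseteq> {a..b}" if "s \<in> P" for s
    using that cover interior_subset unfolding P by blast
  show ?thesis
  proof
    show "a < b" by fact
    show "finite P" unfolding P using fin by simp
    show "T \<in> {a..b} \<rightarrow> {a..b}" using assms(2) unfolding piecewise_monotone_def by simp
    show "finite ({a..b} - \<Union>P)"
    proof (rule finite_subset)
      show "{a..b} - \<Union>P \<subseteq> (\<Union>J\<in>Q. J - interior J)"
      proof
        fix x assume x: "x \<in> {a..b} - \<Union>P"
        then have "x \<in> \<Union>Q" unfolding cover by simp
        then obtain J where "J \<in> Q" "x \<in> J" by blast
        moreover have "x \<notin> interior J" using x \<open>J \<in> Q\<close> unfolding P by fastforce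
        ultimately show "x \<in> (\<Union>J\<in>Q. J - interior J)" by blast
      qed
      show "finite (\<Union>J\<in>Q. J - interior J)"
        using fin J cover by (intro finite_UN_I finite_interval_minus_interior[of _ a b]) auto
    qed
    fix s assume s: "s \<in> P"
    then obtain I where I: "I \<in> Q" "s = interior I" "s \<subseteq> I" "I \<subseteq> {a..b}" using obt by blast
    show "open s" unfolding I(2) by simp
    show "s \<noteq> {}" using s unfolding P by simp
    show "s \<subseteq> {a..b}" using I by blast
    show "is_interval s" using J[OF I(1)] convex_interior unfolding I(2) is_interval_convex_1 by blast
    show "continuous_on s T" using J[OF I(1)] I(3) continuous_on_subset by blast
    have "mono_or_anti T I" using J[OF I(1)] unfolding mono_or_anti_def by blast
    then show "mono_or_anti T s" using I(3) by (rule mono_or_anti_subset)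
    fix t x assume t: "t \<in> P" "x \<in> s" "x \<in> t"
    then obtain I' where I': "I' \<in> Q" "t = interior I'" "t \<subseteq> I'" using obt by blast
    have "x \<in> I \<inter> I'" using t(2,3) I(3) I'(3) by blast
    then have "I = I'" using disjointD[OF disj I(1) I'(1)] by blast
    then show "s = t" using I(2) I'(2) by simp
  qed
qed

theorem theorem13:
  fixes a b :: real and T :: "real \<Rightarrow> real" and P :: "real set set"
  assumes "a < b"
    and "piecewise_monotone a b T"
    and "natural_partition a b T P"
  shows
    "(\<forall>\<mu>. invariant_prob (nat_extension_topology T P) left_shift \<mu> \<longrightarrow>
          emeasure \<mu> (markov_part (nat_extension T P)) = 0 \<longrightarrow> KS_entropy \<mu> left_shift = 0) \<and>
     entropy_conjugacy
       (hofbauer_topology (nat_extension T P)) left_shift (hofbauer_shift (nat_extension T P))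
       (nat_extension_topology T P) left_shift (markov_part (nat_extension T P))
       hofbauer_proj \<and>
     (\<exists>F. finite F \<and> F \<subseteq> {A \<in> nat_extension T P. periodic left_shift A} \<and>
        (\<forall>A \<in> nat_extension T P - F.
           (\<forall>p. shadowed_at (kneading T P) A p) \<longleftrightarrow>
           (\<forall>p. \<not> markov_at (nat_extension T P) A p))) \<and>
     (\<exists>E. finite E \<and> E \<subseteq> periodic_orbits left_shift (hofbauer_shift (nat_extension T P)) \<and>
        bij_betw one_sided_image
          (periodic_orbits left_shift (hofbauer_shift (nat_extension T P)) - E)
          (one_sided_image ` (periodic_orbits left_shift (hofbauer_shift (nat_extension T P)) - E)) \<and>
        (\<forall>Orb \<in> periodic_orbits left_shift (hofbauer_shift (nat_extension T P)) - E.
           one_sided_image Orb \<in> periodic_orbits left_shift (symb_dyn T P) \<and>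
           card (one_sided_image Orb) = card Orb))"
proof -
  interpret monotone_partition a b T P
    using assms by (rule natural_partition_imp_monotone_partition)
  have zero: "KS_entropy \<mu> left_shift = 0"
    if "invariant_prob (nat_extension_topology T P) left_shift \<mu>" "emeasure \<mu> (markov_part \<Sigma>) = 0" for \<mu>
    using that unfolding nat_extension_topology_def
    by (intro KS_entropy_non_markov[OF _ finite_kneading]) (use markov_at_if_not_shadowed in blast)+
  then have "zero_entropy_outside (nat_extension_topology T P) left_shift (markov_part \<Sigma>)"
    unfolding zero_entropy_outside_def by blast
  then have conj: "entropy_conjugacy (hofbauer_topology \<Sigma>) left_shift (hofbauer_shift \<Sigma>)
      (nat_extension_topology T P) left_shift (markov_part \<Sigma>) hofbauer_proj"
    unfolding nat_extension_topology_def hofbauer_topology_def by (rule entropy_conjugacy_hofbauer_proj)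
  have tail: "(\<lambda>k. A (int k)) \<in> symb_dyn T P" if "A \<in> \<Sigma>" for A
  proof -
    have "\<forall>p. (\<lambda>k. A (p + int k)) \<in> symb_dyn T P" using that unfolding nat_extension_def by blast
    from spec[OF this, of 0] show ?thesis by simp
  qed
  let ?O = "periodic_orbits left_shift (hofbauer_shift \<Sigma>)"
  have "\<exists>E. finite E \<and> E \<subseteq> ?O \<and> bij_betw one_sided_image (?O - E) (one_sided_image ` (?O - E)) \<and>
      (\<forall>Orb \<in> ?O - E. one_sided_image Orb \<in> periodic_orbits left_shift (symb_dyn T P) \<and>
           card (one_sided_image Orb) = card Orb)"
    using bij_betw_one_sided_image[OF refl] one_sided_image_periodic_orbit tail
    by (intro exI[of _ "{}"]) simp
  then show ?thesis
    by (intro conjI conj shadowed_iff_non_markov allI impI zero)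
qed

end
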